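(* For $1\le i\le n$ let $K_i(z,w)=\sum_{k=0}^{\infty}a_{i,k}z^k\bar w^k$, $z,w\in\mathbb{D}$, with $a_{i,k}>0$ for all $k$, and suppose that the reproducing kernel Hilbert space $\mathcal{H}_{K_i}$ is Möbius invariant and that the multiplication operator $M_{i,z}$ by $z$ on $\mathcal{H}_{K_i}$ is bounded. Suppose that $\lim_{k\to\infty}k\sqrt{\frac{a_{i,k}}{a_{i+1,k}}}=\infty$ for $1\le i\le n-1$, that $\mathcal{H}_{K_1}\subseteq\mathcal{H}_{K_2}\subseteq\cdots\subseteq\mathcal{H}_{K_n}$, and that $\mathrm{Mult}(\mathcal{H}_{K_i})=H^\infty(\mathbb{D})$ for $1\le i\le n$. For $1\le i\le n-1$ let $\psi_{i,i+1}\in C(\bar{\mathbb{D}})\cap\mathrm{Hol}(\mathbb{D})$ be a non-zero function. Let $T$ be the operator on $\mathcal{H}_{K_1}\oplus\cdots\oplus\mathcal{H}_{K_n}$ given by the upper-triangular operator matrix $$T=\begin{pmatrix} M_{1,z}^{*}&M_{\psi_{1,2}}^{*}&T_{1,3}&\cdots&T_{1,n}\\ 0&M_{2,z}^{*}&M_{\psi_{2,3}}^{*}&\cdots&T_{2,n}\\ \vdots&\ddots&\ddots&\ddots&\vdots\\ 0&\cdots&0&M_{n-1,z}^{*}&M_{\psi_{n-1,n}}^{*}\\ 0&\cdots&\cdots&0&M_{n,z}^{*} \end{pmatrix},$$ where $T$ satisfies Condition (A). Then $T$ is weakly homogeneous if and only if each $\psi_{i,i+1}$, $1\le i\le n-1$,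 is non-vanishing (i.e. has no zero in $\bar{\mathbb{D}}$).
   Context: $\mathbb{D}$ is the open unit disc, $\bar{\mathbb{D}}$ its closure; $\mathrm{Hol}(\mathbb{D})$ is the space of analytic functions on $\mathbb{D}$, $C(\bar{\mathbb{D}})$ the continuous functions on $\bar{\mathbb{D}}$, $H^\infty(\mathbb{D})$ the bounded holomorphic functions on $\mathbb{D}$. All Hilbert spaces are complex and separable; $\mathcal{L}(\mathcal{H})$ is the algebra of bounded linear operators on $\mathcal{H}$, and $\{A\}'$ denotes the commutant of $A\in\mathcal{L}(\mathcal{H})$. $\mathcal{H}_K$ is the reproducing kernel Hilbert space of holomorphic functions on $\mathbb{D}$ with reproducing kernel $K$. $\mathrm{Mult}(\mathcal{H})=\{\psi\in\mathrm{Hol}(\mathbb{D}):\psi f\in\mathcal{H}\text{ for all }f\in\mathcal{H}\}$. $M_{\psi_{i,i+1}}:\mathcal{H}_{K_i}\to\mathcal{H}_{K_{i+1}}$ is the (bounded) operator of multiplication by $\psi_{i,i+1}$, so $M_{\psi_{i,i+1}}^*:\mathcal{H}_{K_{i+1}}\to\mathcal{H}_{K_i}$. Möb is the group of biholomorphic automorphisms of $\mathbb{D}$. A Hilbert space $\mathcal{H}$ of holomorphic functions on $\mathbb{D}$ is Möbius invariant if $f\circ\phi\in\mathcal{H}$ for all $f\in\mathcal{H}$ and $\phi\in$ Möb. An operator $T\in\mathcal{L}(\mathcal{H})$ is weakly homogeneous if $\sigma(T)\subseteq\bar{\mathbb{D}}$ and $\phi(T)$ is similar to $T$ for all $\phi\in$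 Möb. The Cowen-Douglas class $\mathcal{B}_1(\mathbb{D})$ consists of the bounded operators $T$ on a Hilbert space $\mathcal{H}$ such that: (1) $\mathbb{D}\subset\sigma(T)$; (2) $\mathrm{ran}(T-w)=\mathcal{H}$ for all $w\in\mathbb{D}$; (3) the closed linear span of $\bigcup_{w\in\mathbb{D}}\ker(T-w)$ is $\mathcal{H}$; (4) $\dim\ker(T-w)=1$ for all $w\in\mathbb{D}$. $\mathcal{FB}_n(\mathbb{D})$ is the collection of all bounded operators $T$ on a Hilbert space $\mathcal{H}=\mathcal{H}_1\oplus\cdots\oplus\mathcal{H}_n$ that are upper-triangular $n\times n$ operator matrices $T=((T_{i,j}))$ (with $T_{i,j}:\mathcal{H}_j\to\mathcal{H}_i$ and $T_{i,j}=0$ for $i>j$), where each $T_{i,i}\in\mathcal{L}(\mathcal{H}_i)$ is in $\mathcal{B}_1(\mathbb{D})$ and each $T_{i,i+1}$, $1\le i\le n-1$, is a non-zero bounded operator with $T_{i,i}T_{i,i+1}=T_{i,i+1}T_{i+1,i+1}$. An operator $T=((T_{i,j}))\in\mathcal{FB}_n(\mathbb{D})$ satisfies Condition (A) if for all $1\le i<j\le n$ there is an operator $\phi_{i,j}(T_{i,i})\in\{T_{i,i}\}'$ such that $T_{i,j}=\phi_{i,j}(T_{i,i})\,T_{i,i+1}T_{i+1,i+2}\cdots T_{j-1,j}$ (here $\phi_{i,j}(T_{i,i})$ is simply notation for an element of the commutant). *)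

theory Defs
  imports "HOL-Complex_Analysis.Complex_Analysis" "HOL-Library.Function_Algebras"
begin

section \<open>Complex vector spaces and Hilbert spaces on carrier sets\<close>

class complex_vector = ab_group_add +
  fixes scaleC :: "complex \<Rightarrow> 'a \<Rightarrow> 'a"  (infixr "*\<^sub>C" 75)
  assumes scaleC_add_right: "c *\<^sub>C (x + y) = c *\<^sub>C x + c *\<^sub>C y"
    and scaleC_add_left: "(c + d) *\<^sub>C x = c *\<^sub>C x + d *\<^sub>C x"
    and scaleC_scaleC: "c *\<^sub>C d *\<^sub>C x = (c * d) *\<^sub>C x"
    and scaleC_one: "1 *\<^sub>C x = x"

lemma vector_space_scaleC:
  "vector_space (scaleC :: complex \<Rightarrow> 'a \<Rightarrow> 'a::complex_vector)"
  by unfold_locales (auto simp: scaleC_add_right scaleC_add_left scaleC_scaleC scaleC_one)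

instantiation complex :: complex_vector
begin

definition scaleC_complex_def: "c *\<^sub>C (x::complex) = c * x"

instance
  by standard (auto simp: scaleC_complex_def algebra_simps)

end

instantiation "fun" :: (type, complex_vector) complex_vector
begin

definition scaleC_fun_def: "c *\<^sub>C f = (\<lambda>x. c *\<^sub>C f x)"

instance
  by standard
    (auto simp: scaleC_fun_def fun_eq_iff scaleC_add_right scaleC_add_left scaleC_scaleC scaleC_one)

end

text \<open>The values of \<open>hinner\<close> outside of \<open>hcarrier\<close> are irrelevant. The inner product is
  linear in its first argument.\<close>

record 'a hspace =
  hcarrier :: "'a set"
  hinner :: "'a \<Rightarrow> 'a \<Rightarrow> complex"

definition hnorm :: "'a hspace \<Rightarrow> 'a \<Rightarrow> real" where
  "hnorm H x = sqrt (Re (hinner H x x))"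

definition hilbert_space :: "'a::complex_vector hspace \<Rightarrow> bool" where
  "hilbert_space H \<longleftrightarrow>
     module.subspace scaleC (hcarrier H) \<and>
     (\<forall>x\<in>hcarrier H. \<forall>y\<in>hcarrier H. \<forall>z\<in>hcarrier H.
        hinner H (x + y) z = hinner H x z + hinner H y z) \<and>
     (\<forall>c. \<forall>x\<in>hcarrier H. \<forall>y\<in>hcarrier H. hinner H (c *\<^sub>C x) y = c * hinner H x y) \<and>
     (\<forall>x\<in>hcarrier H. \<forall>y\<in>hcarrier H. hinner H y x = cnj (hinner H x y)) \<and>
     (\<forall>x\<in>hcarrier H. x \<noteq> 0 \<longrightarrow> Re (hinner H x x) > 0) \<and>
     (\<forall>X :: nat \<Rightarrow> 'a.
        (\<forall>k. X k \<in> hcarrier H) \<and>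
        (\<forall>e>0. \<exists>N. \<forall>k\<ge>N. \<forall>m\<ge>N. hnorm H (X k - X m) < e) \<longrightarrow>
        (\<exists>x\<in>hcarrier H. (\<lambda>k. hnorm H (X k - x)) \<longlonglongrightarrow> 0)) \<and>
     (\<exists>S. countable S \<and> S \<subseteq> hcarrier H \<and>
        (\<forall>x\<in>hcarrier H. \<forall>e>0. \<exists>y\<in>S. hnorm H (x - y) < e))"

definition hclosed_span :: "'a::complex_vector hspace \<Rightarrow> 'a set \<Rightarrow> 'a set" where
  "hclosed_span H S =
     {x \<in> hcarrier H. \<forall>e>0. \<exists>y \<in> module.span scaleC S. hnorm H (x - y) < e}"


section \<open>Bounded operators\<close>

text \<open>Operators are functions on the ambient type; only their values on the carrier of the
  domain matter.\<close>

definition bounded_op ::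
    "'a::complex_vector hspace \<Rightarrow> 'b::complex_vector hspace \<Rightarrow> ('a \<Rightarrow> 'b) \<Rightarrow> bool" where
  "bounded_op H1 H2 A \<longleftrightarrow>
     (\<forall>x\<in>hcarrier H1. A x \<in> hcarrier H2) \<and>
     (\<forall>x\<in>hcarrier H1. \<forall>y\<in>hcarrier H1. A (x + y) = A x + A y) \<and>
     (\<forall>c. \<forall>x\<in>hcarrier H1. A (c *\<^sub>C x) = c *\<^sub>C A x) \<and>
     (\<exists>C. \<forall>x\<in>hcarrier H1. hnorm H2 (A x) \<le> C * hnorm H1 x)"

definition adjoint_op :: "'a hspace \<Rightarrow> 'b hspace \<Rightarrow> ('a \<Rightarrow> 'b) \<Rightarrow> 'b \<Rightarrow> 'a" where
  "adjoint_op H1 H2 A y =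
     (THE x. x \<in> hcarrier H1 \<and> (\<forall>u\<in>hcarrier H1. hinner H2 (A u) y = hinner H1 u x))"

definition inverse_ops :: "'a::complex_vector hspace \<Rightarrow> ('a \<Rightarrow> 'a) \<Rightarrow> ('a \<Rightarrow> 'a) \<Rightarrow> bool" where
  "inverse_ops H X Y \<longleftrightarrow> bounded_op H H X \<and> bounded_op H H Y \<and>
     (\<forall>x\<in>hcarrier H. Y (X x) = x \<and> X (Y x) = x)"

definition op_spectrum :: "'a::complex_vector hspace \<Rightarrow> ('a \<Rightarrow> 'a) \<Rightarrow> complex set" where
  "op_spectrum H T = {w. \<not> (\<exists>Y. inverse_ops H (\<lambda>x. T x - w *\<^sub>C x) Y)}"

definition similar_ops :: "'a::complex_vector hspace \<Rightarrow> ('a \<Rightarrow> 'a) \<Rightarrow> ('a \<Rightarrow> 'a) \<Rightarrow> bool" where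
  "similar_ops H A B \<longleftrightarrow>
     (\<exists>X Y. inverse_ops H X Y \<and> (\<forall>x\<in>hcarrier H. X (A x) = B (X x)))"

definition commutant :: "'a::complex_vector hspace \<Rightarrow> ('a \<Rightarrow> 'a) \<Rightarrow> ('a \<Rightarrow> 'a) set" where
  "commutant H A = {B. bounded_op H H B \<and> (\<forall>x\<in>hcarrier H. B (A x) = A (B x))}"

definition op_kernel :: "'a::complex_vector hspace \<Rightarrow> ('a \<Rightarrow> 'a) \<Rightarrow> complex \<Rightarrow> 'a set" where
  "op_kernel H T w = {x \<in> hcarrier H. T x - w *\<^sub>C x = 0}"

definition cowen_douglas_1 :: "'a::complex_vector hspace \<Rightarrow> ('a \<Rightarrow> 'a) \<Rightarrow> bool" where
  "cowen_douglas_1 H T \<longleftrightarrow>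
     bounded_op H H T \<and>
     ball 0 1 \<subseteq> op_spectrum H T \<and>
     (\<forall>w\<in>ball 0 1. (\<lambda>x. T x - w *\<^sub>C x) ` hcarrier H = hcarrier H) \<and>
     hclosed_span H (\<Union>w\<in>ball 0 1. op_kernel H T w) = hcarrier H \<and>
     (\<forall>w\<in>ball 0 1. vector_space.dim scaleC (op_kernel H T w) = 1)"


section \<open>The group Moeb and weak homogeneity\<close>

text \<open>Elements of Moeb are represented by functions on the whole plane, of which only the
  values on the unit disc matter.\<close>

definition Moeb :: "(complex \<Rightarrow> complex) set" where
  "Moeb = {\<phi>. \<phi> holomorphic_on ball 0 1 \<and> \<phi> ` ball 0 1 \<subseteq> ball 0 1 \<and>
     (\<exists>\<eta>. \<eta> holomorphic_on ball 0 1 \<and> \<eta> ` ball 0 1 \<subseteq> ball 0 1 \<and>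
        (\<forall>z\<in>ball 0 1. \<eta> (\<phi> z) = z \<and> \<phi> (\<eta> z) = z))}"

definition poly_op :: "complex poly \<Rightarrow> ('a::complex_vector \<Rightarrow> 'a) \<Rightarrow> 'a \<Rightarrow> 'a" where
  "poly_op p T x = (\<Sum>k\<le>degree p. coeff p k *\<^sub>C (T ^^ k) x)"

text \<open>\<open>S = \<phi>(T)\<close> for an operator \<open>T\<close> with spectrum in the closed unit disc and a function
  \<open>\<phi> = p / q\<close>, where \<open>p\<close> and \<open>q\<close> are polynomials and \<open>q\<close> has no zeros in the closed disc, by
  the rational functional calculus: \<open>\<phi>(T) = p(T) q(T)\<^sup>-\<^sup>1\<close>. This does not depend on \<open>p\<close> and
  \<open>q\<close>. It covers all of Moeb, whose elements are \<open>z \<mapsto> c (z - b) / (1 - cnj b * z)\<close> with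
  \<open>|c| = 1\<close> and \<open>|b| < 1\<close>, for which it reads \<open>\<phi>(T) = c (T - b) (1 - cnj b * T)\<^sup>-\<^sup>1\<close>.\<close>

definition is_fun_of_op ::
    "'a::complex_vector hspace \<Rightarrow> ('a \<Rightarrow> 'a) \<Rightarrow> (complex \<Rightarrow> complex) \<Rightarrow> ('a \<Rightarrow> 'a) \<Rightarrow> bool" where
  "is_fun_of_op H T \<phi> S \<longleftrightarrow>
     (\<exists>p q. (\<forall>z\<in>cball 0 1. poly q z \<noteq> 0) \<and>
        (\<forall>z\<in>ball 0 1. \<phi> z = poly p z / poly q z) \<and>
        (\<forall>x\<in>hcarrier H. S x = poly_op p T (inv_into (hcarrier H) (poly_op q T) x)))"

definition weakly_homogeneous :: "'a::complex_vector hspace \<Rightarrow> ('a \<Rightarrow> 'a) \<Rightarrow> bool" where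
  "weakly_homogeneous H T \<longleftrightarrow>
     bounded_op H H T \<and> op_spectrum H T \<subseteq> cball 0 1 \<and>
     (\<forall>\<phi>\<in>Moeb. \<exists>S. is_fun_of_op H T \<phi> S \<and> similar_ops H S T)"


section \<open>Reproducing kernel Hilbert spaces on the unit disc\<close>

text \<open>A function on the unit disc is represented by its extension by zero, so that functions
  agreeing on the disc are equal as elements of the space.\<close>

definition on_disc :: "(complex \<Rightarrow> complex) \<Rightarrow> complex \<Rightarrow> complex" where
  "on_disc f = (\<lambda>z. if z \<in> ball 0 1 then f z else 0)"

text \<open>\<open>H\<close> is the space \<open>\<H>\<^sub>K\<close>. The kernel \<open>K\<close> determines the carrier and the inner
  product on it.\<close>

definition rkhs_disc ::
    "(complex \<Rightarrow> complex) hspace \<Rightarrow> (complex \<Rightarrow> complex \<Rightarrow> complex) \<Rightarrow> bool" where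
  "rkhs_disc H K \<longleftrightarrow>
     hilbert_space H \<and>
     (\<forall>f\<in>hcarrier H. f holomorphic_on ball 0 1 \<and> on_disc f = f) \<and>
     (\<forall>w\<in>ball 0 1. on_disc (\<lambda>z. K z w) \<in> hcarrier H \<and>
        (\<forall>f\<in>hcarrier H. f w = hinner H f (on_disc (\<lambda>z. K z w))))"

definition diag_kernel :: "(nat \<Rightarrow> real) \<Rightarrow> complex \<Rightarrow> complex \<Rightarrow> complex" where
  "diag_kernel a z w = (\<Sum>k. of_real (a k) * z ^ k * cnj w ^ k)"

definition moebius_invariant :: "(complex \<Rightarrow> complex) hspace \<Rightarrow> bool" where
  "moebius_invariant H \<longleftrightarrow>
     (\<forall>\<phi>\<in>Moeb. \<forall>f\<in>hcarrier H. on_disc (f \<circ> \<phi>) \<in> hcarrier H)"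

definition mult_op :: "(complex \<Rightarrow> complex) \<Rightarrow> (complex \<Rightarrow> complex) \<Rightarrow> complex \<Rightarrow> complex" where
  "mult_op \<psi> f = (\<lambda>z. \<psi> z * f z)"

definition Mult :: "(complex \<Rightarrow> complex) hspace \<Rightarrow> (complex \<Rightarrow> complex) set" where
  "Mult H = {\<psi>. \<psi> holomorphic_on ball 0 1 \<and> (\<forall>f\<in>hcarrier H. mult_op \<psi> f \<in> hcarrier H)}"

definition H_infinity :: "(complex \<Rightarrow> complex) set" where
  "H_infinity = {\<psi>. \<psi> holomorphic_on ball 0 1 \<and> bounded (\<psi> ` ball 0 1)}"


section \<open>Operator matrices on direct sums\<close>

text \<open>An element of \<open>H 1 \<oplus> \<dots> \<oplus> H n\<close> is the sequence of its components, continued by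
  zero.\<close>

definition direct_sum :: "nat \<Rightarrow> (nat \<Rightarrow> 'a::complex_vector hspace) \<Rightarrow> (nat \<Rightarrow> 'a) hspace" where
  "direct_sum n H =
     \<lparr> hcarrier = {x. (\<forall>i\<in>{1..n}. x i \<in> hcarrier (H i)) \<and> (\<forall>i. i \<notin> {1..n} \<longrightarrow> x i = 0)},
       hinner = (\<lambda>x y. \<Sum>i=1..n. hinner (H i) (x i) (y i)) \<rparr>"

definition op_matrix ::
    "nat \<Rightarrow> (nat \<Rightarrow> nat \<Rightarrow> 'a \<Rightarrow> 'a) \<Rightarrow> (nat \<Rightarrow> 'a::complex_vector) \<Rightarrow> nat \<Rightarrow> 'a" where
  "op_matrix n T x = (\<lambda>i. if i \<in> {1..n} then \<Sum>j=1..n. T i j (x j) else 0)"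

text \<open>The operator given by a finite operator matrix is bounded iff all of the entries are.\<close>

definition FB_class ::
    "nat \<Rightarrow> (nat \<Rightarrow> 'a::complex_vector hspace) \<Rightarrow> (nat \<Rightarrow> nat \<Rightarrow> 'a \<Rightarrow> 'a) \<Rightarrow> bool" where
  "FB_class n H T \<longleftrightarrow>
     (\<forall>i\<in>{1..n}. \<forall>j\<in>{1..n}. bounded_op (H j) (H i) (T i j)) \<and>
     (\<forall>i\<in>{1..n}. \<forall>j\<in>{1..<i}. \<forall>x\<in>hcarrier (H j). T i j x = 0) \<and>
     (\<forall>i\<in>{1..n}. cowen_douglas_1 (H i) (T i i)) \<and>
     (\<forall>i\<in>{1..<n}.
        (\<exists>x\<in>hcarrier (H (i + 1)). T i (i + 1) x \<noteq> 0) \<and>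
        (\<forall>x\<in>hcarrier (H (i + 1)). T i i (T i (i + 1) x) = T i (i + 1) (T (i + 1) (i + 1) x)))"

text \<open>\<open>superdiag_prod T i m\<close> is \<open>T\<^sub>i\<^sub>,\<^sub>i\<^sub>+\<^sub>1 T\<^sub>i\<^sub>+\<^sub>1\<^sub>,\<^sub>i\<^sub>+\<^sub>2 \<cdots>\<close> with \<open>m\<close> factors.\<close>

primrec superdiag_prod :: "(nat \<Rightarrow> nat \<Rightarrow> 'a \<Rightarrow> 'a) \<Rightarrow> nat \<Rightarrow> nat \<Rightarrow> 'a \<Rightarrow> 'a" where
  "superdiag_prod T i 0 = id"
| "superdiag_prod T i (Suc m) = superdiag_prod T i m \<circ> T (i + m) (i + m + 1)"

text \<open>Condition (A) is a condition on operators in \<open>\<F>\<B>\<^sub>n(\<D>)\<close>, so it includes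
  membership in that class.\<close>

definition condition_A ::
    "nat \<Rightarrow> (nat \<Rightarrow> 'a::complex_vector hspace) \<Rightarrow> (nat \<Rightarrow> nat \<Rightarrow> 'a \<Rightarrow> 'a) \<Rightarrow> bool" where
  "condition_A n H T \<longleftrightarrow>
     FB_class n H T \<and>
     (\<forall>i j. 1 \<le> i \<and> i < j \<and> j \<le> n \<longrightarrow>
        (\<exists>\<Phi>\<in>commutant (H i) (T i i).
           \<forall>x\<in>hcarrier (H j). T i j x = \<Phi> (superdiag_prod T i (j - i) x)))"

end

theory Submission
  imports Defs
begin

text \<open>
  Passing to adjoints turns the problem into one about matrices of functions. By Condition (A) and
  \<open>commutant_shift_adjoint\<close> the adjoint of \<open>T\<close> is multiplication by a lower triangular matrix \<open>G\<close>
  of bounded holomorphic functions, with \<open>z\<close> on the diagonal and the functions \<open>\<psi> i\<close> next to it. The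
  adjoint of \<open>\<phi>(T)\<close> is multiplication by \<open>\<theta>(G)\<close> for the Moebius map \<open>\<theta>(z) = cnj (\<phi> (cnj z))\<close>, with
  \<open>\<theta>\<close> on the diagonal and \<open>\<theta>' \<cdot> \<psi> i\<close> next to it (\<open>function_of_op_adjoint\<close>). So \<open>T\<close> and \<open>\<phi>(T)\<close> are
  similar iff multiplication by \<open>G\<close> is similar to multiplication by \<open>\<theta>(G)\<close>. Composition with
  \<open>\<theta>\<close>, which is bounded by Moebius invariance and the closed graph theorem, replaces \<open>G\<close> by
  \<open>G \<circ> \<theta>\<close>.

  If no \<open>\<psi> i\<close> vanishes on the closed disc, then \<open>\<theta>(G)\<close> and \<open>G \<circ> \<theta>\<close> have the same diagonal and units of
  \<open>H\<^sup>\<infinity>\<close> next to it. Such matrices are conjugate over \<open>H\<^sup>\<infinity>\<close>, both being conjugate to a Jordan block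
  (\<open>lower_tri_intertwiner\<close>), and matrices over \<open>H\<^sup>\<infinity>\<close> that are lower triangular act boundedly,
  because the spaces increase and \<open>H\<^sup>\<infinity>\<close> consists of multipliers.

  Conversely, let \<open>Z\<close> be an invertible operator that intertwines multiplication by two such matrices
  with diagonal \<open>z\<close>. Its entries satisfy commutation relations with the shifts, in which errors are
  multiplication operators. Such a multiplication operator, being a commutator with the shift, must
  vanish (\<open>commutator_mult_zero\<close>): this is a growth argument on monomials, and uses the limit
  condition on the kernels. It follows that \<open>Z\<close> is lower triangular (\<open>entry_upper_zero\<close>), that its
  diagonal entries are multiplications by units \<open>x i\<close> of \<open>H\<^sup>\<infinity>\<close>, and that the entries of the two
  matrices next to the diagonal are related by these units (\<open>similar_shift_tri\<close>). Applied to \<open>T\<close>, this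
  says that \<open>\<theta>' \<cdot> \<psi> i\<close> and \<open>\<psi> i \<circ> \<theta>\<close> differ by a unit for every Moebius map \<open>\<theta>\<close>. So the zero set of \<open>\<psi> i\<close> is
  invariant under the Moebius group, and it is empty as \<open>\<psi> i\<close> is not identically zero
  (\<open>zero_free_if_Moebius_quasi_invariant\<close>).
\<close>

section \<open>Complete inner product spaces\<close>

interpretation cv: vector_space "scaleC :: complex \<Rightarrow> 'a \<Rightarrow> 'a::complex_vector"
  by (rule vector_space_scaleC)

lemma scaleC_complex_mult [simp]: "c *\<^sub>C (x::complex) = c * x"
  by (simp add: scaleC_complex_def)

lemma scaleC_fun_apply [simp]: "(c *\<^sub>C f) x = c *\<^sub>C f x"
  by (simp add: scaleC_fun_def)

locale complete_ips =
  fixes H :: "'a::complex_vector hspace"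
  assumes subspace: "module.subspace scaleC (hcarrier H)"
    and ip_add: "\<And>x y z. x \<in> hcarrier H \<Longrightarrow> y \<in> hcarrier H \<Longrightarrow> z \<in> hcarrier H \<Longrightarrow>
        hinner H (x + y) z = hinner H x z + hinner H y z"
    and ip_scale: "\<And>c x y. x \<in> hcarrier H \<Longrightarrow> y \<in> hcarrier H \<Longrightarrow>
        hinner H (c *\<^sub>C x) y = c * hinner H x y"
    and ip_cnj: "\<And>x y. x \<in> hcarrier H \<Longrightarrow> y \<in> hcarrier H \<Longrightarrow> hinner H y x = cnj (hinner H x y)"
    and ip_pos: "\<And>x. x \<in> hcarrier H \<Longrightarrow> x \<noteq> 0 \<Longrightarrow> Re (hinner H x x) > 0"
    and complete: "\<And>X. (\<And>k. X k \<in> hcarrier H) \<Longrightarrow>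
        (\<And>e. e > 0 \<Longrightarrow> \<exists>N. \<forall>k\<ge>N. \<forall>m\<ge>N. hnorm H (X k - X m) < e) \<Longrightarrow>
        \<exists>x\<in>hcarrier H. (\<lambda>k. hnorm H (X k - x)) \<longlonglongrightarrow> 0"

lemma hilbert_space_complete_ips: "hilbert_space H \<Longrightarrow> complete_ips H"
proof (unfold hilbert_space_def, elim conjE, rule complete_ips.intro, goal_cases)
  case (6 X)
  from 6(6) have "(\<forall>k. X k \<in> hcarrier H) \<and>
      (\<forall>e>0. \<exists>N. \<forall>k\<ge>N. \<forall>m\<ge>N. hnorm H (X k - X m) < e) \<longrightarrow>
      (\<exists>x\<in>hcarrier H. (\<lambda>k. hnorm H (X k - x)) \<longlonglongrightarrow> 0)" by (rule spec)
  then show ?case using 6(8,9) by blast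
qed blast+

context complete_ips
begin

abbreviation "C \<equiv> hcarrier H"
abbreviation "ip \<equiv> hinner H"
abbreviation "nm \<equiv> hnorm H"

lemma zero_mem [simp]: "0 \<in> C"
  by (rule cv.subspace_0[OF subspace])

lemma add_mem: "x \<in> C \<Longrightarrow> y \<in> C \<Longrightarrow> x + y \<in> C"
  by (rule cv.subspace_add[OF subspace])

lemma scale_mem: "x \<in> C \<Longrightarrow> c *\<^sub>C x \<in> C"
  by (rule cv.subspace_scale[OF subspace])

lemma diff_mem: "x \<in> C \<Longrightarrow> y \<in> C \<Longrightarrow> x - y \<in> C"
  by (rule cv.subspace_diff[OF subspace])

lemma sum_mem: "(\<And>i. i \<in> I \<Longrightarrow> f i \<in> C) \<Longrightarrow> sum f I \<in> C"
  by (rule cv.subspace_sum[OF subspace])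

lemma ip_add_r: "\<lbrakk>x \<in> C; y \<in> C; z \<in> C\<rbrakk> \<Longrightarrow> ip x (y + z) = ip x y + ip x z"
  by (metis (no_types, lifting) add_mem complex_cnj_add ip_add ip_cnj)

lemma ip_scale_r: "\<lbrakk>x \<in> C; y \<in> C\<rbrakk> \<Longrightarrow> ip x (c *\<^sub>C y) = cnj c * ip x y"
  by (metis (no_types, lifting) scale_mem complex_cnj_mult ip_scale ip_cnj)

lemma ip_zero [simp]: "y \<in> C \<Longrightarrow> ip 0 y = 0" "y \<in> C \<Longrightarrow> ip y 0 = 0"
  using ip_scale[of 0 y 0] ip_scale_r[of y 0 0] by auto

lemma ip_diff: "\<lbrakk>x \<in> C; y \<in> C; z \<in> C\<rbrakk> \<Longrightarrow> ip (x - y) z = ip x z - ip y z"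
  using ip_add[of "x - y" y z] diff_mem[of x y] by simp

lemma ip_diff_r: "\<lbrakk>x \<in> C; y \<in> C; z \<in> C\<rbrakk> \<Longrightarrow> ip x (y - z) = ip x y - ip x z"
  using ip_add_r[of x "y - z" z] diff_mem[of y z] by simp

lemma ip_sum: "finite I \<Longrightarrow> (\<And>i. i \<in> I \<Longrightarrow> f i \<in> C) \<Longrightarrow> y \<in> C \<Longrightarrow> ip (sum f I) y = (\<Sum>i\<in>I. ip (f i) y)"
  by (induction I rule: finite_induct) (auto simp: ip_add sum_mem)

lemma ip_sum_r: "finite I \<Longrightarrow> (\<And>i. i \<in> I \<Longrightarrow> f i \<in> C) \<Longrightarrow> y \<in> C \<Longrightarrow> ip y (sum f I) = (\<Sum>i\<in>I. ip y (f i))"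
  by (induction I rule: finite_induct) (auto simp: ip_add_r sum_mem)

lemma ip_self_Im: "x \<in> C \<Longrightarrow> Im (ip x x) = 0"
  using ip_cnj[of x x] by (metis cnj.simps(2) neg_equal_zero)

lemma ip_self_nonneg: "x \<in> C \<Longrightarrow> 0 \<le> Re (ip x x)"
  using ip_pos[of x] by (cases "x = 0") auto

lemma nm_sq: "x \<in> C \<Longrightarrow> (nm x)\<^sup>2 = Re (ip x x)"
  by (simp add: hnorm_def ip_self_nonneg)

lemma ip_self: "x \<in> C \<Longrightarrow> ip x x = of_real ((nm x)\<^sup>2)"
  by (simp add: nm_sq complex_eq_iff ip_self_Im)

lemma nm_nonneg [simp]: "x \<in> C \<Longrightarrow> 0 \<le> nm x"
  by (simp add: hnorm_def ip_self_nonneg)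

lemma nm_eq_0 [simp]: "x \<in> C \<Longrightarrow> nm x = 0 \<longleftrightarrow> x = 0"
  using ip_pos[of x] by (cases "x = 0") (auto simp: hnorm_def)

lemma nm_zero [simp]: "nm 0 = 0" by simp

lemma nm_scale: "x \<in> C \<Longrightarrow> nm (c *\<^sub>C x) = cmod c * nm x"
proof -
  assume x: "x \<in> C"
  have "ip (c *\<^sub>C x) (c *\<^sub>C x) = of_real ((cmod c)\<^sup>2) * ip x x"
    unfolding complex_norm_square using x by (simp add: ip_scale ip_scale_r scale_mem)
  then have "(nm (c *\<^sub>C x))\<^sup>2 = (cmod c * nm x)\<^sup>2"
    using x by (simp add: nm_sq scale_mem power_mult_distrib)
  then show ?thesis using x by (simp add: scale_mem)
qed

lemma nm_minus: "x \<in> C \<Longrightarrow> nm (- x) = nm x"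
  using nm_scale[of x "-1"] by (simp add: cv.scale_minus_left)

lemma nm_diff_commute: "x \<in> C \<Longrightarrow> y \<in> C \<Longrightarrow> nm (x - y) = nm (y - x)"
  using nm_minus[of "x - y"] by (simp add: diff_mem)

lemma nm_add_sq:
  assumes "x \<in> C" "y \<in> C"
  shows "(nm (x + y))\<^sup>2 = (nm x)\<^sup>2 + (nm y)\<^sup>2 + 2 * Re (ip x y)"
proof -
  have "Re (ip y x) = Re (ip x y)" using ip_cnj[of x y] assms by simp
  then show ?thesis using assms by (simp add: nm_sq add_mem ip_add ip_add_r)
qed

lemma nm_diff_sq:
  assumes "x \<in> C" "y \<in> C"
  shows "(nm (x - y))\<^sup>2 = (nm x)\<^sup>2 + (nm y)\<^sup>2 - 2 * Re (ip x y)"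
proof -
  have "Re (ip y x) = Re (ip x y)" using ip_cnj[of x y] assms by simp
  then show ?thesis using assms by (simp add: nm_sq diff_mem ip_diff ip_diff_r)
qed

lemma cauchy_schwarz:
  assumes x: "x \<in> C" and y: "y \<in> C"
  shows "cmod (ip x y) \<le> nm x * nm y"
proof (cases "y = 0")
  case False
  define N where "N = (nm y)\<^sup>2"
  have N: "N > 0" using False y ip_pos nm_sq N_def by simp
  define c where "c = ip x y / of_real N"
  have cc: "Re (ip x (c *\<^sub>C y)) = (cmod (ip x y))\<^sup>2 / N"
    using x y by (simp add: ip_scale_r c_def cmod_power2 Re_divide_of_real)
      (simp add: power2_eq_square add_divide_distrib)
  have n2: "(nm (c *\<^sub>C y))\<^sup>2 = (cmod (ip x y))\<^sup>2 / N"
    using x y N by (simp add: nm_scale c_def norm_divide power_mult_distrib power_divide N_def[symmetric])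
      (simp add: power2_eq_square)
  have "0 \<le> (nm (x - c *\<^sub>C y))\<^sup>2" by simp
  also have "\<dots> = (nm x)\<^sup>2 - (cmod (ip x y))\<^sup>2 / N"
    using nm_diff_sq[OF x scale_mem[OF y]] cc n2 by simp
  finally have "(cmod (ip x y))\<^sup>2 \<le> (nm x * nm y)\<^sup>2"
    using N by (simp add: field_simps N_def)
  then show ?thesis using x y by (simp add: abs_le_square_iff[symmetric])
qed (use x in simp)

lemma nm_triangle:
  assumes "x \<in> C" "y \<in> C" shows "nm (x + y) \<le> nm x + nm y"
proof -
  have "(nm (x + y))\<^sup>2 \<le> (nm x + nm y)\<^sup>2"
    using nm_add_sq[OF assms] cauchy_schwarz[OF assms] complex_Re_le_cmod[of "ip x y"]
    by (simp add: power2_sum)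
  then show ?thesis using assms by (meson add_nonneg_nonneg nm_nonneg power2_le_imp_le)
qed

lemma nm_triangle_diff: "x \<in> C \<Longrightarrow> y \<in> C \<Longrightarrow> z \<in> C \<Longrightarrow> nm (x - z) \<le> nm (x - y) + nm (y - z)"
  using nm_triangle[of "x - y" "y - z"] diff_mem by simp

lemma nm_diff_ge: "x \<in> C \<Longrightarrow> y \<in> C \<Longrightarrow> \<bar>nm x - nm y\<bar> \<le> nm (x - y)"
  using nm_triangle[of "x - y" y] nm_triangle[of "y - x" x] diff_mem nm_diff_commute[of x y] by force

lemma eqI: "x \<in> C \<Longrightarrow> y \<in> C \<Longrightarrow> (\<And>z. z \<in> C \<Longrightarrow> ip x z = ip y z) \<Longrightarrow> x = y"
  using ip_pos[of "x - y"] ip_diff[of x y "x - y"] diff_mem[of x y] by force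

lemma eqI_r: "x \<in> C \<Longrightarrow> y \<in> C \<Longrightarrow> (\<And>z. z \<in> C \<Longrightarrow> ip z x = ip z y) \<Longrightarrow> x = y"
  by (rule eqI) (metis ip_cnj)+

lemma ip_tendsto:
  assumes "\<And>k. X k \<in> C" "x \<in> C" "y \<in> C" "(\<lambda>k. nm (X k - x)) \<longlonglongrightarrow> 0"
  shows "(\<lambda>k. ip (X k) y) \<longlonglongrightarrow> ip x y"
proof -
  have "(\<lambda>k. ip (X k) y - ip x y) \<longlonglongrightarrow> 0"
  proof (rule Lim_null_comparison[OF always_eventually])
    show "\<forall>k. norm (ip (X k) y - ip x y) \<le> nm (X k - x) * nm y"
      using assms cauchy_schwarz[OF diff_mem] by (auto simp: ip_diff[symmetric])
    show "(\<lambda>k. nm (X k - x) * nm y) \<longlonglongrightarrow> 0" using tendsto_mult_left_zero[OF assms(4)] by simp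
  qed
  then show ?thesis by (simp add: LIM_zero_iff)
qed

lemma nm_tendsto:
  assumes "\<And>k. X k \<in> C" "x \<in> C" "(\<lambda>k. nm (X k - x)) \<longlonglongrightarrow> 0"
  shows "(\<lambda>k. nm (X k)) \<longlonglongrightarrow> nm x"
proof -
  have "(\<lambda>k. nm (X k) - nm x) \<longlonglongrightarrow> 0"
    by (rule Lim_null_comparison[OF always_eventually assms(3)]) (use assms nm_diff_ge in auto)
  then show ?thesis by (simp add: LIM_zero_iff)
qed

text \<open>The functional is represented by the minimiser of \<open>\<parallel>x\<parallel>\<^sup>2 - 2 Re (L x)\<close> on \<open>V\<close>, for which
  minimising sequences are Cauchy by the parallelogram law. Since \<open>V\<close> is not assumed to be
  closed, the minimiser is only a limit of vectors of \<open>V\<close>. For \<open>V\<close> the whole space this is the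
  Riesz representation theorem; for \<open>L = \<langle>\<cdot>, z\<rangle>\<close> it is the orthogonal projection of \<open>z\<close> to the closure
  of \<open>V\<close>.\<close>

lemma riesz_subspace:
  assumes V: "module.subspace scaleC V" "V \<subseteq> C"
    and L_add: "\<And>x y. x \<in> V \<Longrightarrow> y \<in> V \<Longrightarrow> L (x + y) = L x + L y"
    and L_scale: "\<And>c x. x \<in> V \<Longrightarrow> L (c *\<^sub>C x) = c * L x"
    and L_bd: "\<And>x. x \<in> V \<Longrightarrow> cmod (L x) \<le> B * nm x"
  obtains p X where "p \<in> C" "\<And>k. X k \<in> V" "(\<lambda>k. nm (X k - p)) \<longlonglongrightarrow> 0"
    "\<And>v. v \<in> V \<Longrightarrow> L v = ip v p"
proof -
  have Vadd: "x + y \<in> V" if "x \<in> V" "y \<in> V" for x y using V that cv.subspace_add by blast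
  have Vsc: "c *\<^sub>C x \<in> V" if "x \<in> V" for x c using V that cv.subspace_scale by blast
  have V0: "0 \<in> V" using V cv.subspace_0 by blast
  have VC: "x \<in> V \<Longrightarrow> x \<in> C" for x using V by blast
  define F where "F x = (nm x)\<^sup>2 - 2 * Re (L x)" for x
  have F_ge: "F x \<ge> - (B\<^sup>2)" if "x \<in> V" for x
  proof -
    have "Re (L x) \<le> B * nm x" using L_bd[OF that] complex_Re_le_cmod[of "L x"] by linarith
    moreover have "0 \<le> (nm x - B)\<^sup>2" by simp
    ultimately show ?thesis by (simp add: F_def power2_diff mult.commute)
  qed
  define m where "m = Inf (F ` V)"
  have bb: "bdd_below (F ` V)" by (rule bdd_belowI2[of _ "-(B\<^sup>2)"]) (rule F_ge)
  have m_le: "m \<le> F x" if "x \<in> V" for x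
    unfolding m_def by (rule cINF_lower[OF bb that])
  have "\<exists>x\<in>V. F x < m + 1 / real (Suc k)" for k
  proof -
    have "Inf (F ` V) < m + 1 / real (Suc k)" by (simp add: m_def)
    then show ?thesis using V0 by (subst (asm) cINF_less_iff[OF _ bb]) auto
  qed
  then obtain X where X: "\<And>k. X k \<in> V" "\<And>k. F (X k) < m + 1 / real (Suc k)" by metis
  have par: "(nm (X k - X l))\<^sup>2 \<le> 2 / real (Suc k) + 2 / real (Suc l)" for k l
  proof -
    let ?h = "(1/2) *\<^sub>C (X k + X l)"
    have h: "m \<le> F ?h" by (intro m_le Vsc Vadd X)
    have e1: "(nm ?h)\<^sup>2 = (nm (X k + X l))\<^sup>2 / 4"
      using VC[OF Vadd[OF X(1) X(1)]] by (simp add: nm_scale power_divide)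
    have e2: "Re (L ?h) = (Re (L (X k)) + Re (L (X l))) / 2"
      using X by (simp add: L_scale L_add Vadd)
    have "4 * m \<le> (nm (X k + X l))\<^sup>2 - 4 * Re (L (X k)) - 4 * Re (L (X l))"
      using h unfolding F_def e1 e2 by (simp add: add_divide_distrib)
    moreover have "(nm (X k + X l))\<^sup>2 + (nm (X k - X l))\<^sup>2 = 2 * (nm (X k))\<^sup>2 + 2 * (nm (X l))\<^sup>2"
      using nm_add_sq nm_diff_sq VC X(1) by simp
    ultimately show ?thesis using X(2)[of k] X(2)[of l] by (simp add: F_def)
  qed
  have "\<exists>N. \<forall>k\<ge>N. \<forall>l\<ge>N. nm (X k - X l) < e" if e: "e > 0" for e
  proof -
    obtain N where N: "4 / real (Suc N) < e\<^sup>2"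
    proof -
      obtain N where "inverse (real (Suc N)) < e\<^sup>2 / 4"
        using reals_Archimedean[of "e\<^sup>2/4"] e by auto
      then show ?thesis using that[of N] by (simp add: field_simps)
    qed
    have "nm (X k - X l) < e" if "k \<ge> N" "l \<ge> N" for k l
    proof -
      have "2 / real (Suc k) \<le> 2 / real (Suc N)" "2 / real (Suc l) \<le> 2 / real (Suc N)"
        using that by (auto simp: frac_le)
      then have "(nm (X k - X l))\<^sup>2 < e\<^sup>2" using par[of k l] N by simp
      then show ?thesis using e by (meson less_eq_real_def power2_less_imp_less)
    qed
    then show ?thesis by blast
  qed
  then obtain p where p: "p \<in> C" "(\<lambda>k. nm (X k - p)) \<longlonglongrightarrow> 0"
    using complete[of X] X(1) VC by blast
  \<comment> \<open>first-order condition at the minimum, along the real line through \<open>v\<close>\<close>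
  have re: "Re (L v) = Re (ip v p)" if v: "v \<in> V" for v
  proof -
    have key: "0 \<le> t\<^sup>2 * (nm v)\<^sup>2 + 2 * t * (Re (ip v p) - Re (L v))" for t :: real
    proof (rule LIMSEQ_le[OF _ _ exI[of _ 0]])
      show "(\<lambda>k. - 1 / real (Suc k)) \<longlonglongrightarrow> 0"
        using tendsto_minus[OF LIMSEQ_inverse_real_of_nat] by (simp add: field_simps)
      show "(\<lambda>k. t\<^sup>2 * (nm v)\<^sup>2 + 2 * t * (Re (ip v (X k)) - Re (L v)))
         \<longlonglongrightarrow> t\<^sup>2 * (nm v)\<^sup>2 + 2 * t * (Re (ip v p) - Re (L v))"
      proof (intro tendsto_intros)
        show "(\<lambda>k. ip v (X k)) \<longlonglongrightarrow> ip v p"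
          using tendsto_cnj[OF ip_tendsto[of X p v]] X(1) VC p v by (simp add: ip_cnj[symmetric])
      qed
      have "- 1 / real (Suc k) \<le> t\<^sup>2 * (nm v)\<^sup>2 + 2 * t * (Re (ip v (X k)) - Re (L v))" for k
      proof -
        let ?y = "X k + of_real t *\<^sub>C v"
        have y: "?y \<in> V" by (intro Vadd Vsc X v)
        have "ip (X k) v = cnj (ip v (X k))" using ip_cnj VC X(1) v by blast
        then have n: "(nm ?y)\<^sup>2 = (nm (X k))\<^sup>2 + t\<^sup>2 * (nm v)\<^sup>2 + 2 * t * Re (ip v (X k))"
          using VC X(1) v by (simp add: nm_add_sq scale_mem nm_scale power_mult_distrib ip_scale_r)
        have "Re (L ?y) = Re (L (X k)) + t * Re (L v)" using X v by (simp add: L_add L_scale Vsc)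
        then have "F ?y = F (X k) + t\<^sup>2 * (nm v)\<^sup>2 + 2 * t * (Re (ip v (X k)) - Re (L v))"
          using n by (simp add: F_def algebra_simps)
        then show ?thesis using m_le[OF y] X(2)[of k] by simp
      qed
      then show "\<forall>k\<ge>0. - 1 / real (Suc k) \<le> t\<^sup>2 * (nm v)\<^sup>2 + 2 * t * (Re (ip v (X k)) - Re (L v))"
        by blast
    qed
    define D where "D = Re (ip v p) - Re (L v)"
    define A where "A = (nm v)\<^sup>2 + 1"
    have A: "A > 0" by (simp add: A_def add_nonneg_pos)
    have "0 \<le> (-D/A)\<^sup>2 * (A - 1) + 2 * (-D/A) * D" using key[of "-D/A"] by (simp add: D_def A_def)
    also have "\<dots> = - (D\<^sup>2 * (A + 1)) / A\<^sup>2" using A by (simp add: field_simps power2_eq_square)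
    finally have "D\<^sup>2 * (A + 1) \<le> 0" using A by (simp add: divide_le_0_iff zero_le_divide_iff)
    then have "D\<^sup>2 \<le> 0" using A by (simp add: mult_le_0_iff)
    then show ?thesis by (simp add: D_def)
  qed
  have "L v = ip v p" if v: "v \<in> V" for v
  proof -
    have "Re (L (\<i> *\<^sub>C v)) = Re (ip (\<i> *\<^sub>C v) p)" by (rule re) (rule Vsc[OF v])
    then have "Im (L v) = Im (ip v p)" using v VC p by (simp add: L_scale ip_scale)
    then show ?thesis using re[OF v] by (simp add: complex_eq_iff)
  qed
  with p X show ?thesis using that by blast
qed

lemma riesz:
  assumes "\<And>x y. x \<in> C \<Longrightarrow> y \<in> C \<Longrightarrow> L (x + y) = L x + L y"
    and "\<And>c x. x \<in> C \<Longrightarrow> L (c *\<^sub>C x) = c * L x"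
    and "\<And>x. x \<in> C \<Longrightarrow> cmod (L x) \<le> B * nm x"
  obtains p where "p \<in> C" "\<And>v. v \<in> C \<Longrightarrow> L v = ip v p"
  using riesz_subspace[OF subspace order_refl assms] by metis

text \<open>If \<open>p\<close> is the projection of \<open>z\<close> to the closure of the span, then \<open>p - z\<close> is orthogonal to \<open>D\<close>.\<close>

lemma dense_span_if_total:
  assumes D: "D \<subseteq> C" and total: "\<And>z. z \<in> C \<Longrightarrow> (\<And>g. g \<in> D \<Longrightarrow> ip z g = 0) \<Longrightarrow> z = 0"
    and z: "z \<in> C"
  obtains X where "\<And>k. X k \<in> module.span scaleC D" "(\<lambda>k. nm (X k - z)) \<longlonglongrightarrow> 0"
proof -
  have sC: "cv.span D \<subseteq> C" using cv.span_minimal[OF D subspace] .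
  obtain p X where p: "p \<in> C" and X: "\<And>k. X k \<in> cv.span D" "(\<lambda>k. nm (X k - p)) \<longlonglongrightarrow> 0"
    and ip: "\<And>v. v \<in> cv.span D \<Longrightarrow> ip v z = ip v p"
  proof (rule riesz_subspace[OF cv.subspace_span sC, of "\<lambda>v. ip v z" "nm z"])
    show "cmod (ip x z) \<le> nm z * nm x" if "x \<in> cv.span D" for x
      using cauchy_schwarz[of x z] that sC z by (auto simp: mult.commute)
    show "ip (x + y) z = ip x z + ip y z" if "x \<in> cv.span D" "y \<in> cv.span D" for x y
      using that sC z by (intro ip_add) auto
    show "ip (c *\<^sub>C x) z = c * ip x z" if "x \<in> cv.span D" for c x
      using that sC z by (intro ip_scale) auto
  qed auto
  have "p - z = 0"
  proof (rule total)
    fix g assume g: "g \<in> D"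
    then have "ip g (p - z) = 0" using ip[of g] cv.span_base[of g D] D p z by (auto simp: ip_diff_r)
    then show "ip (p - z) g = 0" using ip_cnj[of g "p - z"] g D p z diff_mem by auto
  qed (use p z diff_mem in auto)
  then have "p = z" by simp
  with X that show ?thesis by blast
qed

text \<open>A gliding hump: if \<open>\<parallel>Y k\<parallel> > 4\<^sup>k\<close>, then one adds successively vectors of norm \<open>3\<^sup>-\<^sup>k\<close> parallel to
  \<open>Y k\<close>, with the sign chosen so that the inner product with \<open>Y k\<close> becomes at least
  \<open>\<parallel>Y k\<parallel> / 3\<^sup>k\<close>. All later vectors together have norm at most \<open>1/2 \<cdot> 3\<^sup>-\<^sup>k\<close>, so the limit \<open>x\<close> still
  satisfies \<open>\<bar>\<langle>x, Y k\<rangle>\<bar> \<ge> 1/2 \<cdot> (4/3)\<^sup>k\<close>.\<close>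

lemma weakly_bounded_imp_bounded:
  assumes S: "S \<subseteq> C" and wb: "\<And>x. x \<in> C \<Longrightarrow> \<exists>B. \<forall>y\<in>S. cmod (ip x y) \<le> B"
  shows "\<exists>B. \<forall>y\<in>S. nm y \<le> B"
proof (rule ccontr)
  assume "\<not> ?thesis"
  then have "\<exists>y\<in>S. nm y > 4 ^ k" for k :: nat by (meson not_le)
  then obtain Y where Y: "\<And>k::nat. Y k \<in> S" "\<And>k. nm (Y k) > 4 ^ k" by metis
  have YC: "Y k \<in> C" for k using Y S by blast
  define V where "V k = of_real (1 / (3 ^ k * nm (Y k))) *\<^sub>C Y k" for k
  have VC: "V k \<in> C" for k by (simp add: V_def scale_mem YC)
  have pos: "nm (Y k) > 0" for k using Y(2)[of k] by (meson less_trans zero_less_numeral zero_less_power)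
  have nV: "nm (V k) = 1 / 3 ^ k" for k
    using less_imp_neq[OF pos[of k]] YC[of k] by (simp add: V_def nm_scale norm_divide norm_mult norm_power)
  have ipV: "ip (V k) (Y k) = of_real (nm (Y k) / 3 ^ k)" for k
    using less_imp_neq[OF pos[of k]] YC[of k] by (simp add: V_def ip_scale ip_self power2_eq_square)
  \<comment> \<open>the sign is chosen such that the new inner product with \<open>Y k\<close> is large\<close>
  define step where "step k x = (if cmod (ip (x + V k) (Y k)) \<ge> nm (Y k) / 3 ^ k then x + V k else x - V k)" for k x
  define X where "X = rec_nat 0 (\<lambda>k x. step (Suc k) x)"
  have X_Suc: "X (Suc k) = step (Suc k) (X k)" for k by (simp add: X_def)
  have stepC: "x \<in> C \<Longrightarrow> step k x \<in> C" for k x by (simp add: step_def add_mem diff_mem VC)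
  have XC: "X k \<in> C" for k
  proof (induction k)
    case 0 show ?case by (simp add: X_def)
  qed (simp add: X_Suc stepC)
  have step_nm: "nm (step k x - x) = 1 / 3 ^ k" if "x \<in> C" for k x
    using nV[of k] nm_minus[OF VC[of k]] that by (auto simp: step_def)
  have step_ge: "cmod (ip (step k x) (Y k)) \<ge> nm (Y k) / 3 ^ k" if x: "x \<in> C" for k x
  proof (cases "cmod (ip (x + V k) (Y k)) \<ge> nm (Y k) / 3 ^ k")
    case False
    have "2 * ip (V k) (Y k) = ip (x + V k) (Y k) - ip (x - V k) (Y k)"
      using x VC YC by (simp add: ip_add ip_diff)
    then have "cmod (2 * ip (V k) (Y k)) \<le> cmod (ip (x + V k) (Y k)) + cmod (ip (x - V k) (Y k))"
      by (metis norm_triangle_ineq4)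
    moreover have "cmod (2 * ip (V k) (Y k)) = 2 * (nm (Y k) / 3 ^ k)"
      using pos[of k] unfolding ipV by (simp add: norm_mult norm_divide norm_power)
    ultimately show ?thesis using False by (simp add: step_def)
  qed (simp add: step_def)
  have tail: "nm (X (k + j) - X k) \<le> (1/2) / 3 ^ k - (1/2) / 3 ^ (k + j)" for k j
  proof (induction j)
    case (Suc j)
    have "nm (X (k + Suc j) - X k) \<le> nm (X (Suc (k + j)) - X (k + j)) + nm (X (k + j) - X k)"
      using nm_triangle_diff XC by simp
    also have "nm (X (Suc (k + j)) - X (k + j)) = 1 / 3 ^ Suc (k + j)"
      unfolding X_Suc using step_nm[OF XC] .
    also have "1 / 3 ^ Suc (k + j) = (1/2) / 3 ^ (k + j) - (1/2) / (3 ^ (k + Suc j) :: real)"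
      by (simp add: field_simps)
    finally show ?case using Suc by simp
  qed (simp add: XC)
  have tail': "nm (X l - X k) \<le> (1/2) / 3 ^ k" if "l \<ge> k" for k l
  proof -
    have "nm (X l - X k) \<le> (1/2) / 3 ^ k - (1/2) / 3 ^ l" using tail[of k "l - k"] that by simp
    moreover have "(0::real) \<le> (1/2) / 3 ^ l" by simp
    ultimately show ?thesis by linarith
  qed
  have "\<exists>N. \<forall>k\<ge>N. \<forall>l\<ge>N. nm (X k - X l) < e" if e: "e > 0" for e
  proof -
    obtain N where N: "(1/3::real) ^ N < e" using real_arch_pow_inv[OF e, of "1/3"] by auto
    have "nm (X k - X l) < e" if "k \<ge> N" "l \<ge> N" for k l
      using nm_triangle_diff[of "X k" "X N" "X l"] tail'[OF that(1)] tail'[OF that(2)] XC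
        nm_diff_commute[of "X N" "X l"] N by (simp add: power_one_over)
    then show ?thesis by blast
  qed
  then obtain x where x: "x \<in> C" "(\<lambda>k. nm (X k - x)) \<longlonglongrightarrow> 0"
    using complete[of X] XC by blast
  have lim: "nm (x - X k) \<le> (1/2) / 3 ^ k" for k
  proof (rule LIMSEQ_le_const2)
    show "(\<lambda>l. nm (X l - X k)) \<longlonglongrightarrow> nm (x - X k)"
      by (rule nm_tendsto) (use XC x diff_mem in auto)
  qed (use tail' in blast)
  obtain B where B: "\<And>y. y \<in> S \<Longrightarrow> cmod (ip x y) \<le> B" using wb[OF x(1)] by blast
  have large: "(4/3) ^ k / 2 \<le> B" if "k > 0" for k :: nat
  proof -
    obtain j where j: "k = Suc j" using \<open>k > 0\<close> by (cases k) auto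
    have "nm (Y k) / 3 ^ k \<le> cmod (ip (X k) (Y k))" unfolding j X_Suc by (rule step_ge[OF XC])
    also have "ip (X k) (Y k) = ip x (Y k) - ip (x - X k) (Y k)" using XC x YC by (simp add: ip_diff)
    also have "cmod \<dots> \<le> B + nm (x - X k) * nm (Y k)"
      using B[OF Y(1)[of k]] cauchy_schwarz[OF diff_mem[OF x(1) XC] YC, of k k]
        norm_triangle_ineq4[of "ip x (Y k)" "ip (x - X k) (Y k)"] by linarith
    also have "nm (x - X k) * nm (Y k) \<le> ((1/2) / 3 ^ k) * nm (Y k)"
      by (rule mult_right_mono[OF lim]) (simp add: YC)
    finally have "nm (Y k) / 3 ^ k / 2 \<le> B" by (simp add: field_simps)
    moreover have "4 ^ k / 3 ^ k / 2 \<le> nm (Y k) / 3 ^ k / 2"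
      using Y(2)[of k] by (intro divide_right_mono) auto
    ultimately show ?thesis by (simp add: power_divide)
  qed
  obtain k where "2 * B < (4/3) ^ k" using real_arch_pow[of "4/3" "2 * B"] by auto
  moreover have "(4/3::real) ^ k \<le> (4/3) ^ Suc k" by simp
  ultimately show False using large[OF zero_less_Suc, of k] by linarith
qed

end

section \<open>Bounded operators and adjoints\<close>

definition linear_op :: "'a::complex_vector hspace \<Rightarrow> 'b::complex_vector hspace \<Rightarrow> ('a \<Rightarrow> 'b) \<Rightarrow> bool" where
  "linear_op H1 H2 A \<longleftrightarrow>
     (\<forall>x\<in>hcarrier H1. A x \<in> hcarrier H2) \<and>
     (\<forall>x\<in>hcarrier H1. \<forall>y\<in>hcarrier H1. A (x + y) = A x + A y) \<and>
     (\<forall>c. \<forall>x\<in>hcarrier H1. A (c *\<^sub>C x) = c *\<^sub>C A x)"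

lemma bounded_op_linear_op: "bounded_op H1 H2 A \<Longrightarrow> linear_op H1 H2 A"
  by (simp add: bounded_op_def linear_op_def)

lemma linear_opD:
  assumes "linear_op H1 H2 A"
  shows "x \<in> hcarrier H1 \<Longrightarrow> A x \<in> hcarrier H2"
    and "x \<in> hcarrier H1 \<Longrightarrow> y \<in> hcarrier H1 \<Longrightarrow> A (x + y) = A x + A y"
    and "x \<in> hcarrier H1 \<Longrightarrow> A (c *\<^sub>C x) = c *\<^sub>C A x"
  using assms by (simp_all add: linear_op_def)

lemmas bounded_opD = linear_opD[OF bounded_op_linear_op]

lemma linear_op_zero:
  assumes "linear_op H1 H2 A" "0 \<in> hcarrier H1" shows "A 0 = 0"
  using linear_opD(3)[OF assms, of 0] by simp

lemma linear_op_sum: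
  assumes "linear_op H1 H2 A" "complete_ips H1" "\<And>i. i \<in> I \<Longrightarrow> f i \<in> hcarrier H1"
  shows "A (sum f I) = (\<Sum>i\<in>I. A (f i))"
proof -
  interpret complete_ips H1 by fact
  show ?thesis using assms(3)
    by (induction I rule: infinite_finite_induct)
      (auto simp: linear_op_zero[OF assms(1)] linear_opD(2)[OF assms(1)] sum_mem)
qed

lemma bounded_op_bound:
  assumes "bounded_op H1 H2 A" "complete_ips H1"
  obtains B where "B \<ge> 0" "\<And>x. x \<in> hcarrier H1 \<Longrightarrow> hnorm H2 (A x) \<le> B * hnorm H1 x"
proof -
  interpret complete_ips H1 by fact
  obtain B where B: "\<And>x. x \<in> C \<Longrightarrow> hnorm H2 (A x) \<le> B * nm x"
    using assms(1) unfolding bounded_op_def by meson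
  have "hnorm H2 (A x) \<le> max B 0 * nm x" if "x \<in> C" for x
  proof -
    have "B * nm x \<le> max B 0 * nm x" using that by (intro mult_right_mono) auto
    then show ?thesis using B[OF that] by linarith
  qed
  then show ?thesis using that[of "max B 0"] by simp
qed

text \<open>A form of the closed graph theorem. The vectors that represent \<open>x \<mapsto> \<langle>A x, g\<rangle>\<close> for \<open>g\<close> in the
  unit ball of the span of \<open>D\<close> are weakly bounded, as \<open>\<bar>\<langle>A x, g\<rangle>\<bar> \<le> \<parallel>A x\<parallel>\<close>. Hence they are bounded,
  and density of the span turns this into a bound for \<open>\<parallel>A x\<parallel>\<close>. In a reproducing kernel space one
  takes the kernel functions for \<open>D\<close>; then only the continuity of point evaluations is needed.\<close>

lemma bounded_if_weakly_continuous:
  assumes H1: "complete_ips H1" and H2: "complete_ips H2" and A: "linear_op H1 H2 A"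
    and D: "D \<subseteq> hcarrier H2"
    and total: "\<And>z. z \<in> hcarrier H2 \<Longrightarrow> (\<And>g. g \<in> D \<Longrightarrow> hinner H2 z g = 0) \<Longrightarrow> z = 0"
    and weak: "\<And>g. g \<in> D \<Longrightarrow> \<exists>y\<in>hcarrier H1. \<forall>x\<in>hcarrier H1. hinner H2 (A x) g = hinner H1 x y"
  shows "bounded_op H1 H2 A"
proof -
  interpret h1: complete_ips H1 by fact
  interpret h2: complete_ips H2 by fact
  note AC = linear_opD(1)[OF A]
  define E where "E = {g \<in> h2.C. \<exists>y\<in>h1.C. \<forall>x\<in>h1.C. h2.ip (A x) g = h1.ip x y}"
  have "cv.subspace E"
  proof (rule cv.subspaceI)
    show "0 \<in> E" unfolding E_def using AC by (auto intro!: bexI[of _ 0])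
  next
    fix g h assume "g \<in> E" "h \<in> E"
    then obtain y z where "g \<in> h2.C" "h \<in> h2.C" "y \<in> h1.C" "z \<in> h1.C"
      "\<forall>x\<in>h1.C. h2.ip (A x) g = h1.ip x y" "\<forall>x\<in>h1.C. h2.ip (A x) h = h1.ip x z"
      unfolding E_def by auto
    then show "g + h \<in> E" unfolding E_def using AC
      by (auto simp: h2.add_mem h1.add_mem h2.ip_add_r h1.ip_add_r intro!: bexI[of _ "y + z"])
  next
    fix c g assume "g \<in> E"
    then obtain y where "g \<in> h2.C" "y \<in> h1.C" "\<forall>x\<in>h1.C. h2.ip (A x) g = h1.ip x y"
      unfolding E_def by auto
    then show "c *\<^sub>C g \<in> E" unfolding E_def using AC
      by (auto simp: h2.scale_mem h1.scale_mem h2.ip_scale_r h1.ip_scale_r intro!: bexI[of _ "c *\<^sub>C y"])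
  qed
  moreover have "D \<subseteq> E" using weak D by (auto simp: E_def)
  ultimately have spE: "cv.span D \<subseteq> E" by (rule cv.span_minimal[rotated])
  define Y where "Y = {y \<in> h1.C. \<exists>g\<in>cv.span D. h2.nm g \<le> 1 \<and> (\<forall>x\<in>h1.C. h2.ip (A x) g = h1.ip x y)}"
  have "\<exists>B. \<forall>y\<in>Y. h1.nm y \<le> B"
  proof (rule h1.weakly_bounded_imp_bounded)
    fix x assume x: "x \<in> h1.C"
    have "cmod (h1.ip x y) \<le> h2.nm (A x)" if y: "y \<in> Y" for y
    proof -
      obtain g where g: "g \<in> cv.span D" "h2.nm g \<le> 1" "\<And>x. x \<in> h1.C \<Longrightarrow> h2.ip (A x) g = h1.ip x y"
        using y by (auto simp: Y_def)
      have "g \<in> h2.C" using g(1) spE by (auto simp: E_def)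
      then have "cmod (h1.ip x y) \<le> h2.nm (A x) * h2.nm g"
        using h2.cauchy_schwarz[OF AC[OF x]] unfolding g(3)[OF x, symmetric] by blast
      also have "\<dots> \<le> h2.nm (A x) * 1" using g(2) AC x by (intro mult_left_mono) auto
      finally show ?thesis by simp
    qed
    then show "\<exists>B. \<forall>y\<in>Y. cmod (h1.ip x y) \<le> B" by blast
  qed (auto simp: Y_def)
  then obtain B where B: "\<And>y. y \<in> Y \<Longrightarrow> h1.nm y \<le> B" by blast
  have bd: "cmod (h2.ip (A x) g) \<le> B * h1.nm x * h2.nm g" if g: "g \<in> cv.span D" and x: "x \<in> h1.C" for g x
  proof (cases "g = 0")
    case False
    obtain y where y: "y \<in> h1.C" "\<And>x. x \<in> h1.C \<Longrightarrow> h2.ip (A x) g = h1.ip x y" and gC: "g \<in> h2.C"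
      using g spE by (auto simp: E_def)
    have pos: "h2.nm g > 0" using False gC h2.nm_eq_0[of g] h2.nm_nonneg[of g] by linarith
    let ?c = "of_real (1 / h2.nm g) :: complex"
    have "?c *\<^sub>C y \<in> Y" unfolding Y_def
    proof (intro CollectI conjI bexI[of _ "?c *\<^sub>C g"] ballI)
      show "h2.nm (?c *\<^sub>C g) \<le> 1" using pos gC by (simp add: h2.nm_scale norm_divide)
    qed (use y gC g AC in \<open>auto simp: h1.scale_mem h1.ip_scale_r h2.ip_scale_r cv.span_scale\<close>)
    then have "h1.nm (?c *\<^sub>C y) \<le> B" by (rule B)
    then have "h1.nm y \<le> B * h2.nm g" using pos y by (simp add: h1.nm_scale norm_divide field_simps)
    moreover have "cmod (h2.ip (A x) g) \<le> h1.nm x * h1.nm y" using h1.cauchy_schwarz x y by simp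
    ultimately show ?thesis using mult_left_mono[of "h1.nm y" "B * h2.nm g" "h1.nm x"] x
      by (simp add: algebra_simps)
  qed (use AC x in simp)
  have "h2.nm (A x) \<le> B * h1.nm x" if x: "x \<in> h1.C" for x
  proof (cases "A x = 0")
    case True
    have "0 \<in> Y" unfolding Y_def using cv.span_zero AC by (auto intro!: bexI[of _ 0])
    then have "0 \<le> B" using B by fastforce
    then show ?thesis using True x by simp
  next
    case False
    obtain X where X: "\<And>k. X k \<in> cv.span D" "(\<lambda>k. h2.nm (X k - A x)) \<longlonglongrightarrow> 0"
      using h2.dense_span_if_total[OF D total AC[OF x]] by blast
    have XC: "X k \<in> h2.C" for k using X(1)[of k] spE by (auto simp: E_def)
    have pos: "h2.nm (A x) > 0" using False AC[OF x] h2.nm_eq_0[of "A x"] h2.nm_nonneg[of "A x"] by linarith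
    have "cmod (h2.ip (A x) (A x)) \<le> B * h1.nm x * h2.nm (A x)"
    proof (rule LIMSEQ_le)
      show "(\<lambda>k. cmod (h2.ip (X k) (A x))) \<longlonglongrightarrow> cmod (h2.ip (A x) (A x))"
        by (intro tendsto_norm h2.ip_tendsto XC X AC x)
      show "(\<lambda>k. B * h1.nm x * h2.nm (X k)) \<longlonglongrightarrow> B * h1.nm x * h2.nm (A x)"
        by (intro tendsto_mult_left h2.nm_tendsto XC X AC x)
      have "cmod (h2.ip (X k) (A x)) = cmod (h2.ip (A x) (X k))" for k
        using h2.ip_cnj[OF XC[of k] AC[OF x]] by simp
      then show "\<exists>N. \<forall>k\<ge>N. cmod (h2.ip (X k) (A x)) \<le> B * h1.nm x * h2.nm (X k)"
        using bd[OF X(1) x] by simp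
    qed
    then have "h2.nm (A x) * h2.nm (A x) \<le> B * h1.nm x * h2.nm (A x)"
      using AC[OF x] by (simp add: h2.ip_self power2_eq_square norm_mult)
    then show ?thesis using pos by simp
  qed
  then show ?thesis using A by (auto simp: bounded_op_def linear_op_def)
qed

text \<open>Stating adjointness as a relation between two given operators makes identities between
  adjoints of composed operators instances of uniqueness, and it includes the boundedness of both
  operators.\<close>

definition adjoint_pair ::
    "'a::complex_vector hspace \<Rightarrow> 'b::complex_vector hspace \<Rightarrow> ('a \<Rightarrow> 'b) \<Rightarrow> ('b \<Rightarrow> 'a) \<Rightarrow> bool" where
  "adjoint_pair H1 H2 A B \<longleftrightarrow>
     (\<forall>x\<in>hcarrier H1. A x \<in> hcarrier H2) \<and> (\<forall>y\<in>hcarrier H2. B y \<in> hcarrier H1) \<and>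
     (\<forall>x\<in>hcarrier H1. \<forall>y\<in>hcarrier H2. hinner H2 (A x) y = hinner H1 x (B y))"

lemma adjoint_pairD:
  assumes "adjoint_pair H1 H2 A B"
  shows "x \<in> hcarrier H1 \<Longrightarrow> A x \<in> hcarrier H2" "y \<in> hcarrier H2 \<Longrightarrow> B y \<in> hcarrier H1"
    "x \<in> hcarrier H1 \<Longrightarrow> y \<in> hcarrier H2 \<Longrightarrow> hinner H2 (A x) y = hinner H1 x (B y)"
  using assms by (simp_all add: adjoint_pair_def)

lemma adjoint_pair_sym:
  assumes "complete_ips H1" "complete_ips H2" "adjoint_pair H1 H2 A B"
  shows "adjoint_pair H2 H1 B A"
proof -
  interpret h1: complete_ips H1 by fact
  interpret h2: complete_ips H2 by fact
  note D = adjoint_pairD[OF assms(3)]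
  have "h1.ip (B y) x = h2.ip y (A x)" if "x \<in> h1.C" "y \<in> h2.C" for x y
    using D(3)[OF that] D(1,2) that h1.ip_cnj[of "x" "B y"] h2.ip_cnj[of "A x" y] by simp
  then show ?thesis using D by (simp add: adjoint_pair_def)
qed

lemma adjoint_pair_linear:
  assumes "complete_ips H1" "complete_ips H2" "adjoint_pair H1 H2 A B"
  shows "linear_op H1 H2 A"
proof -
  interpret h1: complete_ips H1 by fact
  interpret h2: complete_ips H2 by fact
  note D = adjoint_pairD[OF assms(3)]
  show ?thesis unfolding linear_op_def
  proof (intro conjI ballI allI)
    fix x y assume xy: "x \<in> h1.C" "y \<in> h1.C"
    show "A (x + y) = A x + A y"
      by (rule h2.eqI) (use xy D in \<open>simp_all add: h2.add_mem h1.add_mem h2.ip_add h1.ip_add\<close>)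
  next
    fix c x assume x: "x \<in> h1.C"
    show "A (c *\<^sub>C x) = c *\<^sub>C A x"
      by (rule h2.eqI) (use x D in \<open>simp_all add: h2.scale_mem h1.scale_mem h2.ip_scale h1.ip_scale\<close>)
  qed (rule D)
qed

text \<open>The Hellinger--Toeplitz theorem.\<close>

lemma adjoint_pair_bounded:
  assumes "complete_ips H1" "complete_ips H2" "adjoint_pair H1 H2 A B"
  shows "bounded_op H1 H2 A"
proof (rule bounded_if_weakly_continuous[OF assms(1,2) adjoint_pair_linear[OF assms], of "hcarrier H2"])
  interpret h2: complete_ips H2 by fact
  show "z = 0" if "z \<in> hcarrier H2" "\<And>g. g \<in> hcarrier H2 \<Longrightarrow> hinner H2 z g = 0" for z
    using that h2.eqI[of z 0] by simp
qed (use adjoint_pairD[OF assms(3)] in blast)+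

lemma adjoint_pair_adjoint_op:
  assumes "complete_ips H1" "complete_ips H2" "bounded_op H1 H2 A"
  shows "adjoint_pair H1 H2 A (adjoint_op H1 H2 A)"
proof -
  interpret h1: complete_ips H1 by fact
  interpret h2: complete_ips H2 by fact
  note A = bounded_opD[OF assms(3)]
  obtain B where B: "\<And>x. x \<in> h1.C \<Longrightarrow> h2.nm (A x) \<le> B * h1.nm x"
    using bounded_op_bound[OF assms(3,1)] by metis
  have "adjoint_op H1 H2 A y \<in> h1.C \<and> (\<forall>u\<in>h1.C. h2.ip (A u) y = h1.ip u (adjoint_op H1 H2 A y))"
    if y: "y \<in> h2.C" for y
  proof -
    obtain p where p: "p \<in> h1.C" "\<And>v. v \<in> h1.C \<Longrightarrow> h2.ip (A v) y = h1.ip v p"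
    proof (rule h1.riesz[of "\<lambda>v. h2.ip (A v) y" "B * h2.nm y"])
      fix x assume x: "x \<in> h1.C"
      have "cmod (h2.ip (A x) y) \<le> h2.nm (A x) * h2.nm y" using h2.cauchy_schwarz A x y by simp
      also have "\<dots> \<le> (B * h1.nm x) * h2.nm y" using B[OF x] y by (intro mult_right_mono) auto
      finally show "cmod (h2.ip (A x) y) \<le> B * h2.nm y * h1.nm x" by (simp add: mult_ac)
    qed (use A y in \<open>auto simp: h2.ip_add h2.ip_scale\<close>)
    show ?thesis unfolding adjoint_op_def
      by (rule theI[where a = p]) (use p h1.eqI_r in auto)
  qed
  then show ?thesis using A by (simp add: adjoint_pair_def)
qed

lemma bounded_op_adjoint:
  assumes "complete_ips H1" "complete_ips H2" "bounded_op H1 H2 A"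
  obtains B where "adjoint_pair H1 H2 A B"
  using adjoint_pair_adjoint_op[OF assms] that by blast

lemma adjoint_pair_unique:
  assumes "complete_ips H1" "adjoint_pair H1 H2 A B" "adjoint_pair H1 H2 A' B'"
    "\<And>x. x \<in> hcarrier H1 \<Longrightarrow> A x = A' x" "y \<in> hcarrier H2"
  shows "B y = B' y"
proof -
  interpret h1: complete_ips H1 by fact
  show ?thesis
    by (rule h1.eqI_r) (use adjoint_pairD[OF assms(2)] adjoint_pairD[OF assms(3)] assms(4,5) in auto)
qed

lemma adjoint_pair_cong:
  assumes "adjoint_pair H1 H2 A B" "\<And>x. x \<in> hcarrier H1 \<Longrightarrow> A' x = A x" "\<And>y. y \<in> hcarrier H2 \<Longrightarrow> B' y = B y"
  shows "adjoint_pair H1 H2 A' B'"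
  using assms by (simp add: adjoint_pair_def)

lemma adjoint_pair_comp:
  assumes "adjoint_pair H1 H2 A B" "adjoint_pair H2 H3 A' B'"
  shows "adjoint_pair H1 H3 (\<lambda>x. A' (A x)) (\<lambda>y. B (B' y))"
  using assms by (simp add: adjoint_pair_def)

lemma adjoint_pair_id: "adjoint_pair H H (\<lambda>x. x) (\<lambda>x. x)"
  by (simp add: adjoint_pair_def)

lemma adjoint_pair_scale:
  assumes "complete_ips H1" "complete_ips H2" "adjoint_pair H1 H2 A B"
  shows "adjoint_pair H1 H2 (\<lambda>x. c *\<^sub>C A x) (\<lambda>y. cnj c *\<^sub>C B y)"
proof -
  interpret h1: complete_ips H1 by fact
  interpret h2: complete_ips H2 by fact
  show ?thesis using adjoint_pairD[OF assms(3)]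
    by (simp add: adjoint_pair_def h1.scale_mem h2.scale_mem h1.ip_scale_r h2.ip_scale)
qed

lemma adjoint_pair_sum:
  assumes "complete_ips H1" "complete_ips H2" "finite I"
    and "\<And>i. i \<in> I \<Longrightarrow> adjoint_pair H1 H2 (A i) (B i)"
  shows "adjoint_pair H1 H2 (\<lambda>x. \<Sum>i\<in>I. A i x) (\<lambda>y. \<Sum>i\<in>I. B i y)"
proof -
  interpret h1: complete_ips H1 by fact
  interpret h2: complete_ips H2 by fact
  show ?thesis using adjoint_pairD[OF assms(4)] assms(3)
    by (simp add: adjoint_pair_def h1.sum_mem h2.sum_mem h1.ip_sum_r h2.ip_sum)
qed

lemma bounded_op_comp:
  assumes "complete_ips H1" "complete_ips H2" "complete_ips H3"
    "bounded_op H1 H2 A" "bounded_op H2 H3 B"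
  shows "bounded_op H1 H3 (\<lambda>x. B (A x))"
  by (rule bounded_op_adjoint[OF assms(1,2,4)], rule bounded_op_adjoint[OF assms(2,3,5)])
    (blast intro: adjoint_pair_bounded[OF assms(1,3)] adjoint_pair_comp)

lemma inverse_ops_adjoint:
  assumes H: "complete_ips H" and inv: "inverse_ops H X Y"
    and X: "adjoint_pair H H X X'" and Y: "adjoint_pair H H Y Y'"
  shows "inverse_ops H X' Y'"
proof -
  have b: "bounded_op H H X'" "bounded_op H H Y'"
    using adjoint_pair_bounded[OF H H adjoint_pair_sym[OF H H]] X Y by blast+
  have "X' (Y' y) = y" if "y \<in> hcarrier H" for y
    by (rule adjoint_pair_unique[OF H adjoint_pair_comp[OF X Y] adjoint_pair_id])
      (use inv that in \<open>auto simp: inverse_ops_def\<close>)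
  moreover have "Y' (X' y) = y" if "y \<in> hcarrier H" for y
    by (rule adjoint_pair_unique[OF H adjoint_pair_comp[OF Y X] adjoint_pair_id])
      (use inv that in \<open>auto simp: inverse_ops_def\<close>)
  ultimately show ?thesis using b by (simp add: inverse_ops_def)
qed

text \<open>The adjoint of the intertwining relation \<open>X A = B X\<close> is \<open>A\<^sup>* X\<^sup>* = X\<^sup>* B\<^sup>*\<close>, so the two operators
  change sides.\<close>

lemma similar_ops_adjoint:
  assumes H: "complete_ips H" and A: "adjoint_pair H H A A'" and B: "adjoint_pair H H B B'"
    and sim: "similar_ops H A B"
  shows "similar_ops H B' A'"
proof -
  obtain X Y where inv: "inverse_ops H X Y" and XA: "\<And>x. x \<in> hcarrier H \<Longrightarrow> X (A x) = B (X x)"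
    using sim by (auto simp: similar_ops_def)
  obtain X' where X': "adjoint_pair H H X X'"
    using bounded_op_adjoint[OF H H] inv unfolding inverse_ops_def by metis
  obtain Y' where Y': "adjoint_pair H H Y Y'"
    using bounded_op_adjoint[OF H H] inv unfolding inverse_ops_def by metis
  have "X' (B' y) = A' (X' y)" if "y \<in> hcarrier H" for y
    by (rule adjoint_pair_unique[OF H adjoint_pair_comp[OF X' B] adjoint_pair_comp[OF A X']])
      (use XA that in auto)
  then show ?thesis using inverse_ops_adjoint[OF H inv X' Y'] by (auto simp: similar_ops_def)
qed

section \<open>Direct sums and operator matrices\<close>

lemma direct_sum_carrier:
  "x \<in> hcarrier (direct_sum n H) \<longleftrightarrow> (\<forall>i\<in>{1..n}. x i \<in> hcarrier (H i)) \<and> (\<forall>i. i \<notin> {1..n} \<longrightarrow> x i = 0)"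
  by (simp add: direct_sum_def)

lemma direct_sum_ip: "hinner (direct_sum n H) x y = (\<Sum>i=1..n. hinner (H i) (x i) (y i))"
  by (simp add: direct_sum_def)

lemma complete_ips_direct_sum:
  assumes H: "\<And>i. i \<in> {1..n} \<Longrightarrow> complete_ips (H i)"
  shows "complete_ips (direct_sum n H)"
proof (rule complete_ips.intro)
  let ?D = "direct_sum n H"
  note mems = complete_ips.add_mem[OF H] complete_ips.scale_mem[OF H] complete_ips.diff_mem[OF H]
    complete_ips.zero_mem[OF H]
  show "cv.subspace (hcarrier ?D)"
    by (rule cv.subspaceI) (auto simp: direct_sum_carrier mems)
  show "hinner ?D (x + y) z = hinner ?D x z + hinner ?D y z"
    if "x \<in> hcarrier ?D" "y \<in> hcarrier ?D" "z \<in> hcarrier ?D" for x y z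
    using that by (simp add: direct_sum_ip direct_sum_carrier complete_ips.ip_add[OF H] sum.distrib)
  show "hinner ?D (c *\<^sub>C x) y = c * hinner ?D x y"
    if "x \<in> hcarrier ?D" "y \<in> hcarrier ?D" for c x y
    using that by (simp add: direct_sum_ip direct_sum_carrier complete_ips.ip_scale[OF H] sum_distrib_left)
  show "hinner ?D y x = cnj (hinner ?D x y)" if "x \<in> hcarrier ?D" "y \<in> hcarrier ?D" for x y
    unfolding direct_sum_ip cnj_sum
    by (rule sum.cong[OF refl complete_ips.ip_cnj[OF H]]) (use that in \<open>auto simp: direct_sum_carrier\<close>)
  have Re_ip: "Re (hinner ?D x x) = (\<Sum>i=1..n. (hnorm (H i) (x i))\<^sup>2)" if "x \<in> hcarrier ?D" for x
    using that by (simp add: direct_sum_ip direct_sum_carrier complete_ips.nm_sq[OF H])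
  show "Re (hinner ?D x x) > 0" if x: "x \<in> hcarrier ?D" "x \<noteq> 0" for x
  proof -
    obtain i where i: "i \<in> {1..n}" "x i \<noteq> 0"
      using x by (auto simp: direct_sum_carrier fun_eq_iff)
    then have "hnorm (H i) (x i) \<noteq> 0" using x complete_ips.nm_eq_0[OF H] by (auto simp: direct_sum_carrier)
    then show ?thesis unfolding Re_ip[OF x(1)] using i by (intro sum_pos2[of _ i]) auto
  qed
  fix X assume XC: "\<And>k::nat. X k \<in> hcarrier ?D"
    and cau: "\<And>e. e > 0 \<Longrightarrow> \<exists>N. \<forall>k\<ge>N. \<forall>m\<ge>N. hnorm ?D (X k - X m) < e"
  have XC': "X k i \<in> hcarrier (H i)" if "i \<in> {1..n}" for k i
    using XC[of k] that by (auto simp: direct_sum_carrier)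
  have comp_le: "hnorm (H i) (x i) \<le> hnorm ?D x" if x: "x \<in> hcarrier ?D" and i: "i \<in> {1..n}" for x i
  proof -
    have "(hnorm (H i) (x i))\<^sup>2 \<le> (\<Sum>i=1..n. (hnorm (H i) (x i))\<^sup>2)"
      using i by (intro member_le_sum) auto
    then show ?thesis unfolding hnorm_def[of ?D] Re_ip[OF x]
      using i x by (intro real_le_rsqrt) auto
  qed
  have diffC: "x - y \<in> hcarrier ?D" if "x \<in> hcarrier ?D" "y \<in> hcarrier ?D" for x y
    using that by (auto simp: direct_sum_carrier mems)
  have "\<exists>x\<in>hcarrier (H i). (\<lambda>k. hnorm (H i) (X k i - x)) \<longlonglongrightarrow> 0" if i: "i \<in> {1..n}" for i
  proof (rule complete_ips.complete[OF H[OF i]])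
    fix e :: real assume "e > 0"
    then obtain N where N: "\<forall>k\<ge>N. \<forall>m\<ge>N. hnorm ?D (X k - X m) < e" using cau by blast
    have "hnorm (H i) (X k i - X m i) \<le> hnorm ?D (X k - X m)" for k m
      using comp_le[OF diffC[OF XC XC] i] by simp
    then show "\<exists>N. \<forall>k\<ge>N. \<forall>m\<ge>N. hnorm (H i) (X k i - X m i) < e" using N by (meson le_less_trans)
  qed (use XC' i in blast)
  then obtain x where x: "\<And>i. i \<in> {1..n} \<Longrightarrow> x i \<in> hcarrier (H i)"
    "\<And>i. i \<in> {1..n} \<Longrightarrow> (\<lambda>k. hnorm (H i) (X k i - x i)) \<longlonglongrightarrow> 0" by metis
  define x' where "x' = (\<lambda>i. if i \<in> {1..n} then x i else 0)"
  have x'C: "x' \<in> hcarrier ?D" using x by (auto simp: direct_sum_carrier x'_def)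
  have "(\<lambda>k. sqrt (\<Sum>i=1..n. (hnorm (H i) (X k i - x i))\<^sup>2)) \<longlonglongrightarrow> sqrt (\<Sum>i=1..n. 0\<^sup>2)"
    by (intro tendsto_intros x(2))
  moreover have "hnorm ?D (X k - x') = sqrt (\<Sum>i=1..n. (hnorm (H i) (X k i - x i))\<^sup>2)" for k
    unfolding hnorm_def[of ?D] Re_ip[OF diffC[OF XC x'C]] by (simp add: x'_def)
  ultimately show "\<exists>x\<in>hcarrier ?D. (\<lambda>k. hnorm ?D (X k - x)) \<longlonglongrightarrow> 0"
    using x'C by (intro bexI[of _ x']) simp_all
qed

section \<open>Taylor coefficients\<close>

definition tcoeff :: "(complex \<Rightarrow> complex) \<Rightarrow> nat \<Rightarrow> complex" where
  "tcoeff f k = (deriv ^^ k) f 0 / fact k"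

lemma tcoeff_sums:
  assumes "f holomorphic_on ball 0 1" "z \<in> ball 0 1"
  shows "(\<lambda>k. tcoeff f k * z ^ k) sums f z"
  using holomorphic_power_series[OF assms] by (simp add: tcoeff_def)

lemma tcoeff_eqI:
  assumes "\<And>z. z \<in> ball 0 1 \<Longrightarrow> (\<lambda>k. c k * z ^ k) sums f z"
  shows "tcoeff f k = c k"
proof -
  have "norm (1/2 :: complex) \<le> conv_radius c"
    by (rule conv_radius_geI) (use assms[of "1/2"] in \<open>auto simp: sums_iff\<close>)
  then have pos: "fps_conv_radius (Abs_fps c) > 0"
    unfolding fps_conv_radius_def by (auto simp: Abs_fps_inverse intro: less_le_trans[rotated])
  have "eventually (\<lambda>z. z \<in> ball 0 1) (nhds (0::complex))"
    by (intro eventually_nhds_in_open) auto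
  then have "eventually (\<lambda>z. eval_fps (Abs_fps c) z = f z) (nhds 0)"
    by eventually_elim (use assms in \<open>auto simp: eval_fps_def sums_iff\<close>)
  with pos have "f has_fps_expansion Abs_fps c" by (simp add: has_fps_expansion_def)
  from fps_nth_fps_expansion[OF this, of k] show ?thesis by (simp add: tcoeff_def)
qed

lemma tcoeff_add:
  assumes "f holomorphic_on ball 0 1" "g holomorphic_on ball 0 1"
  shows "tcoeff (f + g) k = tcoeff f k + tcoeff g k"
  by (rule tcoeff_eqI) (use sums_add[OF tcoeff_sums[OF assms(1)] tcoeff_sums[OF assms(2)]] in
      \<open>simp add: algebra_simps\<close>)

lemma tcoeff_cmult:
  assumes "f holomorphic_on ball 0 1"
  shows "tcoeff (\<lambda>z. c * f z) k = c * tcoeff f k"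
  by (rule tcoeff_eqI) (use sums_mult[OF tcoeff_sums[OF assms], of _ c] in \<open>simp add: mult.assoc\<close>)

lemma tcoeff_shift:
  assumes "f holomorphic_on ball 0 1" "\<And>z. z \<in> ball 0 1 \<Longrightarrow> g z = z ^ m * f z"
  shows "tcoeff g k = (if k < m then 0 else tcoeff f (k - m))"
proof (rule tcoeff_eqI)
  fix z :: complex assume z: "z \<in> ball 0 1"
  have "(\<lambda>k. z ^ m * (tcoeff f k * z ^ k)) sums g z"
    unfolding assms(2)[OF z] by (intro sums_mult tcoeff_sums assms z)
  then have "(\<lambda>k. if k + m < m then 0 else tcoeff f (k + m - m) * z ^ (k + m)) sums g z"
    by (simp add: power_add mult_ac)
  then have "(\<lambda>k. if k < m then 0 else tcoeff f (k - m) * z ^ k) sums (g z + (\<Sum>i<m. if i < m then 0 else tcoeff f (i - m) * z ^ i))"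
    by (subst (asm) sums_iff_shift)
  then show "(\<lambda>k. (if k < m then 0 else tcoeff f (k - m)) * z ^ k) sums g z"
    by (simp add: if_distrib[of "\<lambda>x. x * _"] cong: if_cong)
qed

lemma tcoeff_nonzero:
  assumes "f holomorphic_on ball 0 1" "z \<in> ball 0 1" "f z \<noteq> 0"
  obtains k where "tcoeff f k \<noteq> 0"
proof -
  have "\<exists>k. tcoeff f k \<noteq> 0"
  proof (rule ccontr)
    assume "\<not> ?thesis"
    then have "(\<lambda>k. 0) sums f z" using tcoeff_sums[OF assms(1,2)] by simp
    then show False using assms(3) sums_unique2[OF sums_zero] by metis
  qed
  then show ?thesis using that by blast
qed

section \<open>Reproducing kernel spaces with a diagonal kernel\<close>

lemma on_disc_in [simp]: "z \<in> ball 0 1 \<Longrightarrow> on_disc f z = f z"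
  and on_disc_out [simp]: "z \<notin> ball 0 1 \<Longrightarrow> on_disc f z = 0"
  by (auto simp: on_disc_def)

locale diag_rkhs =
  fixes H :: "(complex \<Rightarrow> complex) hspace" and a :: "nat \<Rightarrow> real"
  assumes a_pos: "\<And>k. a k > 0"
    and a_summable: "\<And>z w. z \<in> ball 0 1 \<Longrightarrow> w \<in> ball 0 1 \<Longrightarrow>
           summable (\<lambda>k. complex_of_real (a k) * z ^ k * cnj w ^ k)"
    and rkhs: "rkhs_disc H (diag_kernel a)"
    and shift_bounded: "bounded_op H H (mult_op (\<lambda>z. z))"
begin

sublocale complete_ips H
  using rkhs by (auto simp: rkhs_disc_def hilbert_space_complete_ips)

definition "kern w = on_disc (\<lambda>z. diag_kernel a z w)"
definition "pw k = on_disc (\<lambda>z. z ^ k)"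

lemma mem_holo: "f \<in> C \<Longrightarrow> f holomorphic_on ball 0 1"
  and mem_out: "f \<in> C \<Longrightarrow> z \<notin> ball 0 1 \<Longrightarrow> f z = 0"
  and kern_mem: "w \<in> ball 0 1 \<Longrightarrow> kern w \<in> C"
  and reproducing: "w \<in> ball 0 1 \<Longrightarrow> f \<in> C \<Longrightarrow> f w = ip f (kern w)"
  using rkhs on_disc_out[of z f] by (auto simp: rkhs_disc_def kern_def)

lemma mem_eqI: "f \<in> C \<Longrightarrow> g \<in> C \<Longrightarrow> (\<And>z. z \<in> ball 0 1 \<Longrightarrow> f z = g z) \<Longrightarrow> f = g"
  by (rule ext) (metis mem_out)

lemma kern_total: "f \<in> C \<Longrightarrow> (\<And>g. g \<in> kern ` ball 0 1 \<Longrightarrow> ip f g = 0) \<Longrightarrow> f = 0"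
  by (rule mem_eqI) (auto simp: reproducing)

lemma kern_sums:
  assumes "z \<in> ball 0 1" "w \<in> ball 0 1"
  shows "(\<lambda>k. (of_real (a k) * cnj w ^ k) * z ^ k) sums kern w z"
  using summable_sums[OF a_summable[OF assms]] assms by (simp add: kern_def diag_kernel_def mult_ac)

lemma kern_diag_sums:
  assumes "w \<in> ball 0 1"
  shows "(\<lambda>k. complex_of_real (a k * (cmod w ^ 2) ^ k)) sums kern w w"
proof -
  have "(\<lambda>k. (of_real (a k) * cnj w ^ k) * w ^ k) sums kern w w" by (rule kern_sums[OF assms assms])
  also have "(\<lambda>k. (of_real (a k) * cnj w ^ k) * w ^ k) = (\<lambda>k. of_real (a k * (cmod w ^ 2) ^ k))"
    by (auto simp: complex_norm_square[symmetric] mult_ac power_mult_distrib[symmetric])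
  finally show ?thesis .
qed

lemma tcoeff_kern: "w \<in> ball 0 1 \<Longrightarrow> tcoeff (kern w) k = of_real (a k) * cnj w ^ k"
  by (rule tcoeff_eqI) (rule kern_sums)

lemma tcoeff_bound: "\<exists>B. \<forall>f\<in>C. cmod (tcoeff f k) \<le> B * nm f"
proof -
  have half: "(1/2::complex) \<in> ball 0 1" by simp
  have bd: "nm (kern w) \<le> nm (kern (1/2))" if w: "cmod w = 1/2" for w
  proof -
    have wb: "w \<in> ball 0 1" using w by simp
    from kern_diag_sums[OF wb] kern_diag_sums[OF half] have "kern w w = kern (1/2) (1/2)"
      using w by (simp add: sums_unique2)
    moreover have "(nm (kern v))\<^sup>2 = Re (kern v v)" if "v \<in> ball 0 1" for v
      using that by (simp add: nm_sq kern_mem reproducing[OF that kern_mem[OF that]])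
    ultimately have "(nm (kern w))\<^sup>2 = (nm (kern (1/2)))\<^sup>2" using wb half by simp
    then show ?thesis using kern_mem[OF wb] kern_mem[OF half] by simp
  qed
  have "cmod (tcoeff f k) \<le> (nm (kern (1/2)) / (1/2) ^ k) * nm f" if f: "f \<in> C" for f
  proof -
    have "norm ((deriv ^^ k) f 0) \<le> fact k * (nm f * nm (kern (1/2))) / (1/2) ^ k"
    proof (rule Cauchy_inequality)
      show "f holomorphic_on ball 0 (1/2)"
        by (rule holomorphic_on_subset[OF mem_holo[OF f]]) auto
      show "continuous_on (cball 0 (1/2)) f"
        by (rule continuous_on_subset[OF holomorphic_on_imp_continuous_on[OF mem_holo[OF f]]]) auto
      fix x assume "cmod (0 - x) = 1/2"
      then have x: "cmod x = 1/2" "x \<in> ball 0 1" by auto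
      have "cmod (f x) \<le> nm f * nm (kern x)"
        using cauchy_schwarz[OF f kern_mem[OF x(2)]] reproducing[OF x(2) f] by simp
      also have "\<dots> \<le> nm f * nm (kern (1/2))" using bd[OF x(1)] f by (intro mult_left_mono) auto
      finally show "cmod (f x) \<le> nm f * nm (kern (1/2))" .
    qed simp
    then show ?thesis by (simp add: tcoeff_def norm_divide field_simps)
  qed
  then show ?thesis by blast
qed

text \<open>By Cauchy's inequality the \<open>k\<close>-th Taylor coefficient is a bounded functional, so it is the
  inner product with some vector. Pairing this vector with the kernel functions shows that it is
  \<open>a k \<cdot> z\<^sup>k\<close>. In particular the monomials belong to the space, they are orthogonal, and
  \<open>\<parallel>z\<^sup>k\<parallel>\<^sup>2 = 1 / a k\<close>.\<close>

lemma pw_mem: "pw k \<in> C" and tcoeff_ip: "f \<in> C \<Longrightarrow> tcoeff f k = of_real (a k) * ip f (pw k)"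
proof -
  obtain B where B: "\<And>f. f \<in> C \<Longrightarrow> cmod (tcoeff f k) \<le> B * nm f" using tcoeff_bound by blast
  obtain e where e: "e \<in> C" "\<And>f. f \<in> C \<Longrightarrow> tcoeff f k = ip f e"
  proof (rule riesz[of "\<lambda>f. tcoeff f k" B])
    show "tcoeff (c *\<^sub>C f) k = c * tcoeff f k" if "f \<in> C" for c f
      using tcoeff_cmult[OF mem_holo[OF that]] by (simp add: scaleC_fun_def)
  qed (use B tcoeff_add mem_holo in auto)
  have ev: "e w = of_real (a k) * w ^ k" if w: "w \<in> ball 0 1" for w
  proof -
    have "e w = ip e (kern w)" by (rule reproducing[OF w e(1)])
    also have "\<dots> = cnj (ip (kern w) e)" by (rule ip_cnj[OF kern_mem[OF w] e(1)])
    also have "\<dots> = cnj (tcoeff (kern w) k)" by (simp add: e(2) kern_mem[OF w])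
    finally show ?thesis using w by (simp add: tcoeff_kern)
  qed
  have m: "pw k = of_real (1 / a k) *\<^sub>C e"
  proof
    fix z show "pw k z = (of_real (1 / a k) *\<^sub>C e) z"
      using a_pos[of k] by (cases "z \<in> ball 0 1") (auto simp: pw_def ev mem_out[OF e(1)])
  qed
  show "pw k \<in> C" unfolding m by (rule scale_mem[OF e(1)])
  show "tcoeff f k = of_real (a k) * ip f (pw k)" if "f \<in> C"
    using that e a_pos[of k] by (simp add: m ip_scale_r)
qed

lemma tcoeff_pw: "tcoeff (pw k) m = (if m = k then 1 else 0)"
proof -
  have "tcoeff (pw k) m = (if m < k then 0 else tcoeff (\<lambda>_. 1) (m - k))"
    by (rule tcoeff_shift) (auto simp: pw_def)
  moreover have "tcoeff (\<lambda>_. 1) j = (if j = 0 then 1 else 0)" for j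
    by (rule tcoeff_eqI) (use sums_single[of 0 "\<lambda>_. 1 :: complex"] in
        \<open>simp add: if_distrib[of "\<lambda>x. x * _"] cong: if_cong\<close>)
  ultimately show ?thesis by auto
qed

lemma nm_pw: "(nm (pw k))\<^sup>2 = 1 / a k"
proof -
  have "1 = of_real (a k) * ip (pw k) (pw k)"
    using tcoeff_ip[OF pw_mem, of k k] tcoeff_pw[of k k] by simp
  then have "complex_of_real (a k * (nm (pw k))\<^sup>2) = 1" by (simp add: ip_self pw_mem)
  then have "a k * (nm (pw k))\<^sup>2 = 1" by (simp only: of_real_eq_1_iff)
  then show ?thesis using a_pos[of k] by (simp add: field_simps)
qed

lemma tcoeff_le: assumes f: "f \<in> C" shows "(cmod (tcoeff f k))\<^sup>2 \<le> a k * (nm f)\<^sup>2"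
proof -
  have "cmod (tcoeff f k) \<le> a k * (nm f * nm (pw k))"
    unfolding tcoeff_ip[OF f] using cauchy_schwarz[OF f pw_mem] a_pos[of k]
    by (simp add: norm_mult)
  then have "(cmod (tcoeff f k))\<^sup>2 \<le> (a k * (nm f * nm (pw k)))\<^sup>2"
    by (rule power_mono) simp
  also have "\<dots> = a k * (nm f)\<^sup>2"
    using a_pos[of k] by (simp add: power_mult_distrib nm_pw) (simp add: power2_eq_square)
  finally show ?thesis .
qed

lemma mult_z_pw: "mult_op (\<lambda>z. z) (pw k) = pw (Suc k)"
  by (auto simp: mult_op_def pw_def on_disc_def)

lemma a_le_Suc: "\<exists>B\<ge>0. \<forall>k. a k \<le> B * a (Suc k)"
proof -
  obtain B where B: "B \<ge> 0" "\<And>f. f \<in> C \<Longrightarrow> nm (mult_op (\<lambda>z. z) f) \<le> B * nm f"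
    using bounded_op_bound[OF shift_bounded complete_ips_axioms] by metis
  have "a k \<le> B\<^sup>2 * a (Suc k)" for k
  proof -
    have "(nm (pw (Suc k)))\<^sup>2 \<le> (B * nm (pw k))\<^sup>2"
      using B(2)[OF pw_mem[of k]] by (intro power_mono) (auto simp: mult_z_pw pw_mem)
    then show ?thesis using a_pos[of k] a_pos[of "Suc k"]
      by (simp add: nm_pw power_mult_distrib field_simps)
  qed
  then show ?thesis by (intro exI[of _ "B\<^sup>2"]) auto
qed

text \<open>If the adjoint of the shift is onto, then the shift is bounded below, by the uniform
  boundedness principle: the inner product of \<open>z\<^sup>k / \<parallel>z\<^sup>k\<^sup>+\<^sup>1\<parallel>\<close> with the vector \<open>M\<^sub>z\<^sup>* u\<close> is that of
  \<open>z\<^sup>k\<^sup>+\<^sup>1 / \<parallel>z\<^sup>k\<^sup>+\<^sup>1\<parallel>\<close> with \<open>u\<close>.\<close>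

lemma a_Suc_le:
  assumes surj: "adjoint_op H H (mult_op (\<lambda>z. z)) ` C = C"
  shows "\<exists>B\<ge>0. \<forall>k. a (Suc k) \<le> B * a k"
proof -
  let ?M = "mult_op (\<lambda>z. z)"
  note adj = adjoint_pairD[OF adjoint_pair_adjoint_op[OF complete_ips_axioms complete_ips_axioms shift_bounded]]
  define S where "S = range (\<lambda>k. of_real (1 / nm (pw (Suc k))) *\<^sub>C pw k)"
  have npos: "nm (pw k) > 0" for k
    using nm_pw[of k] a_pos[of k] pw_mem[of k]
    by (metis less_eq_real_def nm_nonneg power_zero_numeral zero_less_divide_1_iff less_irrefl)
  have "\<exists>B. \<forall>y\<in>S. nm y \<le> B"
  proof (rule weakly_bounded_imp_bounded)
    show "S \<subseteq> C" by (auto simp: S_def scale_mem pw_mem)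
    fix x assume "x \<in> C"
    then obtain u where u: "u \<in> C" "x = adjoint_op H H ?M u" using surj by blast
    have "cmod (ip x (of_real (1 / nm (pw (Suc k))) *\<^sub>C pw k)) \<le> nm u" for k
    proof -
      have "ip (pw k) x = ip (pw (Suc k)) u" using adj(3)[OF pw_mem u(1)] u by (simp add: mult_z_pw)
      then have "cmod (ip x (pw k)) \<le> nm (pw (Suc k)) * nm u"
        using cauchy_schwarz[OF pw_mem u(1)] ip_cnj[OF pw_mem \<open>x \<in> C\<close>] by simp
      then show ?thesis using npos[of "Suc k"] \<open>x \<in> C\<close>
        by (simp add: ip_scale_r pw_mem norm_mult norm_divide field_simps)
    qed
    then show "\<exists>B. \<forall>y\<in>S. cmod (ip x y) \<le> B" by (auto simp: S_def)
  qed
  then obtain B where B: "\<And>k. nm (of_real (1 / nm (pw (Suc k))) *\<^sub>C pw k) \<le> B"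
    by (auto simp: S_def)
  have "a (Suc k) \<le> B\<^sup>2 * a k" for k
  proof -
    have "nm (pw k) \<le> B * nm (pw (Suc k))"
      using B[of k] npos[of "Suc k"] by (simp add: nm_scale pw_mem norm_divide field_simps)
    then have "(nm (pw k))\<^sup>2 \<le> (B * nm (pw (Suc k)))\<^sup>2"
      by (intro power_mono) (auto simp: pw_mem)
    then show ?thesis using a_pos[of k] a_pos[of "Suc k"]
      by (simp add: nm_pw power_mult_distrib field_simps)
  qed
  then show ?thesis by (intro exI[of _ "B\<^sup>2"]) auto
qed

end

lemma mult_op_bounded:
  assumes H1: "diag_rkhs H1 a1" and H2: "diag_rkhs H2 a2"
    and h: "\<And>f. f \<in> hcarrier H1 \<Longrightarrow> mult_op h f \<in> hcarrier H2"
  shows "bounded_op H1 H2 (mult_op h)"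
proof -
  interpret h1: diag_rkhs H1 a1 by fact
  interpret h2: diag_rkhs H2 a2 by fact
  show ?thesis
  proof (rule bounded_if_weakly_continuous[OF h1.complete_ips_axioms h2.complete_ips_axioms])
    show "linear_op H1 H2 (mult_op h)"
      using h by (auto simp: linear_op_def mult_op_def fun_eq_iff algebra_simps)
    show "h2.kern ` ball 0 1 \<subseteq> h2.C" using h2.kern_mem by blast
    fix g assume "g \<in> h2.kern ` ball 0 1"
    then obtain w where w: "w \<in> ball 0 1" "g = h2.kern w" by blast
    have "h2.ip (mult_op h f) g = h1.ip f (cnj (h w) *\<^sub>C h1.kern w)" if f: "f \<in> h1.C" for f
      using h2.reproducing[OF w(1) h[OF f]] h1.reproducing[OF w(1) f] h1.kern_mem[OF w(1)] f w(2)
      by (simp add: h1.ip_scale_r mult_op_def)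
    then show "\<exists>y\<in>h1.C. \<forall>x\<in>h1.C. h2.ip (mult_op h x) g = h1.ip x y"
      using h1.scale_mem h1.kern_mem[OF w(1)] by blast
  qed (rule h2.kern_total)
qed

lemma composition_bounded:
  assumes H: "diag_rkhs H a" and \<phi>: "\<phi> ` ball 0 1 \<subseteq> ball 0 1"
    and h: "\<And>f. f \<in> hcarrier H \<Longrightarrow> on_disc (f \<circ> \<phi>) \<in> hcarrier H"
  shows "bounded_op H H (\<lambda>f. on_disc (f \<circ> \<phi>))"
proof -
  interpret diag_rkhs H a by fact
  show ?thesis
  proof (rule bounded_if_weakly_continuous[OF complete_ips_axioms complete_ips_axioms])
    show "linear_op H H (\<lambda>f. on_disc (f \<circ> \<phi>))"
      using h by (auto simp: linear_op_def on_disc_def fun_eq_iff)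
    show "kern ` ball 0 1 \<subseteq> C" using kern_mem by blast
    fix g assume "g \<in> kern ` ball 0 1"
    then obtain w where w: "w \<in> ball 0 1" "g = kern w" by blast
    have "\<phi> w \<in> ball 0 1" using \<phi> w by blast
    then have "ip (on_disc (f \<circ> \<phi>)) g = ip f (kern (\<phi> w))" if f: "f \<in> C" for f
      using reproducing[OF w(1) h[OF f]] reproducing[OF _ f] w by simp
    then show "\<exists>y\<in>C. \<forall>x\<in>C. ip (on_disc (x \<circ> \<phi>)) g = ip x y"
      using kern_mem \<open>\<phi> w \<in> ball 0 1\<close> by blast
  qed (rule kern_total)
qed

lemma inclusion_imp_coeff_le:
  assumes H1: "diag_rkhs H1 a1" and H2: "diag_rkhs H2 a2" and sub: "hcarrier H1 \<subseteq> hcarrier H2"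
  shows "\<exists>B\<ge>0. \<forall>k. a1 k \<le> B * a2 k"
proof -
  interpret h1: diag_rkhs H1 a1 by fact
  interpret h2: diag_rkhs H2 a2 by fact
  have "bounded_op H1 H2 (mult_op (\<lambda>_. 1))"
    by (rule mult_op_bounded[OF H1 H2]) (use sub in \<open>auto simp: mult_op_def\<close>)
  then obtain B where B: "B \<ge> 0" "\<And>f. f \<in> h1.C \<Longrightarrow> h2.nm f \<le> B * h1.nm f"
    by (rule bounded_op_bound[OF _ h1.complete_ips_axioms]) (simp add: mult_op_def)
  have "a1 k \<le> B\<^sup>2 * a2 k" for k
  proof -
    have m: "h2.pw k = h1.pw k" by (simp add: h1.pw_def h2.pw_def)
    have "(h2.nm (h2.pw k))\<^sup>2 \<le> (B * h1.nm (h1.pw k))\<^sup>2"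
      using B(2)[OF h1.pw_mem[of k]] h2.pw_mem[of k] m by (intro power_mono) auto
    then show ?thesis using h1.a_pos[of k] h2.a_pos[of k]
      by (simp add: h1.nm_pw h2.nm_pw power_mult_distrib field_simps)
  qed
  then show ?thesis by (intro exI[of _ "B\<^sup>2"]) auto
qed

text \<open>The vector \<open>v\<close> representing \<open>f \<mapsto> A f w\<close> satisfies \<open>\<langle>z\<^sup>k, v\<rangle> = w\<^sup>k \<langle>1, v\<rangle>\<close>. Its Taylor coefficients
  are therefore those of a multiple of the kernel function at \<open>w\<close>.\<close>

lemma shift_intertwiner_is_mult:
  assumes H1: "diag_rkhs H1 a1" and H2: "diag_rkhs H2 a2" and A: "bounded_op H1 H2 A"
    and comm: "\<And>f. f \<in> hcarrier H1 \<Longrightarrow> A (mult_op (\<lambda>z. z) f) = mult_op (\<lambda>z. z) (A f)"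
    and f: "f \<in> hcarrier H1"
  shows "A f = mult_op (A (on_disc (\<lambda>_. 1))) f"
proof
  interpret h1: diag_rkhs H1 a1 by fact
  interpret h2: diag_rkhs H2 a2 by fact
  fix w
  have m0: "h1.pw 0 = on_disc (\<lambda>_. 1)" by (simp add: h1.pw_def)
  have AC: "A g \<in> h2.C" if "g \<in> h1.C" for g using bounded_opD(1)[OF A that] .
  show "A f w = mult_op (A (on_disc (\<lambda>_. 1))) f w"
  proof (cases "w \<in> ball 0 1")
    case True
    obtain B where B: "adjoint_pair H1 H2 A B"
      using bounded_op_adjoint[OF h1.complete_ips_axioms h2.complete_ips_axioms A] .
    define v where "v = B (h2.kern w)"
    define h where "h = A (h1.pw 0)"
    have v: "v \<in> h1.C" unfolding v_def by (rule adjoint_pairD[OF B]) (rule h2.kern_mem[OF True])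
    have ipv: "h1.ip g v = A g w" if "g \<in> h1.C" for g
      using adjoint_pairD(3)[OF B that h2.kern_mem[OF True]] h2.reproducing[OF True AC[OF that]]
      by (simp add: v_def)
    have Am: "A (h1.pw k) w = w ^ k * h w" for k
    proof (induction k)
      case (Suc k)
      have "A (h1.pw (Suc k)) = mult_op (\<lambda>z. z) (A (h1.pw k))"
        using comm[OF h1.pw_mem] by (simp add: h1.mult_z_pw)
      then show ?case using Suc by (simp add: mult_op_def)
    qed (simp add: h_def)
    have tv: "tcoeff v k = cnj (h w) * tcoeff (h1.kern w) k" for k
    proof -
      have "tcoeff v k = of_real (a1 k) * cnj (h1.ip (h1.pw k) v)"
        using h1.tcoeff_ip[OF v] h1.ip_cnj[OF h1.pw_mem v] by simp
      then show ?thesis by (simp add: ipv h1.pw_mem Am h1.tcoeff_kern[OF True])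
    qed
    have "v = cnj (h w) *\<^sub>C h1.kern w"
    proof (rule h1.mem_eqI[OF v h1.scale_mem[OF h1.kern_mem[OF True]]])
      fix z :: complex assume z: "z \<in> ball 0 1"
      have "(\<lambda>k. tcoeff v k * z ^ k) sums (cnj (h w) * h1.kern w z)"
        unfolding tv mult.assoc by (intro sums_mult tcoeff_sums h1.mem_holo h1.kern_mem True z)
      then show "v z = (cnj (h w) *\<^sub>C h1.kern w) z"
        using sums_unique2[OF tcoeff_sums[OF h1.mem_holo[OF v] z]] by simp
    qed
    then have "A f w = h w * f w"
      using ipv[OF f] f h1.kern_mem[OF True] h1.reproducing[OF True f] by (simp add: h1.ip_scale_r)
    then show ?thesis by (simp add: mult_op_def h_def m0)
  qed (simp add: mult_op_def h2.mem_out AC f h1.mem_out)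
qed

text \<open>The analytic core of the rigidity. The relation \<open>A M\<^sub>z - M\<^sub>z A = M\<^sub>u\<close> gives
  \<open>A z\<^sup>k\<^sup>+\<^sup>1 = z\<^sup>k (z \<cdot> A 1 + (k + 1) u)\<close>, whose Taylor coefficient of order \<open>k + d\<close> grows like \<open>k\<close> times
  the \<open>d\<close>-th coefficient of \<open>u\<close>. Boundedness of \<open>A\<close> bounds it by a constant times
  \<open>\<parallel>z\<^sup>k\<^sup>+\<^sup>1\<parallel>\<^sub>1 / \<parallel>z\<^sup>k\<^sup>+\<^sup>d\<parallel>\<^sub>2\<close>. Here \<open>z\<^sup>k\<^sup>+\<^sup>d\<close> may be replaced by \<open>z\<^sup>k\<^sup>+\<^sup>1\<close> at the cost of a constant, because the
  shift on \<open>H2\<close> is bounded and bounded below; so the assumption on the ratios \<open>a1 k / a2 k\<close> makes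
  the \<open>d\<close>-th coefficient vanish.\<close>

lemma commutator_mult_zero:
  assumes H1: "diag_rkhs H1 a1" and H2: "diag_rkhs H2 a2" and A: "bounded_op H1 H2 A"
    and u: "u holomorphic_on ball 0 1"
    and comm: "\<And>f. f \<in> hcarrier H1 \<Longrightarrow>
       A (mult_op (\<lambda>z. z) f) - mult_op (\<lambda>z. z) (A f) = mult_op u f"
    and surj: "adjoint_op H2 H2 (mult_op (\<lambda>z. z)) ` hcarrier H2 = hcarrier H2"
    and lim: "filterlim (\<lambda>k. real k * sqrt (a1 k / a2 k)) at_top sequentially"
    and w: "w \<in> ball 0 1"
  shows "u w = 0"
proof (rule ccontr)
  assume "u w \<noteq> 0"
  then obtain d where d: "tcoeff u d \<noteq> 0" using tcoeff_nonzero[OF u w] by blast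
  interpret h1: diag_rkhs H1 a1 by fact
  interpret h2: diag_rkhs H2 a2 by fact
  have AC: "A g \<in> h2.C" if "g \<in> h1.C" for g using bounded_opD(1)[OF A that] .
  obtain B where B: "B \<ge> 0" "\<And>f. f \<in> h1.C \<Longrightarrow> h2.nm (A f) \<le> B * h1.nm f"
    using bounded_op_bound[OF A h1.complete_ips_axioms] by metis
  define h where "h = A (h1.pw 0)"
  have h: "h holomorphic_on ball 0 1" unfolding h_def by (intro h2.mem_holo AC h1.pw_mem)
  have Am: "A (h1.pw (Suc k)) z = z ^ k * (z * h z + of_nat (Suc k) * u z)" if z: "z \<in> ball 0 1" for k z
  proof (induction k)
    case 0
    have "A (h1.pw 1) = mult_op (\<lambda>z. z) h + mult_op u (h1.pw 0)"
      using comm[OF h1.pw_mem, of 0] by (simp add: h1.mult_z_pw h_def algebra_simps)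
    then show ?case using z by (simp add: mult_op_def h1.pw_def)
  next
    case (Suc k)
    have "A (h1.pw (Suc (Suc k))) = mult_op (\<lambda>z. z) (A (h1.pw (Suc k))) + mult_op u (h1.pw (Suc k))"
      using comm[OF h1.pw_mem, of "Suc k"] by (simp add: h1.mult_z_pw algebra_simps)
    then show ?case using z Suc by (simp add: mult_op_def h1.pw_def algebra_simps)
  qed
  define c where "c = tcoeff (\<lambda>z. z * h z) d"
  have tc: "tcoeff (A (h1.pw (Suc k))) (k + d) = c + of_nat (Suc k) * tcoeff u d" for k
  proof -
    have "tcoeff (A (h1.pw (Suc k))) (k + d) = tcoeff ((\<lambda>z. z * h z) + (\<lambda>z. of_nat (Suc k) * u z)) d"
      by (subst tcoeff_shift[of "(\<lambda>z. z * h z) + (\<lambda>z. of_nat (Suc k) * u z)" _ k])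
        (use Am in \<open>auto simp: plus_fun_def intro!: holomorphic_intros h u\<close>)
    also have "\<dots> = c + of_nat (Suc k) * tcoeff u d"
      unfolding c_def by (subst tcoeff_add) (auto intro!: holomorphic_intros h u simp: tcoeff_cmult[OF u])
    finally show ?thesis .
  qed
  obtain P where P: "P \<ge> 0" "\<And>k. a2 k \<le> P * a2 (Suc k)" using h2.a_le_Suc by blast
  obtain Q where Q: "Q \<ge> 0" "\<And>k. a2 (Suc k) \<le> Q * a2 k" using h2.a_Suc_le[OF surj] by blast
  have step: "a2 (k + e) \<le> Q ^ e * a2 k" for k e
  proof (induction e)
    case (Suc e)
    have "a2 (k + Suc e) \<le> Q * a2 (k + e)" using Q(2) by simp
    also have "\<dots> \<le> Q * (Q ^ e * a2 k)" by (rule mult_left_mono[OF Suc Q(1)])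
    finally show ?case by simp
  qed simp
  \<comment> \<open>\<open>k + d\<close> is reached from \<open>Suc k\<close> by one step down and \<open>d\<close> steps up, which also covers \<open>d = 0\<close>\<close>
  define E where "E = Q ^ d * P"
  have E0: "E \<ge> 0" using P(1) Q(1) by (simp add: E_def)
  have E: "a2 (k + d) \<le> E * a2 (Suc k)" for k
  proof -
    have "a2 (k + d) \<le> Q ^ d * a2 k" by (rule step)
    also have "\<dots> \<le> Q ^ d * (P * a2 (Suc k))" using P(2)[of k] Q(1) by (intro mult_left_mono) auto
    finally show ?thesis by (simp add: E_def mult.assoc)
  qed
  have key: "cmod (c + of_nat (Suc k) * tcoeff u d) * sqrt (a1 (Suc k) / a2 (Suc k)) \<le> sqrt E * B" for k
  proof -
    have "(cmod (c + of_nat (Suc k) * tcoeff u d))\<^sup>2 \<le> a2 (k + d) * (h2.nm (A (h1.pw (Suc k))))\<^sup>2"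
      using h2.tcoeff_le[OF AC[OF h1.pw_mem]] unfolding tc[symmetric] .
    also have "\<dots> \<le> (E * a2 (Suc k)) * (B * h1.nm (h1.pw (Suc k)))\<^sup>2"
      using E B(2)[OF h1.pw_mem] h2.a_pos[of "Suc k"] E0
      by (intro mult_mono power_mono) (auto simp: AC h1.pw_mem less_imp_le)
    also have "\<dots> = E * B\<^sup>2 * (a2 (Suc k) / a1 (Suc k))"
      by (simp add: power_mult_distrib h1.nm_pw)
    finally have "(cmod (c + of_nat (Suc k) * tcoeff u d))\<^sup>2 * (a1 (Suc k) / a2 (Suc k)) \<le> E * B\<^sup>2"
      using h1.a_pos[of "Suc k"] h2.a_pos[of "Suc k"] by (simp add: field_simps)
    then have "sqrt ((cmod (c + of_nat (Suc k) * tcoeff u d))\<^sup>2 * (a1 (Suc k) / a2 (Suc k))) \<le> sqrt (E * B\<^sup>2)"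
      by (rule real_sqrt_le_mono)
    then show ?thesis using B(1) by (simp only: real_sqrt_mult real_sqrt_abs abs_norm_cancel abs_of_nonneg)
  qed
  define \<rho> where "\<rho> k = real k * sqrt (a1 k / a2 k)" for k
  define t where "t = cmod (tcoeff u d)"
  have t: "t > 0" using d by (simp add: t_def)
  have "eventually (\<lambda>k. \<rho> k > 2 * (sqrt E * B) / t \<and> real k \<ge> 2 * cmod c / t) sequentially"
    using lim[unfolded filterlim_at_top_dense] filterlim_real_sequentially[unfolded filterlim_at_top]
    unfolding \<rho>_def by (intro eventually_conj) blast+
  then obtain k0 where k0: "\<And>k. k \<ge> k0 \<Longrightarrow> \<rho> k > 2 * (sqrt E * B) / t \<and> real k \<ge> 2 * cmod c / t"
    unfolding eventually_sequentially by blast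
  define k where "k = Suc k0"
  have "real k * t \<le> 2 * (real k * t - cmod c)"
    using k0[of k] t by (simp add: k_def field_simps)
  also have "real k * t - cmod c \<le> cmod (c + of_nat k * tcoeff u d)"
    using norm_diff_ineq[of "of_nat k * tcoeff u d" c] by (simp add: t_def norm_mult add.commute)
  finally have "real k * t * sqrt (a1 k / a2 k) \<le> 2 * cmod (c + of_nat k * tcoeff u d) * sqrt (a1 k / a2 k)"
    using h1.a_pos[of k] h2.a_pos[of k] by (intro mult_right_mono) auto
  also have "\<dots> \<le> 2 * (sqrt E * B)" using key[of k0] by (simp add: k_def)
  finally have "t * \<rho> k \<le> 2 * (sqrt E * B)" by (simp add: \<rho>_def mult_ac)
  then show False using k0[of k] t by (simp add: k_def field_simps)
qed

section \<open>The algebra of bounded holomorphic functions\<close>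

lemma H_infinityI:
  assumes "h holomorphic_on ball 0 1" "\<And>z. z \<in> ball 0 1 \<Longrightarrow> cmod (h z) \<le> B"
  shows "h \<in> H_infinity"
  using assms by (auto simp: H_infinity_def bounded_iff intro!: exI[of _ B])

lemma H_infinityE:
  assumes "h \<in> H_infinity"
  obtains B where "B > 0" "h holomorphic_on ball 0 1" "\<And>z. z \<in> ball 0 1 \<Longrightarrow> cmod (h z) \<le> B"
  using assms unfolding H_infinity_def bounded_pos by (auto simp: bounded_pos)

lemma H_infinity_cong:
  assumes "h \<in> H_infinity" "\<And>z. z \<in> ball 0 1 \<Longrightarrow> g z = h z" shows "g \<in> H_infinity"
proof (rule H_infinityE[OF assms(1)])
  fix B assume "h holomorphic_on ball 0 1" "\<And>z. z \<in> ball 0 1 \<Longrightarrow> cmod (h z) \<le> B"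
  then show ?thesis using assms(2) holomorphic_cong[OF refl, of "ball 0 1" g h]
    by (intro H_infinityI[of g B]) auto
qed

lemma H_infinity_const [simp]: "(\<lambda>_. c) \<in> H_infinity"
  by (rule H_infinityI[of _ "cmod c"]) auto

lemma H_infinity_ident [simp]: "(\<lambda>z. z) \<in> H_infinity"
  by (rule H_infinityI[of _ 1]) auto

lemma H_infinity_add: "f \<in> H_infinity \<Longrightarrow> g \<in> H_infinity \<Longrightarrow> (\<lambda>z. f z + g z) \<in> H_infinity"
  by (elim H_infinityE, rule H_infinityI[of _ "_ + _"])
    (auto intro!: holomorphic_intros norm_triangle_le add_mono)

lemma H_infinity_mult: "f \<in> H_infinity \<Longrightarrow> g \<in> H_infinity \<Longrightarrow> (\<lambda>z. f z * g z) \<in> H_infinity"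
  by (elim H_infinityE, rule H_infinityI[of _ "_ * _"])
    (auto intro!: holomorphic_intros mult_mono simp: norm_mult less_imp_le)

lemma H_infinity_diff:
  assumes "f \<in> H_infinity" "g \<in> H_infinity" shows "(\<lambda>z. f z - g z) \<in> H_infinity"
  using H_infinity_add[OF assms(1) H_infinity_mult[OF H_infinity_const[of "-1"] assms(2)]] by simp

lemma H_infinity_sum: "(\<And>i. i \<in> I \<Longrightarrow> f i \<in> H_infinity) \<Longrightarrow> (\<lambda>z. \<Sum>i\<in>I. f i z) \<in> H_infinity"
  by (induction I rule: infinite_finite_induct) (auto intro!: H_infinity_add)

definition Hinf_units :: "(complex \<Rightarrow> complex) set" where
  "Hinf_units = {h \<in> H_infinity. \<exists>\<delta>>0. \<forall>z\<in>ball 0 1. \<delta> \<le> cmod (h z)}"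

lemma Hinf_units_mem: "h \<in> Hinf_units \<Longrightarrow> h \<in> H_infinity"
  by (simp add: Hinf_units_def)

lemma Hinf_units_nz:
  assumes "h \<in> Hinf_units" "z \<in> ball 0 1" shows "h z \<noteq> 0"
proof -
  obtain \<delta> where "\<delta> > 0" "\<delta> \<le> cmod (h z)" using assms by (auto simp: Hinf_units_def)
  then show ?thesis by auto
qed

lemma Hinf_units_inverse: 
  assumes "h \<in> Hinf_units" shows "(\<lambda>z. 1 / h z) \<in> Hinf_units"
proof -
  obtain \<delta> where d: "\<delta> > 0" "\<And>z. z \<in> ball 0 1 \<Longrightarrow> \<delta> \<le> cmod (h z)" using assms by (auto simp: Hinf_units_def)
  obtain B where B: "B > 0" "h holomorphic_on ball 0 1" "\<And>z. z \<in> ball 0 1 \<Longrightarrow> cmod (h z) \<le> B"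
    using H_infinityE[OF Hinf_units_mem[OF assms]] by metis
  have nz: "h z \<noteq> 0" if "z \<in> ball 0 1" for z using Hinf_units_nz[OF assms that] .
  have "(\<lambda>z. 1 / h z) \<in> H_infinity"
  proof (rule H_infinityI[of _ "1 / \<delta>"])
    show "cmod (1 / h z) \<le> 1 / \<delta>" if "z \<in> ball 0 1" for z
      using d(1) d(2)[OF that] by (simp add: norm_divide frac_le)
  qed (use nz in \<open>auto intro!: holomorphic_intros B\<close>)
  moreover have "1 / B \<le> cmod (1 / h z)" if "z \<in> ball 0 1" for z
    using B(3)[OF that] nz[OF that] by (simp add: norm_divide frac_le)
  ultimately show ?thesis using B(1) by (auto simp: Hinf_units_def intro!: exI[of _ "1 / B"])
qed

lemma Hinf_units_mult:
  assumes "f \<in> Hinf_units" "g \<in> Hinf_units" shows "(\<lambda>z. f z * g z) \<in> Hinf_units"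
proof -
  obtain d e where "d > 0" "\<And>z. z \<in> ball 0 1 \<Longrightarrow> d \<le> cmod (f z)" "e > 0" "\<And>z. z \<in> ball 0 1 \<Longrightarrow> e \<le> cmod (g z)"
    using assms by (auto simp: Hinf_units_def)
  then have "d * e > 0" "\<And>z. z \<in> ball 0 1 \<Longrightarrow> d * e \<le> cmod (f z * g z)"
    by (auto simp: norm_mult intro!: mult_mono)
  then show ?thesis using H_infinity_mult[of f g] assms by (auto simp: Hinf_units_def)
qed

lemma Hinf_units_divide:
  "f \<in> Hinf_units \<Longrightarrow> g \<in> Hinf_units \<Longrightarrow> (\<lambda>z. f z / g z) \<in> Hinf_units"
  using Hinf_units_mult[OF _ Hinf_units_inverse, of f g] by simp

lemma H_infinity_divide:
  "f \<in> H_infinity \<Longrightarrow> g \<in> Hinf_units \<Longrightarrow> (\<lambda>z. f z / g z) \<in> H_infinity"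
  using H_infinity_mult[OF _ Hinf_units_mem[OF Hinf_units_inverse], of f g] by simp

lemma Hinf_units_cong:
  assumes "h \<in> Hinf_units" "\<And>z. z \<in> ball 0 1 \<Longrightarrow> g z = h z" shows "g \<in> Hinf_units"
  using H_infinity_cong[OF Hinf_units_mem[OF assms(1)] assms(2)] assms by (auto simp: Hinf_units_def)

lemma Hinf_units_const [simp]: "c \<noteq> 0 \<Longrightarrow> (\<lambda>_. c) \<in> Hinf_units"
  by (auto simp: Hinf_units_def intro!: exI[of _ "cmod c"])

lemma H_infinity_cont:
  assumes "continuous_on (cball 0 1) f" "f holomorphic_on ball 0 1"
  shows "f \<in> H_infinity"
proof -
  have "bounded (f ` cball 0 1)"
    by (intro compact_imp_bounded compact_continuous_image assms compact_cball)
  then have "bounded (f ` ball 0 1)" by (rule bounded_subset) auto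
  then show ?thesis using assms by (simp add: H_infinity_def)
qed

lemma Hinf_units_cont:
  assumes "continuous_on (cball 0 1) f" "f holomorphic_on ball 0 1" "\<And>z. z \<in> cball 0 1 \<Longrightarrow> f z \<noteq> 0"
  shows "f \<in> Hinf_units"
proof -
  have "\<exists>x\<in>cball 0 1. \<forall>y\<in>cball 0 1. cmod (f x) \<le> cmod (f y)"
    by (intro continuous_attains_inf compact_cball continuous_intros assms) auto
  then obtain x where "x \<in> cball 0 1" "\<And>y. y \<in> cball 0 1 \<Longrightarrow> cmod (f x) \<le> cmod (f y)" by blast
  then show ?thesis using assms(3)[of x] H_infinity_cont[OF assms(1,2)]
    by (auto simp: Hinf_units_def intro!: exI[of _ "cmod (f x)"])
qed

lemma H_infinity_compose:
  assumes "f \<in> H_infinity" "\<phi> holomorphic_on ball 0 1" "\<phi> ` ball 0 1 \<subseteq> ball 0 1"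
  shows "(\<lambda>z. f (\<phi> z)) \<in> H_infinity"
proof (rule H_infinityE[OF assms(1)])
  fix B assume B: "f holomorphic_on ball 0 1" "\<And>z. z \<in> ball 0 1 \<Longrightarrow> cmod (f z) \<le> B"
  have "f \<circ> \<phi> holomorphic_on ball 0 1"
    by (rule holomorphic_on_compose_gen[OF assms(2) B(1)]) (use assms(3) in auto)
  moreover have "cmod (f (\<phi> z)) \<le> B" if "z \<in> ball 0 1" for z
    by (rule B(2)) (use assms(3) that in blast)
  ultimately show ?thesis by (intro H_infinityI[of _ B]) (auto simp: o_def)
qed

lemma Hinf_units_compose:
  assumes "f \<in> Hinf_units" "\<phi> holomorphic_on ball 0 1" "\<phi> ` ball 0 1 \<subseteq> ball 0 1"
  shows "(\<lambda>z. f (\<phi> z)) \<in> Hinf_units"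
proof -
  obtain d where "d > 0" "\<And>z. z \<in> ball 0 1 \<Longrightarrow> d \<le> cmod (f z)"
    using assms(1) by (auto simp: Hinf_units_def)
  then show ?thesis using H_infinity_compose[OF Hinf_units_mem[OF assms(1)] assms(2,3)] assms(3)
    by (auto simp: Hinf_units_def intro!: exI[of _ d])
qed

section \<open>Lower triangular matrix functions\<close>

type_synonym matfun = "nat \<Rightarrow> nat \<Rightarrow> complex \<Rightarrow> complex"

definition mmul :: "nat \<Rightarrow> matfun \<Rightarrow> matfun \<Rightarrow> matfun" where
  "mmul n A B = (\<lambda>i j z. \<Sum>k=1..n. A i k z * B k j z)"

definition mone :: matfun where
  "mone = (\<lambda>i j z. if i = j then 1 else 0)"

primrec mpow :: "nat \<Rightarrow> matfun \<Rightarrow> nat \<Rightarrow> matfun" where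
  "mpow n A 0 = mone"
| "mpow n A (Suc k) = mmul n (mpow n A k) A"

definition meq :: "nat \<Rightarrow> matfun \<Rightarrow> matfun \<Rightarrow> bool" where
  "meq n A B \<longleftrightarrow> (\<forall>i\<in>{1..n}. \<forall>j\<in>{1..n}. \<forall>z\<in>ball 0 1. A i j z = B i j z)"

text \<open>The entries are bounded holomorphic functions, so that these matrix functions form an algebra
  that acts on the direct sum.\<close>

definition lower_tri :: "nat \<Rightarrow> matfun \<Rightarrow> bool" where
  "lower_tri n A \<longleftrightarrow> (\<forall>i\<in>{1..n}. \<forall>j\<in>{1..n}. A i j \<in> H_infinity \<and> (i < j \<longrightarrow> (\<forall>z\<in>ball 0 1. A i j z = 0)))"

lemma lower_triD:
  assumes "lower_tri n A" "i \<in> {1..n}" "j \<in> {1..n}"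
  shows "A i j \<in> H_infinity" "i < j \<Longrightarrow> z \<in> ball 0 1 \<Longrightarrow> A i j z = 0"
  using assms by (auto simp: lower_tri_def)

lemma mmul_lower:
  assumes "lower_tri n A" "lower_tri n B" "i \<in> {1..n}" "j \<in> {1..n}" "z \<in> ball 0 1"
  shows "mmul n A B i j z = (\<Sum>k=j..i. A i k z * B k j z)"
  unfolding mmul_def
proof (rule sum.mono_neutral_right)
  show "\<forall>k\<in>{1..n} - {j..i}. A i k z * B k j z = 0"
  proof
    fix k assume k: "k \<in> {1..n} - {j..i}"
    then have "i < k \<or> k < j" by auto
    then show "A i k z * B k j z = 0"
      using k lower_triD(2)[OF assms(1,3), of k z] lower_triD(2)[OF assms(2) _ assms(4), of k z] assms(5) by auto
  qed
qed (use assms in auto)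

lemma mmul_diag:
  assumes "lower_tri n A" "lower_tri n B" "i \<in> {1..n}" "z \<in> ball 0 1"
  shows "mmul n A B i i z = A i i z * B i i z"
  by (simp add: mmul_lower[OF assms(1,2,3,3,4)])

lemma mmul_subdiag:
  assumes "lower_tri n A" "lower_tri n B" "i \<in> {1..<n}" "z \<in> ball 0 1"
  shows "mmul n A B (Suc i) i z = A (Suc i) i z * B i i z + A (Suc i) (Suc i) z * B (Suc i) i z"
proof -
  have "{i..Suc i} = {i, Suc i}" by auto
  then show ?thesis using mmul_lower[OF assms(1,2), of "Suc i" i z] assms(3,4) by simp
qed

lemma lower_tri_mmul:
  assumes "lower_tri n A" "lower_tri n B" shows "lower_tri n (mmul n A B)"
  unfolding lower_tri_def
proof (intro ballI conjI impI)
  fix i j assume ij: "i \<in> {1..n}" "j \<in> {1..n}"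
  show "mmul n A B i j \<in> H_infinity" unfolding mmul_def
    by (intro H_infinity_sum H_infinity_mult lower_triD(1)[OF assms(1)] lower_triD(1)[OF assms(2)] ij) auto
  show "mmul n A B i j z = 0" if "i < j" "z \<in> ball 0 1" for z
    using mmul_lower[OF assms ij that(2)] that(1) by simp
qed

lemma lower_tri_mone: "lower_tri n mone"
  by (auto simp: lower_tri_def mone_def)

lemma lower_tri_mpow: "lower_tri n A \<Longrightarrow> lower_tri n (mpow n A k)"
  by (induction k) (auto intro: lower_tri_mone lower_tri_mmul)

lemma lower_tri_linear_comb:
  assumes "\<And>k. lower_tri n (A k)"
  shows "lower_tri n (\<lambda>i j z. \<Sum>k\<le>(m::nat). c k * A k i j z)"
  using lower_triD[OF assms]
  by (auto simp: lower_tri_def intro!: H_infinity_sum H_infinity_mult)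

lemma lower_tri_compose:
  assumes "lower_tri n A" "\<phi> holomorphic_on ball 0 1" "\<phi> ` ball 0 1 \<subseteq> ball 0 1"
  shows "lower_tri n (\<lambda>i j z. A i j (\<phi> z))"
  unfolding lower_tri_def
proof (intro ballI conjI impI)
  fix i j assume ij: "i \<in> {1..n}" "j \<in> {1..n}"
  show "(\<lambda>z. A i j (\<phi> z)) \<in> H_infinity"
    by (rule H_infinity_compose[OF lower_triD(1)[OF assms(1) ij] assms(2,3)])
  show "A i j (\<phi> z) = 0" if "i < j" "z \<in> ball 0 1" for z
    using lower_triD(2)[OF assms(1) ij that(1)] assms(3) that(2) by blast
qed

lemma mpow_diag:
  assumes "lower_tri n A" "i \<in> {1..n}" "z \<in> ball 0 1"
  shows "mpow n A k i i z = A i i z ^ k"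
proof (induction k)
  case (Suc k)
  then show ?case using mmul_diag[OF lower_tri_mpow[OF assms(1)] assms] by simp
qed (simp add: mone_def)

lemma mpow_subdiag:
  assumes "lower_tri n A" "i \<in> {1..<n}" "z \<in> ball 0 1" "A (Suc i) (Suc i) z = A i i z"
  shows "mpow n A k (Suc i) i z = of_nat k * A i i z ^ (k - 1) * A (Suc i) i z"
proof (induction k)
  case (Suc k)
  have "mpow n A (Suc k) (Suc i) i z = mpow n A k (Suc i) i z * A i i z + A i i z ^ k * A (Suc i) i z"
    using mmul_subdiag[OF lower_tri_mpow[OF assms(1)] assms(1,2,3)] mpow_diag[OF assms(1) _ assms(3), of "Suc i" k]
      assms(2,4) by simp
  then show ?case using Suc by (cases k) (simp_all add: algebra_simps)
qed (simp add: mone_def)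

text \<open>Forward substitution for the equation \<open>D E = 1\<close>.\<close>

fun tri_inv :: "(nat \<Rightarrow> nat \<Rightarrow> complex) \<Rightarrow> nat \<Rightarrow> nat \<Rightarrow> complex" where
  "tri_inv D i j = ((if i = j then 1 else 0) - (\<Sum>k\<in>{1..<i}. D i k * tri_inv D k j)) / D i i"

declare tri_inv.simps [simp del]

lemma tri_inv_lower: "i < j \<Longrightarrow> tri_inv D i j = 0"
proof (induction i rule: less_induct)
  case (less i)
  then show ?case by (subst tri_inv.simps) simp
qed

lemma lower_tri_right_inverse:
  assumes D: "lower_tri n D" and diag: "\<And>i. i \<in> {1..n} \<Longrightarrow> D i i \<in> Hinf_units"
  obtains E where "lower_tri n E" "meq n (mmul n D E) mone"
    "\<And>i. i \<in> {1..n} \<Longrightarrow> E i i \<in> Hinf_units"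
proof -
  define E where "E = (\<lambda>i j z. tri_inv (\<lambda>i j. D i j z) i j)"
  have E: "E i j z = ((if i = j then 1 else 0) - (\<Sum>k\<in>{1..<i}. D i k z * E k j z)) / D i i z" for i j z
    unfolding E_def by (subst tri_inv.simps) simp
  have "E i j \<in> H_infinity" if "i \<in> {1..n}" "j \<in> {1..n}" for i j
    using that(1)
  proof (induction i rule: less_induct)
    case (less i)
    have "(\<lambda>z. ((if i = j then 1 else 0) - (\<Sum>k\<in>{1..<i}. D i k z * E k j z)) / D i i z) \<in> H_infinity"
    proof (intro H_infinity_divide[OF _ diag] H_infinity_diff H_infinity_const H_infinity_sum H_infinity_mult)
      fix k assume "k \<in> {1..<i}"
      then show "D i k \<in> H_infinity" "E k j \<in> H_infinity" using less lower_triD(1)[OF D, of i k] by auto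
    qed (use less in auto)
    then show ?case by (subst E[abs_def]) 
  qed
  moreover have up: "E i j z = 0" if "i < j" for i j z using that by (simp add: E_def tri_inv_lower)
  ultimately have LE: "lower_tri n E" by (auto simp: lower_tri_def)
  moreover have "meq n (mmul n D E) mone" unfolding meq_def
  proof (intro ballI)
    fix i j z assume ij: "i \<in> {1..n}" "j \<in> {1..n}" and z: "z \<in> ball (0::complex) 1"
    have "mmul n D E i j z = (\<Sum>k\<in>{1..i}. D i k z * E k j z)" unfolding mmul_def
      by (rule sum.mono_neutral_right) (use ij lower_triD(2)[OF D ij(1) _ _ z] in auto)
    also have "{1..i} = insert i {1..<i}" using ij by auto
    also have "(\<Sum>k\<in>insert i {1..<i}. D i k z * E k j z) = D i i z * E i j z + (\<Sum>k\<in>{1..<i}. D i k z * E k j z)"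
      by simp
    also have "\<dots> = mone i j z"
      using Hinf_units_nz[OF diag[OF ij(1)] z] by (subst E) (simp add: mone_def)
    finally show "mmul n D E i j z = mone i j z" .
  qed
  moreover have "E i i \<in> Hinf_units" if i: "i \<in> {1..n}" for i
  proof (rule Hinf_units_cong[OF Hinf_units_inverse[OF diag[OF i]]])
    show "E i i z = 1 / D i i z" for z by (subst E) (simp add: up)
  qed
  ultimately show ?thesis using that by blast
qed

text \<open>A solution \<open>X\<close> of \<open>M X = X N\<close> with the first column of the identity matrix. As \<open>M\<close> and \<open>N\<close> have
  the same scalar diagonal, its contribution to the entry \<open>(i, j - 1)\<close> of the equation cancels, and
  that entry determines \<open>X i j\<close> from the rows above \<open>i\<close> and from the entries of row \<open>i\<close> to the
  right of \<open>j\<close>.\<close>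

function tri_sol :: "(nat \<Rightarrow> nat \<Rightarrow> complex) \<Rightarrow> (nat \<Rightarrow> nat \<Rightarrow> complex) \<Rightarrow> nat \<Rightarrow> nat \<Rightarrow> complex" where
  "tri_sol M N i j = (if i < j then 0 else if j \<le> 1 then (if i = 1 then 1 else 0)
     else ((\<Sum>k\<in>{1..<i}. M i k * tri_sol M N k (j - 1)) - (\<Sum>k\<in>{j<..i}. tri_sol M N i k * N k (j - 1))) / N j (j - 1))"
  by pat_completeness auto
termination
  by (relation "measures [\<lambda>(M, N, i, j). i, \<lambda>(M, N, i, j). i - j]") auto

declare tri_sol.simps [simp del]

text \<open>Lower triangular matrices with the same scalar diagonal and with invertible entries immediately below it
  have a common normal form, a Jordan block, over any commutative ring. Here the ring is
  \<open>H\<^sup>\<infinity>\<close>, and solving for \<open>X\<close> entry by entry divides only by units of this ring.\<close>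

lemma lower_tri_intertwiner:
  assumes M: "lower_tri n M" and N: "lower_tri n N"
    and diag: "\<And>i z. i \<in> {1..n} \<Longrightarrow> z \<in> ball 0 1 \<Longrightarrow> M i i z = d z \<and> N i i z = d z"
    and subdiag: "\<And>i. i \<in> {1..<n} \<Longrightarrow> M (Suc i) i \<in> Hinf_units \<and> N (Suc i) i \<in> Hinf_units"
  obtains X where "lower_tri n X" "\<And>i. i \<in> {1..n} \<Longrightarrow> X i i \<in> Hinf_units"
    "meq n (mmul n M X) (mmul n X N)"
proof -
  define X where "X = (\<lambda>i j z. tri_sol (\<lambda>i j. M i j z) (\<lambda>i j. N i j z) i j)"
  have X_up: "X i j z = 0" if "i < j" for i j z
    unfolding X_def by (subst tri_sol.simps) (simp add: that)
  have X_1: "X i 1 z = (if i = 1 then 1 else 0)" if "i \<ge> 1" for i z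
    unfolding X_def by (subst tri_sol.simps) (use that in auto)
  have X_rec: "X i (Suc j) z = ((\<Sum>k\<in>{1..<i}. M i k z * X k j z) - (\<Sum>k\<in>{Suc j<..i}. X i k z * N k j z)) / N (Suc j) j z"
    if "j \<ge> 1" "Suc j \<le> i" for i j z
    unfolding X_def by (subst tri_sol.simps) (use that in auto)
  have X_Hinf: "X i j \<in> H_infinity" if "i \<in> {1..n}" "j \<in> {1..n}" for i j
    using that
  proof (induction i arbitrary: j rule: less_induct)
    case outer: (less i)
    show ?case using outer.prems
    proof (induction "i - j" arbitrary: j rule: less_induct)
      case less
      consider "i < j" | "j = 1" | j' where "j = Suc j'" "j' \<ge> 1" "Suc j' \<le> i"
        using less.prems by (cases j) force+
      then show ?case
      proof cases
        case 1
        then have "X i j = (\<lambda>_. 0)" using X_up by auto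
        then show ?thesis by simp
      next
        case 2
        then have "X i j = (\<lambda>_. if i = 1 then 1 else 0)" using X_1 less.prems by auto
        then show ?thesis by simp
      next
        case 3
        have "(\<lambda>z. ((\<Sum>k\<in>{1..<i}. M i k z * X k j' z) - (\<Sum>k\<in>{Suc j'<..i}. X i k z * N k j' z)) / N (Suc j') j' z) \<in> H_infinity"
        proof (intro H_infinity_divide H_infinity_diff H_infinity_sum H_infinity_mult)
          show "N (Suc j') j' \<in> Hinf_units" using subdiag[of j'] 3 less.prems by simp
          show "M i k \<in> H_infinity" "X k j' \<in> H_infinity" if "k \<in> {1..<i}" for k
            using that lower_triD(1)[OF M, of i k] less.prems outer.IH[of k j'] 3 by auto
          show "X i k \<in> H_infinity" "N k j' \<in> H_infinity" if "k \<in> {Suc j'<..i}" for k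
            using that lower_triD(1)[OF N, of k j'] less.prems less.hyps[of k] 3 by auto
        qed
        moreover have "X i j = (\<lambda>z. ((\<Sum>k\<in>{1..<i}. M i k z * X k j' z) - (\<Sum>k\<in>{Suc j'<..i}. X i k z * N k j' z)) / N (Suc j') j' z)"
          using X_rec[OF 3(2,3)] 3(1) by auto
        ultimately show ?thesis by simp
      qed
    qed
  qed
  then have LX: "lower_tri n X" using X_up by (auto simp: lower_tri_def)
  moreover have "X i i \<in> Hinf_units" if "i \<in> {1..n}" for i
    using that
  proof (induction i)
    case (Suc i)
    show ?case
    proof (cases "i = 0")
      case True
      then have "X (Suc i) (Suc i) = (\<lambda>_. 1)" using X_1 by auto
      then show ?thesis by simp
    next
      case False
      have "X (Suc i) (Suc i) z = M (Suc i) i z * X i i z / N (Suc i) i z" for z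
      proof -
        have "(\<Sum>k\<in>{1..<Suc i}. M (Suc i) k z * X k i z) = (\<Sum>k\<in>{i}. M (Suc i) k z * X k i z)"
          using False X_up by (intro sum.mono_neutral_right) auto
        then show ?thesis using X_rec[of i "Suc i" z] False by simp
      qed
      moreover have "i \<in> {1..<n}" "i \<in> {1..n}" using Suc.prems False by auto
      ultimately show ?thesis using Suc.IH subdiag
        Hinf_units_cong[OF Hinf_units_divide[OF Hinf_units_mult[of "M (Suc i) i" "X i i"], of "N (Suc i) i"]]
        by metis
    qed
  qed simp
  moreover have "meq n (mmul n M X) (mmul n X N)" unfolding meq_def
  proof (intro ballI)
    fix i j z assume ij: "i \<in> {1..n}" "j \<in> {1..n}" and z: "z \<in> ball (0::complex) 1"
    show "mmul n M X i j z = mmul n X N i j z"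
    proof (cases "j < i")
      case False
      then show ?thesis using mmul_lower[OF M LX ij z] mmul_lower[OF LX N ij z] diag[OF ij(1) z]
        by (cases "j = i") auto
    next
      case True
      have "mmul n M X i j z = (\<Sum>k\<in>{1..i}. M i k z * X k j z)" unfolding mmul_def
        by (rule sum.mono_neutral_right) (use ij lower_triD(2)[OF M ij(1) _ _ z] in auto)
      also have "{1..i} = insert i {1..<i}" using ij by auto
      also have "(\<Sum>k\<in>insert i {1..<i}. M i k z * X k j z) = d z * X i j z + (\<Sum>k\<in>{1..<i}. M i k z * X k j z)"
        using diag[OF ij(1) z] by simp
      also have "(\<Sum>k\<in>{1..<i}. M i k z * X k j z)
          = X i (Suc j) z * N (Suc j) j z + (\<Sum>k\<in>{Suc j<..i}. X i k z * N k j z)"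
        using X_rec[of j i z] True ij Hinf_units_nz[OF conjunct2[OF subdiag[of j]] z] by (simp add: field_simps)
      finally have L: "mmul n M X i j z = d z * X i j z + (X i (Suc j) z * N (Suc j) j z + (\<Sum>k\<in>{Suc j<..i}. X i k z * N k j z))" .
      have "mmul n X N i j z = (\<Sum>k=j..i. X i k z * N k j z)" by (rule mmul_lower[OF LX N ij z])
      also have "{j..i} = insert j (insert (Suc j) {Suc j<..i})" using True by auto
      also have "(\<Sum>k\<in>insert j (insert (Suc j) {Suc j<..i}). X i k z * N k j z)
        = X i j z * N j j z + (X i (Suc j) z * N (Suc j) j z + (\<Sum>k\<in>{Suc j<..i}. X i k z * N k j z))"
        by simp
      finally show ?thesis using L diag[OF ij(2) z] by simp
    qed
  qed
  ultimately show ?thesis using that by blast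
qed

section \<open>Matrix functions as operators, and functions of operators\<close>

definition mat_op :: "nat \<Rightarrow> matfun \<Rightarrow> (nat \<Rightarrow> complex \<Rightarrow> complex) \<Rightarrow> nat \<Rightarrow> complex \<Rightarrow> complex" where
  "mat_op n A = op_matrix n (\<lambda>i j. mult_op (A i j))"

lemma mat_op_apply: "mat_op n A x i z = (if i \<in> {1..n} then \<Sum>j=1..n. A i j z * x j z else 0)"
proof -
  have "(\<Sum>j\<in>J. mult_op (A i j) (x j)) z = (\<Sum>j\<in>J. A i j z * x j z)" for J :: "nat set"
    by (induction J rule: infinite_finite_induct) (auto simp: mult_op_def)
  then show ?thesis by (simp add: mat_op_def op_matrix_def)
qed

lemma mat_op_mmul: "mat_op n (mmul n A B) x = mat_op n A (mat_op n B x)"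
proof (intro ext)
  fix i z
  have "(\<Sum>j=1..n. (\<Sum>k=1..n. A i k z * B k j z) * x j z) = (\<Sum>k=1..n. A i k z * (\<Sum>j=1..n. B k j z * x j z))"
    unfolding sum_distrib_left sum_distrib_right by (subst sum.swap) (simp add: mult.assoc)
  then show "mat_op n (mmul n A B) x i z = mat_op n A (mat_op n B x) i z"
    by (simp add: mat_op_apply mmul_def)
qed

lemma sum_apply2: "(\<Sum>k\<in>K. f k) i z = (\<Sum>k\<in>K. f k i (z::'c) :: 'b::comm_monoid_add)"
  by (induction K rule: infinite_finite_induct) auto

lemma mat_op_linear_comb:
  "mat_op n (\<lambda>i j z. \<Sum>k\<in>K. c k * A k i j z) x = (\<Sum>k\<in>K. c k *\<^sub>C mat_op n (A k) x)"
proof (intro ext)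
  fix i z
  have "(\<Sum>j=1..n. (\<Sum>k\<in>K. c k * A k i j z) * x j z) = (\<Sum>k\<in>K. c k * (\<Sum>j=1..n. A k i j z * x j z))"
    unfolding sum_distrib_left sum_distrib_right by (subst sum.swap) (simp add: mult.assoc)
  then show "mat_op n (\<lambda>i j z. \<Sum>k\<in>K. c k * A k i j z) x i z = (\<Sum>k\<in>K. c k *\<^sub>C mat_op n (A k) x) i z"
    by (cases "i \<in> {1..n}") (simp_all add: mat_op_apply sum_apply2 del: atLeastAtMost_iff)
qed

lemma mat_op_mone:
  assumes "\<And>i. i \<notin> {1..n} \<Longrightarrow> x i = 0" shows "mat_op n mone x = x"
proof (intro ext)
  fix i z
  have "(\<Sum>j=1..n. mone i j z * x j z) = (\<Sum>j\<in>{1..n}. if i = j then x j z else 0)"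
    by (rule sum.cong) (auto simp: mone_def)
  then show "mat_op n mone x i z = x i z" using assms by (auto simp: mat_op_apply)
qed

lemma mat_op_meq:
  assumes "meq n A B" "\<And>i z. z \<notin> ball 0 1 \<Longrightarrow> x i z = 0"
  shows "mat_op n A x = mat_op n B x"
proof (intro ext)
  fix i z
  show "mat_op n A x i z = mat_op n B x i z"
    using assms by (cases "z \<in> ball 0 1") (auto simp: mat_op_apply meq_def intro!: sum.cong)
qed

lemma bounded_op_cong:
  assumes "bounded_op H1 H2 A" "\<And>x. x \<in> hcarrier H1 \<Longrightarrow> A' x = A x" "complete_ips H1"
  shows "bounded_op H1 H2 A'"
proof -
  interpret complete_ips H1 by fact
  show ?thesis using assms(1,2) by (simp add: bounded_op_def add_mem scale_mem)
qed

lemma op_matrix_carrier: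
  assumes H: "\<And>i. i \<in> {1..n} \<Longrightarrow> complete_ips (H i)"
    and A: "\<And>i j x. i \<in> {1..n} \<Longrightarrow> j \<in> {1..n} \<Longrightarrow> x \<in> hcarrier (H j) \<Longrightarrow> A i j x \<in> hcarrier (H i)"
    and x: "x \<in> hcarrier (direct_sum n H)"
  shows "op_matrix n A x \<in> hcarrier (direct_sum n H)"
  using x by (auto simp: direct_sum_carrier op_matrix_def intro!: complete_ips.sum_mem[OF H] A)

lemma adjoint_pair_op_matrix:
  assumes H: "\<And>i. i \<in> {1..n} \<Longrightarrow> complete_ips (H i)"
    and adj: "\<And>i j. i \<in> {1..n} \<Longrightarrow> j \<in> {1..n} \<Longrightarrow> adjoint_pair (H j) (H i) (A i j) (B j i)"
  shows "adjoint_pair (direct_sum n H) (direct_sum n H) (op_matrix n A) (op_matrix n B)"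
  unfolding adjoint_pair_def
proof (intro conjI ballI)
  note D = adjoint_pairD[OF adj]
  show "op_matrix n A x \<in> hcarrier (direct_sum n H)" if "x \<in> hcarrier (direct_sum n H)" for x
    by (rule op_matrix_carrier[OF H _ that]) (use D in auto)
  show "op_matrix n B x \<in> hcarrier (direct_sum n H)" if "x \<in> hcarrier (direct_sum n H)" for x
    by (rule op_matrix_carrier[OF H _ that]) (use D in auto)
  fix x y assume x: "x \<in> hcarrier (direct_sum n H)" and y: "y \<in> hcarrier (direct_sum n H)"
  then have xm: "\<And>i. i \<in> {1..n} \<Longrightarrow> x i \<in> hcarrier (H i)" and ym: "\<And>i. i \<in> {1..n} \<Longrightarrow> y i \<in> hcarrier (H i)"
    by (auto simp: direct_sum_carrier)
  have "hinner (direct_sum n H) (op_matrix n A x) y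
      = (\<Sum>i=1..n. \<Sum>j=1..n. hinner (H i) (A i j (x j)) (y i))"
    unfolding direct_sum_ip op_matrix_def
    by (rule sum.cong) (use xm ym D(1,2) in \<open>auto intro!: complete_ips.ip_sum[OF H]\<close>)
  also have "\<dots> = (\<Sum>i=1..n. \<Sum>j=1..n. hinner (H j) (x j) (B j i (y i)))"
    by (intro sum.cong refl D(3) xm ym)
  also have "\<dots> = (\<Sum>j=1..n. \<Sum>i=1..n. hinner (H j) (x j) (B j i (y i)))"
    by (rule sum.swap)
  also have "\<dots> = hinner (direct_sum n H) x (op_matrix n B y)"
    unfolding direct_sum_ip op_matrix_def
    by (rule sum.cong) (use xm ym D(1,2) in \<open>auto intro!: complete_ips.ip_sum_r[OF H, symmetric]\<close>)
  finally show "hinner (direct_sum n H) (op_matrix n A x) y = hinner (direct_sum n H) x (op_matrix n B y)" .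
qed

lemma bounded_op_matrix:
  assumes H: "\<And>i. i \<in> {1..n} \<Longrightarrow> complete_ips (H i)"
    and A: "\<And>i j. i \<in> {1..n} \<Longrightarrow> j \<in> {1..n} \<Longrightarrow> bounded_op (H j) (H i) (A i j)"
  shows "bounded_op (direct_sum n H) (direct_sum n H) (op_matrix n A)"
proof -
  have "adjoint_pair (direct_sum n H) (direct_sum n H) (op_matrix n A)
      (op_matrix n (\<lambda>j i. adjoint_op (H j) (H i) (A i j)))"
    by (intro adjoint_pair_op_matrix H adjoint_pair_adjoint_op A) auto
  then show ?thesis by (intro adjoint_pair_bounded complete_ips_direct_sum H)
qed

definition comp_op :: "(complex \<Rightarrow> complex) \<Rightarrow> (nat \<Rightarrow> complex \<Rightarrow> complex) \<Rightarrow> nat \<Rightarrow> complex \<Rightarrow> complex" where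
  "comp_op \<phi> x = (\<lambda>i. on_disc (x i \<circ> \<phi>))"

lemma Moeb_mem: "\<phi> \<in> Moeb \<Longrightarrow> z \<in> ball 0 1 \<Longrightarrow> \<phi> z \<in> ball 0 1"
  unfolding Moeb_def by blast

text \<open>The adjoint of \<open>f(A)\<close> is \<open>(disc_conj f)(A\<^sup>*)\<close>.\<close>

definition disc_conj :: "(complex \<Rightarrow> complex) \<Rightarrow> complex \<Rightarrow> complex" where
  "disc_conj f z = cnj (f (cnj z))"

text \<open>The coefficients are conjugated so that multiplication by this matrix function is adjoint to
  \<open>p(T)\<close> if multiplication by \<open>A\<close> is adjoint to \<open>T\<close>.\<close>

definition mat_cnj_poly :: "nat \<Rightarrow> complex poly \<Rightarrow> matfun \<Rightarrow> matfun" where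
  "mat_cnj_poly n p A = (\<lambda>i j z. \<Sum>k\<le>degree p. cnj (coeff p k) * mpow n A k i j z)"

lemma lower_tri_mat_cnj_poly: "lower_tri n A \<Longrightarrow> lower_tri n (mat_cnj_poly n p A)"
  unfolding mat_cnj_poly_def by (intro lower_tri_linear_comb lower_tri_mpow)

lemma poly_pderiv_sum: "poly (pderiv p) x = (\<Sum>k\<le>degree p. coeff p k * (of_nat k * x ^ (k - 1)))"
  for x :: complex
proof (rule DERIV_unique[OF poly_DERIV])
  have "((\<lambda>x. \<Sum>k\<le>degree p. coeff p k * x ^ k) has_field_derivative
      (\<Sum>k\<le>degree p. coeff p k * (of_nat k * x ^ (k - 1)))) (at x)"
    by (rule DERIV_sum) (auto intro!: derivative_eq_intros)
  then show "(poly p has_field_derivative (\<Sum>k\<le>degree p. coeff p k * (of_nat k * x ^ (k - 1)))) (at x)"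
    by (simp add: poly_altdef[abs_def])
qed

lemma mat_cnj_poly_diag:
  assumes "lower_tri n A" "i \<in> {1..n}" "z \<in> ball 0 1" "A i i z = z"
  shows "mat_cnj_poly n p A i i z = disc_conj (poly p) z"
  by (simp add: mat_cnj_poly_def mpow_diag[OF assms(1-3)] assms(4) disc_conj_def poly_altdef)

lemma mat_cnj_poly_subdiag:
  assumes "lower_tri n A" "i \<in> {1..<n}" "z \<in> ball 0 1" "A i i z = z" "A (Suc i) (Suc i) z = z"
  shows "mat_cnj_poly n p A (Suc i) i z = disc_conj (poly (pderiv p)) z * A (Suc i) i z"
  using assms(4,5)
  by (simp add: mat_cnj_poly_def mpow_subdiag[OF assms(1-3)] disc_conj_def poly_pderiv_sum sum_distrib_right mult.assoc)

lemma disc_conj_DERIV: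
  assumes "(f has_field_derivative f' (cnj z)) (at (cnj z))"
  shows "(disc_conj f has_field_derivative disc_conj f' z) (at z)"
proof -
  have "disc_conj f = cnj \<circ> f \<circ> cnj" by (auto simp: disc_conj_def)
  then show ?thesis using has_field_derivative_cnj_cnj[OF assms]
    by (simp add: disc_conj_def)
qed

lemma disc_conj_poly_unit:
  assumes q: "\<And>z. z \<in> cball 0 1 \<Longrightarrow> poly q z \<noteq> 0"
  shows "disc_conj (poly q) \<in> Hinf_units"
proof (rule Hinf_units_cont)
  show "continuous_on (cball 0 1) (disc_conj (poly q))"
    unfolding disc_conj_def[abs_def] by (intro continuous_intros)
  have "(disc_conj (poly q) has_field_derivative disc_conj (poly (pderiv q)) z) (at z)" for z
    by (rule disc_conj_DERIV) (rule poly_DERIV)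
  then show "disc_conj (poly q) holomorphic_on ball 0 1"
    using holomorphic_on_open[OF open_ball, of "disc_conj (poly q)" 0 1] by blast
  show "disc_conj (poly q) z \<noteq> 0" if "z \<in> cball 0 1" for z
    using q[of "cnj z"] that by (simp add: disc_conj_def)
qed

lemma adjoint_pair_funpow:
  assumes "adjoint_pair D D A A'" shows "adjoint_pair D D (A ^^ k) (A' ^^ k)"
proof (induction k)
  case (Suc k)
  have "adjoint_pair D D (\<lambda>x. A ((A ^^ k) x)) (\<lambda>y. (A' ^^ k) (A' y))"
    by (rule adjoint_pair_comp[OF Suc assms])
  then show ?case by (simp add: o_def funpow_swap1)
qed (simp add: adjoint_pair_def)

locale rkhs_tower =
  fixes n :: nat and H :: "nat \<Rightarrow> (complex \<Rightarrow> complex) hspace" and a :: "nat \<Rightarrow> nat \<Rightarrow> real"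
  assumes diag: "\<And>i. i \<in> {1..n} \<Longrightarrow> diag_rkhs (H i) (a i)"
    and incl: "\<And>i. i \<in> {1..<n} \<Longrightarrow> hcarrier (H i) \<subseteq> hcarrier (H (Suc i))"
    and Mult_eq: "\<And>i. i \<in> {1..n} \<Longrightarrow> Mult (H i) = H_infinity"
    and invariant: "\<And>i. i \<in> {1..n} \<Longrightarrow> moebius_invariant (H i)"
begin

abbreviation "DS \<equiv> direct_sum n H"

lemma Hi: "i \<in> {1..n} \<Longrightarrow> complete_ips (H i)"
proof -
  assume "i \<in> {1..n}"
  then interpret diag_rkhs "H i" "a i" by (rule diag)
  show ?thesis by (rule complete_ips_axioms)
qed

sublocale DS: complete_ips DS
  by (rule complete_ips_direct_sum) (rule Hi)

lemma carrier_mono: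
  assumes "i \<le> j" "1 \<le> i" "j \<le> n" shows "hcarrier (H i) \<subseteq> hcarrier (H j)"
  using assms
proof (induction j rule: dec_induct)
  case (step m)
  then show ?case using incl[of m] by force
qed simp

lemma mult_mem:
  assumes "h \<in> H_infinity" "j \<le> i" "1 \<le> j" "i \<le> n" "f \<in> hcarrier (H j)"
  shows "mult_op h f \<in> hcarrier (H i)"
proof -
  have "h \<in> Mult (H j)" using Mult_eq[of j] assms by simp
  then show ?thesis using assms(5) carrier_mono[OF assms(2-4)] by (auto simp: Mult_def)
qed

lemma mult_bounded:
  assumes "h \<in> H_infinity" "j \<le> i" "1 \<le> j" "i \<le> n"
  shows "bounded_op (H j) (H i) (mult_op h)"
  by (rule mult_op_bounded[OF diag diag]) (use assms mult_mem in auto)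

lemma DS_zero: "x \<in> DS.C \<Longrightarrow> i \<notin> {1..n} \<Longrightarrow> x i = 0"
  by (simp add: direct_sum_carrier)

lemma DS_out: "x \<in> DS.C \<Longrightarrow> z \<notin> ball 0 1 \<Longrightarrow> x i z = 0"
  using DS_zero[of x i] diag_rkhs.mem_out[OF diag, of i "x i" z]
  by (cases "i \<in> {1..n}") (auto simp: direct_sum_carrier)

lemma mat_op_bounded:
  assumes "lower_tri n A" shows "bounded_op DS DS (mat_op n A)"
  unfolding mat_op_def
proof (rule bounded_op_matrix[OF Hi])
  fix i j assume ij: "i \<in> {1..n}" "j \<in> {1..n}"
  show "bounded_op (H j) (H i) (mult_op (A i j))"
  proof (cases "j \<le> i")
    case True
    then show ?thesis using ij by (intro mult_bounded lower_triD(1)[OF assms]) auto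
  next
    case False
    have "mult_op (A i j) f = 0" if "f \<in> hcarrier (H j)" for f
    proof
      fix z show "mult_op (A i j) f z = 0 z"
        using lower_triD(2)[OF assms ij, of z] False diag_rkhs.mem_out[OF diag[OF ij(2)] that, of z]
        by (cases "z \<in> ball 0 1") (auto simp: mult_op_def)
    qed
    then show ?thesis using complete_ips.zero_mem[OF Hi[OF ij(1)]]
      by (intro mult_op_bounded[OF diag diag] ij) simp
  qed
qed auto

lemma mat_op_mem: "lower_tri n A \<Longrightarrow> x \<in> DS.C \<Longrightarrow> mat_op n A x \<in> DS.C"
  by (rule bounded_opD(1)[OF mat_op_bounded])

lemma mat_op_cong: "meq n A B \<Longrightarrow> x \<in> DS.C \<Longrightarrow> mat_op n A x = mat_op n B x"
  by (rule mat_op_meq) (use DS_out in auto)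

lemma mat_op_one: "x \<in> DS.C \<Longrightarrow> mat_op n mone x = x"
  by (rule mat_op_mone) (rule DS_zero)

text \<open>The right inverse found by forward substitution has a right inverse itself, so it is a
  two-sided inverse.\<close>

lemma mat_op_inverse:
  assumes D: "lower_tri n D" and dg: "\<And>i. i \<in> {1..n} \<Longrightarrow> D i i \<in> Hinf_units"
  obtains E where "lower_tri n E" "meq n (mmul n D E) mone" "inverse_ops DS (mat_op n D) (mat_op n E)"
proof -
  obtain E where E: "lower_tri n E" "meq n (mmul n D E) mone" "\<And>i. i \<in> {1..n} \<Longrightarrow> E i i \<in> Hinf_units"
    using lower_tri_right_inverse[OF D dg] by blast
  obtain F where F: "lower_tri n F" "meq n (mmul n E F) mone"
    using lower_tri_right_inverse[OF E(1,3)] by blast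
  have DE: "mat_op n D (mat_op n E x) = x" if "x \<in> DS.C" for x
    using mat_op_cong[OF E(2) that] mat_op_one[OF that] by (simp add: mat_op_mmul)
  have EF: "mat_op n E (mat_op n F x) = x" if "x \<in> DS.C" for x
    using mat_op_cong[OF F(2) that] mat_op_one[OF that] by (simp add: mat_op_mmul)
  have "mat_op n E (mat_op n D x) = x" if x: "x \<in> DS.C" for x
  proof -
    have "mat_op n D x = mat_op n F x"
      using DE[OF mat_op_mem[OF F(1) x]] EF[OF x] by simp
    then show ?thesis using EF[OF x] by simp
  qed
  then have "inverse_ops DS (mat_op n D) (mat_op n E)"
    using DE mat_op_bounded[OF D] mat_op_bounded[OF E(1)] by (simp add: inverse_ops_def)
  then show ?thesis using that E by blast
qed

lemma comp_op_bounded: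
  assumes \<phi>: "\<phi> \<in> Moeb" shows "bounded_op DS DS (comp_op \<phi>)"
proof (rule bounded_op_cong[OF bounded_op_matrix[OF Hi] _ DS.complete_ips_axioms])
  let ?A = "\<lambda>i j. if i = j then (\<lambda>f. on_disc (f \<circ> \<phi>)) else (\<lambda>f. 0)"
  fix i j assume ij: "i \<in> {1..n}" "j \<in> {1..n}"
  have "bounded_op (H i) (H i) (\<lambda>f. on_disc (f \<circ> \<phi>))"
    by (rule composition_bounded[OF diag[OF ij(1)]])
      (use \<phi> invariant[OF ij(1)] in \<open>auto simp: Moeb_def moebius_invariant_def\<close>)
  moreover have "bounded_op (H j) (H i) (\<lambda>f. 0)"
    using complete_ips.zero_mem[OF Hi[OF ij(1)]] complete_ips.nm_zero[OF Hi[OF ij(1)]]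
    by (auto simp: bounded_op_def intro!: exI[of _ 0])
  ultimately show "bounded_op (H j) (H i) (?A i j)" by (cases "i = j") auto
next
  fix x assume x: "x \<in> DS.C"
  show "comp_op \<phi> x = op_matrix n (\<lambda>i j. if i = j then (\<lambda>f. on_disc (f \<circ> \<phi>)) else (\<lambda>f. 0)) x"
  proof
    fix i
    have "(\<Sum>j=1..n. (if i = j then (\<lambda>f. on_disc (f \<circ> \<phi>)) else (\<lambda>f. 0)) (x j))
       = (\<Sum>j=1..n. if i = j then on_disc (x j \<circ> \<phi>) else 0)" by (rule sum.cong) auto
    moreover have "on_disc (0 \<circ> \<phi>) = 0" by (auto simp: on_disc_def)
    ultimately show "comp_op \<phi> x i = op_matrix n (\<lambda>i j. if i = j then (\<lambda>f. on_disc (f \<circ> \<phi>)) else (\<lambda>f. 0)) x i"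
      using DS_zero[OF x, of i] by (auto simp: comp_op_def op_matrix_def)
  qed
qed auto

lemma comp_op_inverse:
  assumes "\<phi> \<in> Moeb" "\<eta> \<in> Moeb" "\<And>z. z \<in> ball 0 1 \<Longrightarrow> \<eta> (\<phi> z) = z \<and> \<phi> (\<eta> z) = z"
  shows "inverse_ops DS (comp_op \<phi>) (comp_op \<eta>)"
proof -
  have in_ball: "\<phi> z \<in> ball 0 1" "\<eta> z \<in> ball 0 1" if "z \<in> ball 0 1" for z
    using Moeb_mem assms(1,2) that by blast+
  have "comp_op \<eta> (comp_op \<phi> x) = x \<and> comp_op \<phi> (comp_op \<eta> x) = x" if x: "x \<in> DS.C" for x
  proof (intro conjI ext)
    fix i z
    show "comp_op \<eta> (comp_op \<phi> x) i z = x i z" "comp_op \<phi> (comp_op \<eta> x) i z = x i z"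
      using in_ball assms(3) DS_out[OF x, of z i]
      by (cases "z \<in> ball 0 1"; simp add: comp_op_def del: mem_ball)+
  qed
  then show ?thesis using comp_op_bounded assms(1,2) by (simp add: inverse_ops_def)
qed

lemma comp_op_mat_op:
  assumes "\<phi> \<in> Moeb"
  shows "comp_op \<phi> (mat_op n A x) = mat_op n (\<lambda>i j z. A i j (\<phi> z)) (comp_op \<phi> x)"
proof (intro ext)
  fix i z
  show "comp_op \<phi> (mat_op n A x) i z = mat_op n (\<lambda>i j z. A i j (\<phi> z)) (comp_op \<phi> x) i z"
    by (cases "z \<in> ball 0 1") (simp_all add: comp_op_def mat_op_apply del: mem_ball)
qed

lemma inverse_ops_comp:
  assumes "inverse_ops DS X Y" "inverse_ops DS X' Y'"
  shows "inverse_ops DS (\<lambda>x. X' (X x)) (\<lambda>x. Y (Y' x))"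
proof -
  have m: "X x \<in> DS.C" "Y' x \<in> DS.C" if "x \<in> DS.C" for x
    using assms that bounded_opD(1) unfolding inverse_ops_def by blast+
  show ?thesis
    using assms m bounded_op_comp[OF DS.complete_ips_axioms DS.complete_ips_axioms DS.complete_ips_axioms]
    unfolding inverse_ops_def by auto
qed

context
  fixes T :: "(nat \<Rightarrow> complex \<Rightarrow> complex) \<Rightarrow> nat \<Rightarrow> complex \<Rightarrow> complex" and G :: matfun
  assumes G: "lower_tri n G" and G_diag: "\<And>i z. i \<in> {1..n} \<Longrightarrow> G i i z = z"
    and TG: "adjoint_pair DS DS T (mat_op n G)"
begin

lemma poly_op_adjoint: "adjoint_pair DS DS (poly_op p T) (mat_op n (mat_cnj_poly n p G))"
proof -
  have pw: "(mat_op n G ^^ k) x = mat_op n (mpow n G k) x" if "x \<in> DS.C" for k x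
    using that
  proof (induction k arbitrary: x)
    case (Suc k)
    have "(mat_op n G ^^ Suc k) x = (mat_op n G ^^ k) (mat_op n G x)" by (simp add: funpow_swap1)
    also have "\<dots> = mat_op n (mpow n G (Suc k)) x"
      using Suc mat_op_mem[OF G] by (simp add: mat_op_mmul)
    finally show ?case .
  qed (simp add: mat_op_one)
  have "adjoint_pair DS DS (\<lambda>x. \<Sum>k\<le>degree p. coeff p k *\<^sub>C (T ^^ k) x)
      (\<lambda>x. \<Sum>k\<le>degree p. cnj (coeff p k) *\<^sub>C (mat_op n G ^^ k) x)"
    by (intro adjoint_pair_sum adjoint_pair_scale adjoint_pair_funpow TG DS.complete_ips_axioms) auto
  then show ?thesis
    by (rule adjoint_pair_cong) (simp_all add: poly_op_def mat_cnj_poly_def mat_op_linear_comb pw)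
qed

lemma poly_op_inverse:
  assumes q: "\<And>z. z \<in> cball 0 1 \<Longrightarrow> poly q z \<noteq> 0"
  obtains E R where "lower_tri n E" "meq n (mmul n (mat_cnj_poly n q G) E) mone"
    "adjoint_pair DS DS R (mat_op n E)" "inverse_ops DS (poly_op q T) R"
proof -
  obtain E where E: "lower_tri n E" "meq n (mmul n (mat_cnj_poly n q G) E) mone"
      "inverse_ops DS (mat_op n (mat_cnj_poly n q G)) (mat_op n E)"
  proof (rule mat_op_inverse[OF lower_tri_mat_cnj_poly[OF G]])
    show "mat_cnj_poly n q G i i \<in> Hinf_units" if "i \<in> {1..n}" for i
      by (rule Hinf_units_cong[OF disc_conj_poly_unit[OF q]]) (use mat_cnj_poly_diag[OF G that] G_diag[OF that] in auto)
  qed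
  obtain R where R: "adjoint_pair DS DS (mat_op n E) R"
    using bounded_op_adjoint[OF DS.complete_ips_axioms DS.complete_ips_axioms mat_op_bounded[OF E(1)]] .
  note sym = adjoint_pair_sym[OF DS.complete_ips_axioms DS.complete_ips_axioms]
  have "inverse_ops DS (poly_op q T) R"
    by (rule inverse_ops_adjoint[OF DS.complete_ips_axioms E(3) sym[OF poly_op_adjoint] R])
  then show ?thesis using that E(1,2) sym[OF R] by blast
qed

text \<open>The adjoint of \<open>\<phi>(T)\<close> is multiplication by \<open>\<theta>(G)\<close> with \<open>\<theta> = disc_conj \<phi>\<close>. As for a function of a
  Jordan block, its diagonal is \<open>\<theta>\<close>, and the entries immediately below it are \<open>\<theta>'\<close> times those of
  \<open>G\<close>.\<close>

lemma function_of_op_adjoint: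
  assumes "is_fun_of_op DS T \<phi> S"
  obtains B where "lower_tri n B" "adjoint_pair DS DS S (mat_op n B)"
    "\<And>i z. i \<in> {1..n} \<Longrightarrow> z \<in> ball 0 1 \<Longrightarrow> B i i z = disc_conj \<phi> z"
    "\<And>i z. i \<in> {1..<n} \<Longrightarrow> z \<in> ball 0 1 \<Longrightarrow> B (Suc i) i z = deriv (disc_conj \<phi>) z * G (Suc i) i z"
proof -
  obtain p q where q: "\<And>z. z \<in> cball 0 1 \<Longrightarrow> poly q z \<noteq> 0"
    and pq: "\<And>z. z \<in> ball 0 1 \<Longrightarrow> \<phi> z = poly p z / poly q z"
    and S: "\<And>x. x \<in> DS.C \<Longrightarrow> S x = poly_op p T (inv_into DS.C (poly_op q T) x)"
    using assms unfolding is_fun_of_op_def by blast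
  have \<phi>: "disc_conj \<phi> z = disc_conj (poly p) z / disc_conj (poly q) z" if "z \<in> ball 0 1" for z
    using pq[of "cnj z"] that by (simp add: disc_conj_def)
  obtain E R where E: "lower_tri n E" "meq n (mmul n (mat_cnj_poly n q G) E) mone"
    and R: "adjoint_pair DS DS R (mat_op n E)" "inverse_ops DS (poly_op q T) R"
    using poly_op_inverse[OF q] by blast
  note LQ = lower_tri_mat_cnj_poly[OF G, of q] and LP = lower_tri_mat_cnj_poly[OF G, of p]
  \<comment> \<open>\<open>E\<close> is \<open>q(G)\<^sup>-\<^sup>1\<close> and \<open>B\<close> is \<open>q(G)\<^sup>-\<^sup>1 p(G)\<close>, up to the conjugation of coefficients\<close>
  define B where "B = mmul n E (mat_cnj_poly n p G)"
  have LB: "lower_tri n B" unfolding B_def by (rule lower_tri_mmul[OF E(1) LP])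
  have inv: "inv_into DS.C (poly_op q T) x = R x" if x: "x \<in> DS.C" for x
  proof (rule inv_into_f_eq)
    show "inj_on (poly_op q T) DS.C" using R(2) by (intro inj_on_inverseI[of _ R]) (simp add: inverse_ops_def)
    show "R x \<in> DS.C" by (rule adjoint_pairD(1)[OF R(1) x])
    show "poly_op q T (R x) = x" using R(2) x by (simp add: inverse_ops_def)
  qed
  have "adjoint_pair DS DS S (mat_op n B)"
    by (rule adjoint_pair_cong[OF adjoint_pair_comp[OF R(1) poly_op_adjoint[of p]]])
      (simp_all add: S inv B_def mat_op_mmul)
  moreover have Ed: "E i i z = 1 / disc_conj (poly q) z" and qnz: "disc_conj (poly q) z \<noteq> 0"
    if "i \<in> {1..n}" "z \<in> ball 0 1" for i z
  proof -
    show nz: "disc_conj (poly q) z \<noteq> 0" using q[of "cnj z"] that by (simp add: disc_conj_def)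
    have "mmul n (mat_cnj_poly n q G) E i i z = 1" using E(2) that by (simp add: meq_def mone_def)
    then show "E i i z = 1 / disc_conj (poly q) z"
      using mmul_diag[OF LQ E(1) that] mat_cnj_poly_diag[OF G that G_diag[OF that(1)]] nz by (simp add: field_simps)
  qed
  moreover have "B i i z = disc_conj \<phi> z" if "i \<in> {1..n}" "z \<in> ball 0 1" for i z
    using mmul_diag[OF E(1) LP that] mat_cnj_poly_diag[OF G that G_diag[OF that(1)]] Ed[OF that] \<phi>[OF that(2)] by (simp add: B_def)
  moreover have "B (Suc i) i z = deriv (disc_conj \<phi>) z * G (Suc i) i z" if i: "i \<in> {1..<n}" and z: "z \<in> ball 0 1" for i z
  proof -
    have i': "i \<in> {1..n}" "Suc i \<in> {1..n}" using i by auto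
    define P P' Q Q' g where defs: "P = disc_conj (poly p) z" "P' = disc_conj (poly (pderiv p)) z"
      "Q = disc_conj (poly q) z" "Q' = disc_conj (poly (pderiv q)) z" "g = G (Suc i) i z"
    have Q0: "Q \<noteq> 0" using qnz[OF i'(1) z] by (simp add: defs)
    have "mmul n (mat_cnj_poly n q G) E (Suc i) i z = 0" using E(2) i' z by (simp add: meq_def mone_def)
    then have "Q' * g * (1 / Q) + Q * E (Suc i) i z = 0"
      using mmul_subdiag[OF LQ E(1) i z] mat_cnj_poly_subdiag[OF G i z G_diag[OF i'(1)] G_diag[OF i'(2)]]
        mat_cnj_poly_diag[OF G i'(2) z G_diag[OF i'(2)]] Ed[OF i'(1) z] by (simp add: defs)
    then have e: "E (Suc i) i z = - Q' * g / Q\<^sup>2" using Q0 by (simp add: field_simps power2_eq_square eq_neg_iff_add_eq_0)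
    have "B (Suc i) i z = E (Suc i) i z * P + (1 / Q) * (P' * g)"
      using mmul_subdiag[OF E(1) LP i z] mat_cnj_poly_subdiag[OF G i z G_diag[OF i'(1)] G_diag[OF i'(2)]]
        mat_cnj_poly_diag[OF G i'(1) z G_diag[OF i'(1)]] Ed[OF i'(2) z] by (simp add: defs B_def)
    also have "\<dots> = (P' * Q - P * Q') / (Q * Q) * g" unfolding e using Q0 by (simp add: field_simps power2_eq_square)
    finally have B_sub: "B (Suc i) i z = (P' * Q - P * Q') / (Q * Q) * g" .
    have "((\<lambda>z. disc_conj (poly p) z / disc_conj (poly q) z) has_field_derivative (P' * Q - P * Q') / (Q * Q)) (at z)"
      using Q0 unfolding defs by (intro DERIV_divide disc_conj_DERIV poly_DERIV)
    then have "(disc_conj \<phi> has_field_derivative (P' * Q - P * Q') / (Q * Q)) (at z)"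
      by (rule has_field_derivative_transform_within_open[OF _ open_ball z]) (simp add: \<phi> del: mem_ball)
    then have "(P' * Q - P * Q') / (Q * Q) = deriv (disc_conj \<phi>) z" by (simp add: DERIV_imp_deriv)
    then show ?thesis using B_sub defs(5) by simp
  qed
  ultimately show ?thesis using that LB by blast
qed

end

end

section \<open>Rigidity of intertwining operators\<close>

lemma holomorphic_mult_eq_0:
  assumes h: "h holomorphic_on ball 0 1" and g: "g holomorphic_on ball 0 1"
    and hg: "\<And>z. z \<in> ball 0 1 \<Longrightarrow> h z * g z = 0" and z0: "z0 \<in> ball 0 1" "g z0 \<noteq> 0"
    and z: "z \<in> ball (0::complex) 1"
  shows "h z = 0"
proof (rule analytic_continuation_open[of "{z \<in> ball 0 1. g z \<noteq> 0}" "ball 0 1" h "\<lambda>_. 0"])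
  have "open (ball 0 1 \<inter> g -` (- {0}))"
    by (intro continuous_open_preimage holomorphic_on_imp_continuous_on g) auto
  also have "ball 0 1 \<inter> g -` (- {0}) = {z \<in> ball 0 1. g z \<noteq> 0}" by auto
  finally show "open {z \<in> ball 0 1. g z \<noteq> 0}" .
qed (use assms in auto)

locale rkhs_tower_rigid = rkhs_tower +
  assumes shift_adj_surj: "\<And>i. i \<in> {1..n} \<Longrightarrow>
       adjoint_op (H i) (H i) (mult_op (\<lambda>z. z)) ` hcarrier (H i) = hcarrier (H i)"
    and ratio_lim: "\<And>i. i \<in> {1..<n} \<Longrightarrow>
       filterlim (\<lambda>k. real k * sqrt (a i k / a (Suc i) k)) at_top sequentially"
begin

text \<open>Towards a smaller space the assumption on the ratios of \<open>commutator_mult_zero\<close> is automatic: by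
  boundedness of the inclusion the ratios are bounded below.\<close>

lemma ratio_lim_down:
  assumes "i \<le> j" "1 \<le> i" "j \<le> n"
  shows "filterlim (\<lambda>k. real k * sqrt (a j k / a i k)) at_top sequentially"
proof -
  have ij: "i \<in> {1..n}" "j \<in> {1..n}" using assms by auto
  obtain B where B: "B \<ge> 0" "\<And>k. a i k \<le> B * a j k"
    using inclusion_imp_coeff_le[OF diag[OF ij(1)] diag[OF ij(2)] carrier_mono[OF assms]] by blast
  have pos: "a i k > 0" "a j k > 0" for k using diag_rkhs.a_pos[OF diag] ij by auto
  have "B \<noteq> 0" using B(2)[of 0] pos(1)[of 0] by auto
  then have B0: "B > 0" using B(1) by simp
  have "filterlim (\<lambda>k. sqrt (1 / B) * real k) at_top sequentially"
    by (rule filterlim_tendsto_pos_mult_at_top[OF tendsto_const _ filterlim_real_sequentially]) (use B0 in simp)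
  then show ?thesis
  proof (rule filterlim_at_top_mono, intro always_eventually allI)
    fix k
    have "1 / B \<le> a j k / a i k" using B(2)[of k] pos[of k] B0 by (simp add: field_simps)
    then show "sqrt (1 / B) * real k \<le> real k * sqrt (a j k / a i k)"
      by (subst mult.commute) (intro mult_left_mono real_sqrt_le_mono; simp)
  qed
qed

definition emb :: "nat \<Rightarrow> (complex \<Rightarrow> complex) \<Rightarrow> nat \<Rightarrow> complex \<Rightarrow> complex" where
  "emb j f = (\<lambda>k. if k = j then f else 0)"

lemma emb_mem: "j \<in> {1..n} \<Longrightarrow> f \<in> hcarrier (H j) \<Longrightarrow> emb j f \<in> DS.C"
  using complete_ips.zero_mem[OF Hi] by (auto simp: direct_sum_carrier emb_def)

lemma emb_proj_adjoint: 
  assumes j: "j \<in> {1..n}" shows "adjoint_pair (H j) DS (emb j) (\<lambda>x. x j)"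
  unfolding adjoint_pair_def
proof (intro conjI ballI)
  fix f x assume f: "f \<in> hcarrier (H j)" and x: "x \<in> DS.C"
  have "hinner DS (emb j f) x = (\<Sum>i=1..n. if i = j then hinner (H j) f (x j) else 0)"
    unfolding direct_sum_ip emb_def
    by (rule sum.cong) (use x complete_ips.ip_zero[OF Hi] in \<open>auto simp: direct_sum_carrier\<close>)
  then show "hinner DS (emb j f) x = hinner (H j) f (x j)" using j by simp
qed (use j emb_mem in \<open>auto simp: direct_sum_carrier\<close>)

lemma sum_emb: assumes "x \<in> DS.C" shows "x = (\<Sum>j=1..n. emb j (x j))"
proof
  fix k
  have s: "(\<Sum>j\<in>J. emb j (x j)) k = (\<Sum>j\<in>J. if k = j then x j else 0)" for J :: "nat set"
    by (induction J rule: infinite_finite_induct) (auto simp: emb_def)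
  show "x k = (\<Sum>j=1..n. emb j (x j)) k" unfolding s using DS_zero[OF assms] by auto
qed

lemma mat_op_emb:
  assumes "i \<in> {1..n}" "j \<in> {1..n}" shows "mat_op n A (emb j f) i = mult_op (A i j) f"
proof
  fix z
  have "(\<Sum>k=1..n. A i k z * emb j f k z) = (\<Sum>k=1..n. if k = j then A i j z * f z else 0)"
    by (rule sum.cong) (auto simp: emb_def)
  then show "mat_op n A (emb j f) i z = mult_op (A i j) f z"
    using assms by (simp add: mat_op_apply mult_op_def)
qed

lemma mult_op_upper:
  assumes "lower_tri n A" "i \<in> {1..n}" "j \<in> {1..n}" "i < j" "f \<in> hcarrier (H j)"
  shows "mult_op (A i j) f = 0"
proof
  fix z show "mult_op (A i j) f z = 0 z"
    using lower_triD(2)[OF assms(1-4), of z] diag_rkhs.mem_out[OF diag[OF assms(3)] assms(5), of z]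
    by (cases "z \<in> ball 0 1") (auto simp: mult_op_def)
qed

definition shift_tri :: "matfun \<Rightarrow> bool" where
  "shift_tri A \<longleftrightarrow> lower_tri n A \<and> (\<forall>i\<in>{1..n}. \<forall>z\<in>ball 0 1. A i i z = z) \<and>
     (\<forall>i\<in>{1..<n}. \<exists>z\<in>ball 0 1. A (Suc i) i z \<noteq> 0)"

lemma shift_tri_diag:
  assumes "shift_tri A" "i \<in> {1..n}" "f \<in> hcarrier (H i)"
  shows "mult_op (A i i) f = mult_op (\<lambda>z. z) f"
proof
  fix z show "mult_op (A i i) f z = mult_op (\<lambda>z. z) f z"
    using assms diag_rkhs.mem_out[OF diag[OF assms(2)] assms(3), of z]
    by (cases "z \<in> ball 0 1") (auto simp: mult_op_def shift_tri_def)
qed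

definition entry :: "((nat \<Rightarrow> complex \<Rightarrow> complex) \<Rightarrow> nat \<Rightarrow> complex \<Rightarrow> complex) \<Rightarrow> nat \<Rightarrow> nat \<Rightarrow> (complex \<Rightarrow> complex) \<Rightarrow> complex \<Rightarrow> complex" where
  "entry Z i j f = Z (emb j f) i"

lemma entry_bounded:
  assumes Z: "bounded_op DS DS Z" and "i \<in> {1..n}" "j \<in> {1..n}"
  shows "bounded_op (H j) (H i) (entry Z i j)"
proof -
  note ac = DS.complete_ips_axioms
  have i: "bounded_op (H j) DS (emb j)"
    using adjoint_pair_bounded[OF Hi ac emb_proj_adjoint] assms(3) by blast
  have p: "bounded_op DS (H i) (\<lambda>x. x i)"
    using adjoint_pair_bounded[OF ac Hi adjoint_pair_sym[OF Hi ac emb_proj_adjoint]] assms(2) by blast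
  show ?thesis
    using bounded_op_comp[OF Hi[OF assms(3)] ac Hi[OF assms(2)] bounded_op_comp[OF Hi[OF assms(3)] ac ac i Z] p]
    by (simp add: entry_def[abs_def])
qed

lemma op_entries:
  assumes Z: "bounded_op DS DS Z" and x: "x \<in> DS.C"
  shows "Z x i = (\<Sum>j=1..n. entry Z i j (x j))"
proof -
  have "Z x = Z (\<Sum>j=1..n. emb j (x j))" using sum_emb[OF x] by simp
  also have "\<dots> = (\<Sum>j=1..n. Z (emb j (x j)))"
    by (rule linear_op_sum[OF bounded_op_linear_op[OF Z] DS.complete_ips_axioms])
      (use x in \<open>intro emb_mem, auto simp: direct_sum_carrier\<close>)
  finally have "Z x i = (\<Sum>j=1..n. Z (emb j (x j))) i" by simp
  also have "(\<Sum>j\<in>J. Z (emb j (x j))) i = (\<Sum>j\<in>J. Z (emb j (x j)) i)" for J :: "nat set"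
    by (induction J rule: infinite_finite_induct) auto
  finally show ?thesis by (simp add: entry_def)
qed

lemma one_mem: "i \<in> {1..n} \<Longrightarrow> on_disc (\<lambda>_. 1) \<in> hcarrier (H i)"
  using diag_rkhs.pw_mem[OF diag, of i 0] diag_rkhs.pw_def[OF diag, of i 0] by simp

context
  fixes G B :: matfun and Z
  assumes G: "shift_tri G" and B: "shift_tri B" and Z: "bounded_op DS DS Z"
    and inter: "\<And>x. x \<in> DS.C \<Longrightarrow> Z (mat_op n G x) = mat_op n B (Z x)"
begin

abbreviation "Y \<equiv> entry Z"

lemma LG: "lower_tri n G" and LB: "lower_tri n B"
  using G B by (auto simp: shift_tri_def)

lemma Y_mem: "i \<in> {1..n} \<Longrightarrow> j \<in> {1..n} \<Longrightarrow> f \<in> hcarrier (H j) \<Longrightarrow> Y i j f \<in> hcarrier (H i)"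
  by (rule bounded_opD(1)[OF entry_bounded[OF Z]])

lemma Y_zero: "i \<in> {1..n} \<Longrightarrow> j \<in> {1..n} \<Longrightarrow> Y i j 0 = 0"
  by (rule linear_op_zero[OF bounded_op_linear_op[OF entry_bounded[OF Z]]])
    (auto simp: complete_ips.zero_mem[OF Hi])

lemma entry_equation:
  assumes "i \<in> {1..n}" "j \<in> {1..n}" "f \<in> hcarrier (H j)"
  shows "(\<Sum>k=j..n. Y i k (mult_op (G k j) f)) = (\<Sum>k=1..i. mult_op (B i k) (Y k j f))"
proof -
  have "Z (mat_op n G (emb j f)) i = (\<Sum>k=1..n. Y i k (mat_op n G (emb j f) k))"
    by (rule op_entries[OF Z mat_op_mem[OF LG emb_mem[OF assms(2,3)]]])
  also have "\<dots> = (\<Sum>k=1..n. Y i k (mult_op (G k j) f))"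
    by (rule sum.cong) (use mat_op_emb assms in auto)
  also have "\<dots> = (\<Sum>k=j..n. Y i k (mult_op (G k j) f))"
    by (rule sum.mono_neutral_right) (use assms mult_op_upper[OF LG] Y_zero in auto)
  finally have L: "Z (mat_op n G (emb j f)) i = (\<Sum>k=j..n. Y i k (mult_op (G k j) f))" .
  have "mat_op n B (Z (emb j f)) i = (\<Sum>k=1..n. mult_op (B i k) (Y k j f))"
    using assms by (simp add: mat_op_def op_matrix_def entry_def)
  also have "\<dots> = (\<Sum>k=1..i. mult_op (B i k) (Y k j f))"
    by (rule sum.mono_neutral_right) (use assms mult_op_upper[OF LB] Y_mem in auto)
  finally show ?thesis using L inter[OF emb_mem[OF assms(2,3)]] by simp
qed

lemma mult_op_zero [simp]: "mult_op h 0 = 0"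
  by (auto simp: mult_op_def)

text \<open>One goes through the rows downwards, and through each row from the right. When the previous
  entries vanish, \<open>Y i j\<close> commutes with the shift, so it is multiplication by some \<open>h\<close>. The equation
  one column further to the left then exhibits multiplication by \<open>- h \<cdot> G j (j - 1)\<close> as a commutator
  with the shift, from \<open>H (j - 1)\<close> to the smaller space \<open>H i\<close>. Hence this function vanishes, and so
  does \<open>h\<close>.\<close>

lemma entry_upper_zero:
  "i \<in> {1..n} \<Longrightarrow> j \<in> {1..n} \<Longrightarrow> i < j \<Longrightarrow> f \<in> hcarrier (H j) \<Longrightarrow> Y i j f = 0"
proof (induction i arbitrary: j f rule: less_induct)
  case row: (less i)
  show ?case using row.prems
  proof (induction "n - j" arbitrary: j f rule: less_induct)
    case col: (less j)
    have ij: "i \<in> {1..n}" "j \<in> {1..n}" "i < j" by fact+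
    have Yk: "Y i k g = 0" if "k \<in> {j<..n}" "g \<in> hcarrier (H k)" for k g
      by (rule col.hyps) (use that ij in auto)
    have Yr: "Y k l g = 0" if "k \<in> {1..<i}" "l \<in> {i..n}" "g \<in> hcarrier (H l)" for k l g
      by (rule row.IH) (use that ij in auto)
    have Gm: "mult_op (G k l) g \<in> hcarrier (H k)" if "l \<le> k" "k \<in> {1..n}" "l \<in> {1..n}" "g \<in> hcarrier (H l)" for k l g
      by (rule mult_mem[OF lower_triD(1)[OF LG that(2,3)] that(1)]) (use that in auto)
    have comm: "Y i j (mult_op (\<lambda>z. z) g) = mult_op (\<lambda>z. z) (Y i j g)" if g: "g \<in> hcarrier (H j)" for g
    proof -
      have "(\<Sum>k=j..n. Y i k (mult_op (G k j) g)) = (\<Sum>k\<in>{j}. Y i k (mult_op (G k j) g))"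
        by (rule sum.mono_neutral_right) (use ij g Yk Gm in auto)
      moreover have "(\<Sum>k=1..i. mult_op (B i k) (Y k j g)) = (\<Sum>k\<in>{i}. mult_op (B i k) (Y k j g))"
        by (rule sum.mono_neutral_right) (use ij g Yr in auto)
      ultimately show ?thesis using entry_equation[OF ij(1,2) g]
          shift_tri_diag[OF G ij(2) g] shift_tri_diag[OF B ij(1) Y_mem[OF ij(1,2) g]] by simp
    qed
    define h where "h = Y i j (on_disc (\<lambda>_. 1))"
    have one: "on_disc (\<lambda>_. 1) \<in> hcarrier (H j)"
      by (rule one_mem[OF ij(2)])
    have h: "Y i j g = mult_op h g" if "g \<in> hcarrier (H j)" for g unfolding h_def
      by (rule shift_intertwiner_is_mult[OF diag[OF ij(2)] diag[OF ij(1)] entry_bounded[OF Z ij(1,2)] comm that])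
    have hH: "h holomorphic_on ball 0 1" unfolding h_def
      by (rule diag_rkhs.mem_holo[OF diag[OF ij(1)] Y_mem[OF ij(1,2) one]])
    obtain m where m: "j = Suc m" using ij by (cases j) auto
    have m': "m \<in> {1..n}" "m \<in> {1..<n}" "i \<le> m" using ij m by auto
    have G_holo: "G j m holomorphic_on ball 0 1"
      using lower_triD(1)[OF LG ij(2) m'(1)] by (simp add: H_infinity_def)
    have hG: "h z * G j m z = 0" if z: "z \<in> ball 0 1" for z
    proof -
      have "- (h z * G j m z) = 0"
      proof (rule commutator_mult_zero[where u = "\<lambda>z. - (h z * G j m z)", OF diag[OF m'(1)] diag[OF ij(1)] entry_bounded[OF Z ij(1) m'(1)]])
        show "(\<lambda>z. - (h z * G j m z)) holomorphic_on ball 0 1" by (intro holomorphic_intros hH G_holo)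
        fix g assume g: "g \<in> hcarrier (H m)"
        have "(\<Sum>k=m..n. Y i k (mult_op (G k m) g)) = (\<Sum>k\<in>{m, j}. Y i k (mult_op (G k m) g))"
          by (rule sum.mono_neutral_right) (use ij m m' g Yk Gm in auto)
        moreover have "(\<Sum>k=1..i. mult_op (B i k) (Y k m g)) = (\<Sum>k\<in>{i}. mult_op (B i k) (Y k m g))"
          by (rule sum.mono_neutral_right) (use ij m' g Yr in auto)
        moreover have "Y i j (mult_op (G j m) g) = mult_op h (mult_op (G j m) g)"
          by (rule h, rule Gm) (use ij m m' g in auto)
        ultimately have "Y i m (mult_op (\<lambda>z. z) g) + mult_op h (mult_op (G j m) g) = mult_op (\<lambda>z. z) (Y i m g)"
          using entry_equation[OF ij(1) m'(1) g] m
            shift_tri_diag[OF G m'(1) g] shift_tri_diag[OF B ij(1) Y_mem[OF ij(1) m'(1) g]] by simp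
        then have "Y i m (mult_op (\<lambda>z. z) g) - mult_op (\<lambda>z. z) (Y i m g) = - mult_op h (mult_op (G j m) g)"
          by (metis add_diff_cancel_left' diff_add_cancel minus_diff_eq)
        then show "Y i m (mult_op (\<lambda>z. z) g) - mult_op (\<lambda>z. z) (Y i m g) = mult_op (\<lambda>z. - (h z * G j m z)) g"
          by (auto simp: mult_op_def fun_eq_iff)
      qed (use shift_adj_surj[OF ij(1)] ratio_lim_down[OF m'(3)] ij m' z in auto)
      then show ?thesis by simp
    qed
    have "\<exists>z\<in>ball 0 1. G j m z \<noteq> 0" using G m'(2) unfolding shift_tri_def m by blast
    then obtain z0 where "z0 \<in> ball 0 1" "G j m z0 \<noteq> 0" by blast
    then have "h z = 0" if "z \<in> ball 0 1" for z
      using holomorphic_mult_eq_0[OF hH G_holo hG] that by blast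
    then have "mult_op h f z = 0" for z
      using diag_rkhs.mem_out[OF diag[OF ij(2)] col.prems(4), of z]
      by (cases "z \<in> ball 0 1") (auto simp: mult_op_def)
    then show ?case using h[OF col.prems(4)] by auto
  qed
qed

definition symb :: "nat \<Rightarrow> complex \<Rightarrow> complex" where
  "symb i = Y i i (on_disc (\<lambda>_. 1))"

lemma mult_G_mem: "l \<le> k \<Longrightarrow> k \<in> {1..n} \<Longrightarrow> l \<in> {1..n} \<Longrightarrow> g \<in> hcarrier (H l) \<Longrightarrow> mult_op (G k l) g \<in> hcarrier (H k)"
  by (rule mult_mem[OF lower_triD(1)[OF LG]]) auto

lemma entry_diag:
  assumes i: "i \<in> {1..n}" and f: "f \<in> hcarrier (H i)"
  shows "Y i i f = mult_op (symb i) f"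
  unfolding symb_def
proof (rule shift_intertwiner_is_mult[OF diag[OF i] diag[OF i] entry_bounded[OF Z i i] _ f])
  fix g assume g: "g \<in> hcarrier (H i)"
  have "(\<Sum>k=i..n. Y i k (mult_op (G k i) g)) = (\<Sum>k\<in>{i}. Y i k (mult_op (G k i) g))"
    by (rule sum.mono_neutral_right) (use i g entry_upper_zero mult_G_mem in auto)
  moreover have "(\<Sum>k=1..i. mult_op (B i k) (Y k i g)) = (\<Sum>k\<in>{i}. mult_op (B i k) (Y k i g))"
    by (rule sum.mono_neutral_right) (use i g entry_upper_zero in auto)
  ultimately show "Y i i (mult_op (\<lambda>z. z) g) = mult_op (\<lambda>z. z) (Y i i g)"
    using entry_equation[OF i i g] shift_tri_diag[OF G i g] shift_tri_diag[OF B i Y_mem[OF i i g]] by simp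
qed

lemma symb_H_infinity: assumes i: "i \<in> {1..n}" shows "symb i \<in> H_infinity"
proof -
  have "symb i holomorphic_on ball 0 1" unfolding symb_def
    by (rule diag_rkhs.mem_holo[OF diag[OF i] Y_mem[OF i i one_mem[OF i]]])
  then have "symb i \<in> Mult (H i)"
    using entry_diag[OF i] Y_mem[OF i i] by (auto simp: Mult_def)
  then show ?thesis using Mult_eq[OF i] by simp
qed

text \<open>By triangularity the difference of the two sides is a commutator with the shift, from \<open>H i\<close> to
  \<open>H (Suc i)\<close>. This is where the growth condition on the kernels enters.\<close>

lemma symb_equation:
  assumes i: "i \<in> {1..<n}" and z: "z \<in> ball 0 1"
  shows "B (Suc i) i z * symb i z = symb (Suc i) z * G (Suc i) i z"
proof -
  have i': "i \<in> {1..n}" "Suc i \<in> {1..n}" using i by auto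
  have holo: "B (Suc i) i holomorphic_on ball 0 1" "G (Suc i) i holomorphic_on ball 0 1"
    "symb i holomorphic_on ball 0 1" "symb (Suc i) holomorphic_on ball 0 1"
    using lower_triD(1)[OF LB i'(2,1)] lower_triD(1)[OF LG i'(2,1)] symb_H_infinity i'
    by (auto simp: H_infinity_def)
  have "B (Suc i) i z * symb i z - symb (Suc i) z * G (Suc i) i z = 0"
  proof (rule commutator_mult_zero[where u = "\<lambda>z. B (Suc i) i z * symb i z - symb (Suc i) z * G (Suc i) i z",
        OF diag[OF i'(1)] diag[OF i'(2)] entry_bounded[OF Z i'(2,1)]])
    show "(\<lambda>z. B (Suc i) i z * symb i z - symb (Suc i) z * G (Suc i) i z) holomorphic_on ball 0 1"
      by (intro holomorphic_intros holo)
    fix g assume g: "g \<in> hcarrier (H i)"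
    have "(\<Sum>k=i..n. Y (Suc i) k (mult_op (G k i) g)) = (\<Sum>k\<in>{i, Suc i}. Y (Suc i) k (mult_op (G k i) g))"
      by (rule sum.mono_neutral_right) (use i' g entry_upper_zero mult_G_mem in auto)
    moreover have "(\<Sum>k=1..Suc i. mult_op (B (Suc i) k) (Y k i g)) = (\<Sum>k\<in>{i, Suc i}. mult_op (B (Suc i) k) (Y k i g))"
      by (rule sum.mono_neutral_right) (use i' g entry_upper_zero in auto)
    ultimately have "Y (Suc i) i (mult_op (\<lambda>z. z) g) + mult_op (symb (Suc i)) (mult_op (G (Suc i) i) g)
       = mult_op (B (Suc i) i) (mult_op (symb i) g) + mult_op (\<lambda>z. z) (Y (Suc i) i g)"
      using entry_equation[OF i'(2,1) g] shift_tri_diag[OF G i'(1) g]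
        shift_tri_diag[OF B i'(2) Y_mem[OF i'(2,1) g]] entry_diag[OF i'(1) g]
        entry_diag[OF i'(2) mult_G_mem[OF _ i'(2,1) g]] by simp
    then show "Y (Suc i) i (mult_op (\<lambda>z. z) g) - mult_op (\<lambda>z. z) (Y (Suc i) i g)
        = mult_op (\<lambda>z. B (Suc i) i z * symb i z - symb (Suc i) z * G (Suc i) i z) g"
      by (auto simp: mult_op_def fun_eq_iff algebra_simps)
  qed (use shift_adj_surj[OF i'(2)] ratio_lim[OF i] z in auto)
  then show ?thesis by simp
qed

end

text \<open>Both \<open>Z\<close> and its inverse intertwine, so both are triangular and their diagonal symbols are
  reciprocal multipliers. Multipliers are bounded, so the symbols are bounded below as well.\<close>

lemma similar_shift_tri:
  assumes G: "shift_tri G" and B: "shift_tri B" and inv: "inverse_ops DS Z W"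
    and inter: "\<And>x. x \<in> DS.C \<Longrightarrow> Z (mat_op n G x) = mat_op n B (Z x)"
  obtains x where "\<And>i. i \<in> {1..n} \<Longrightarrow> x i \<in> Hinf_units"
    "\<And>i z. i \<in> {1..<n} \<Longrightarrow> z \<in> ball 0 1 \<Longrightarrow> B (Suc i) i z * x i z = x (Suc i) z * G (Suc i) i z"
proof -
  have Z: "bounded_op DS DS Z" and W: "bounded_op DS DS W"
    and ZW: "\<And>x. x \<in> DS.C \<Longrightarrow> W (Z x) = x \<and> Z (W x) = x"
    using inv by (auto simp: inverse_ops_def)
  have LG: "lower_tri n G" using G by (simp add: shift_tri_def)
  have inter': "W (mat_op n B x) = mat_op n G (W x)" if x: "x \<in> DS.C" for x
  proof -
    have Wx: "W x \<in> DS.C" by (rule bounded_opD(1)[OF W x])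
    then have "W (mat_op n B x) = W (Z (mat_op n G (W x)))" using inter[OF Wx] ZW[OF x] by simp
    then show ?thesis using ZW[OF mat_op_mem[OF LG Wx]] by simp
  qed
  let ?x = "symb Z" and ?y = "symb W"
  have xy: "?x i z * ?y i z = 1" if i: "i \<in> {1..n}" and z: "z \<in> ball 0 1" for i z
  proof -
    let ?o = "on_disc (\<lambda>_. 1)"
    have o: "?o \<in> hcarrier (H i)" by (rule one_mem[OF i])
    have m: "W (emb i ?o) \<in> DS.C" by (rule bounded_opD(1)[OF W emb_mem[OF i o]])
    have "?o = Z (W (emb i ?o)) i" using ZW[OF emb_mem[OF i o]] by (simp add: emb_def)
    also have "\<dots> = (\<Sum>k=1..n. entry Z i k (entry W k i ?o))"
      using op_entries[OF Z m] by (simp add: entry_def)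
    also have "\<dots> = (\<Sum>k\<in>{i}. entry Z i k (entry W k i ?o))"
    proof (rule sum.mono_neutral_right)
      show "\<forall>k\<in>{1..n} - {i}. entry Z i k (entry W k i ?o) = 0"
      proof
        fix k assume k: "k \<in> {1..n} - {i}"
        then have k': "k \<in> {1..n}" by auto
        show "entry Z i k (entry W k i ?o) = 0"
        proof (cases "k < i")
          case True
          then have "entry W k i ?o = 0" using entry_upper_zero[OF B G W inter'] k' i o by blast
          then show ?thesis using Y_zero[OF G B Z inter i k'] by simp
        next
          case False
          then show ?thesis
            using entry_upper_zero[OF G B Z inter i k'] Y_mem[OF B G W inter' k' i o] k by auto
        qed
      qed
    qed (use i in auto)
    also have "\<dots> = mult_op (?x i) (mult_op (?y i) ?o)"
      using entry_diag[OF G B Z inter i] entry_diag[OF B G W inter' i o] Y_mem[OF B G W inter' i i o] by simp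
    finally have "?o z = mult_op (?x i) (mult_op (?y i) ?o) z" by simp
    then show ?thesis using z by (simp add: mult_op_def)
  qed
  have "?x i \<in> Hinf_units" if i: "i \<in> {1..n}" for i
  proof -
    obtain M where M: "M > 0" "\<And>z. z \<in> ball 0 1 \<Longrightarrow> cmod (?y i z) \<le> M"
      using H_infinityE[OF symb_H_infinity[OF B G W inter' i]] by metis
    have "1 / M \<le> cmod (?x i z)" if z: "z \<in> ball 0 1" for z
    proof -
      have "1 = cmod (?x i z) * cmod (?y i z)" using xy[OF i z] by (metis norm_mult norm_one)
      also have "\<dots> \<le> cmod (?x i z) * M" by (rule mult_left_mono[OF M(2)[OF z]]) simp
      finally show ?thesis using M(1) by (simp add: field_simps)
    qed
    then show ?thesis using symb_H_infinity[OF G B Z inter i] M(1)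
      by (auto simp: Hinf_units_def intro!: exI[of _ "1 / M"])
  qed
  then show ?thesis using that symb_equation[OF G B Z inter] by blast
qed

end

section \<open>Moebius maps\<close>

lemma MoebI:
  assumes "\<phi> holomorphic_on ball 0 1" "\<eta> holomorphic_on ball 0 1"
    "\<And>z. z \<in> ball 0 1 \<Longrightarrow> \<phi> z \<in> ball 0 1" "\<And>z. z \<in> ball 0 1 \<Longrightarrow> \<eta> z \<in> ball 0 1"
    "\<And>z. z \<in> ball 0 1 \<Longrightarrow> \<eta> (\<phi> z) = z" "\<And>z. z \<in> ball 0 1 \<Longrightarrow> \<phi> (\<eta> z) = z"
  shows "\<phi> \<in> Moeb"
  unfolding Moeb_def using assms by blast

lemma Moeb_inverse:
  assumes "\<phi> \<in> Moeb"
  obtains \<eta> where "\<eta> \<in> Moeb" "\<And>z. z \<in> ball 0 1 \<Longrightarrow> \<eta> (\<phi> z) = z" "\<And>z. z \<in> ball 0 1 \<Longrightarrow> \<phi> (\<eta> z) = z"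
proof -
  obtain \<eta> where \<eta>: "\<eta> holomorphic_on ball 0 1" "\<eta> ` ball 0 1 \<subseteq> ball 0 1"
      "\<forall>z\<in>ball 0 1. \<eta> (\<phi> z) = z \<and> \<phi> (\<eta> z) = z"
    using assms unfolding Moeb_def by blast
  have "\<eta> \<in> Moeb" using \<eta> assms unfolding Moeb_def by blast
  then show ?thesis using that \<eta>(3) by blast
qed

lemma Moeb_holo: "\<phi> \<in> Moeb \<Longrightarrow> \<phi> holomorphic_on ball 0 1"
  by (simp add: Moeb_def)

lemma Moeb_compose:
  assumes "\<phi> \<in> Moeb" "\<psi> \<in> Moeb" shows "(\<lambda>z. \<phi> (\<psi> z)) \<in> Moeb"
proof -
  obtain \<eta> where \<eta>: "\<eta> \<in> Moeb" "\<And>z. z \<in> ball 0 1 \<Longrightarrow> \<eta> (\<phi> z) = z" "\<And>z. z \<in> ball 0 1 \<Longrightarrow> \<phi> (\<eta> z) = z"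
    using Moeb_inverse[OF assms(1)] by metis
  obtain \<theta> where \<theta>: "\<theta> \<in> Moeb" "\<And>z. z \<in> ball 0 1 \<Longrightarrow> \<theta> (\<psi> z) = z" "\<And>z. z \<in> ball 0 1 \<Longrightarrow> \<psi> (\<theta> z) = z"
    using Moeb_inverse[OF assms(2)] by metis
  have holo: "(\<lambda>z. f (g z)) holomorphic_on ball 0 1" if "f \<in> Moeb" "g \<in> Moeb" for f g
  proof -
    have "g ` ball 0 1 \<subseteq> ball 0 1" using Moeb_mem[OF that(2)] by blast
    from holomorphic_on_compose_gen[OF Moeb_holo[OF that(2)] Moeb_holo[OF that(1)] this]
    show ?thesis by (simp add: o_def)
  qed
  show ?thesis
    by (rule MoebI[of _ "\<lambda>z. \<theta> (\<eta> z)"])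
      (use assms \<eta> \<theta> Moeb_mem holo in \<open>simp_all del: mem_ball\<close>)
qed

lemma disc_conj_holo:
  assumes "f holomorphic_on ball 0 1" shows "disc_conj f holomorphic_on ball 0 1"
proof -
  have "\<exists>D. (disc_conj f has_field_derivative D) (at z)" if z: "z \<in> ball 0 1" for z
  proof -
    have "(f has_field_derivative deriv f (cnj z)) (at (cnj z))"
      using holomorphic_derivI[OF assms open_ball, of "cnj z"] z by simp
    then show ?thesis using disc_conj_DERIV by blast
  qed
  then show ?thesis by (simp add: holomorphic_on_open)
qed

lemma disc_conj_Moeb:
  assumes "\<phi> \<in> Moeb" shows "disc_conj \<phi> \<in> Moeb"
proof -
  obtain \<eta> where \<eta>: "\<eta> \<in> Moeb" "\<And>z. z \<in> ball 0 1 \<Longrightarrow> \<eta> (\<phi> z) = z" "\<And>z. z \<in> ball 0 1 \<Longrightarrow> \<phi> (\<eta> z) = z"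
    using Moeb_inverse[OF assms] by metis
  show ?thesis
    by (rule MoebI[of _ "disc_conj \<eta>"])
      (use \<eta> Moeb_mem[OF assms] Moeb_mem[OF \<eta>(1)] disc_conj_holo[OF Moeb_holo[OF assms]]
          disc_conj_holo[OF Moeb_holo[OF \<eta>(1)]] in \<open>auto simp: disc_conj_def\<close>)
qed

lemma disc_conj_disc_conj [simp]: "disc_conj (disc_conj f) = f"
  by (auto simp: disc_conj_def)

lemma Moebius_function_Moeb: "cmod w < 1 \<Longrightarrow> Moebius_function 0 w \<in> Moeb"
  by (rule MoebI[of _ "Moebius_function 0 (- w)"])
    (auto intro!: Moebius_function_holomorphic Moebius_function_norm_lt_1 Moebius_function_compose)

lemma rotation_Moeb: 
  assumes "cmod c = 1" shows "(\<lambda>z. c * z) \<in> Moeb"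
proof (rule MoebI[of _ "\<lambda>z. z / c"])
  have "c \<noteq> 0" using assms by auto
  then show "(\<lambda>z. z / c) holomorphic_on ball 0 1" by (intro holomorphic_intros) auto
qed (use assms in \<open>auto simp: norm_mult norm_divide intro!: holomorphic_intros\<close>)

lemma Moeb_transitive:
  assumes "v \<in> ball 0 1" "w \<in> ball 0 1"
  obtains \<phi> where "\<phi> \<in> Moeb" "\<phi> v = w"
  using that[of "\<lambda>z. Moebius_function 0 (- w) (Moebius_function 0 v z)"]
    Moeb_compose[OF Moebius_function_Moeb[of "- w"] Moebius_function_Moeb[of v]] assms
  by (simp add: Moebius_function_eq_zero Moebius_function_of_zero)

lemma Moeb_deriv_nonzero:
  assumes "\<phi> \<in> Moeb" "z \<in> ball 0 1" shows "deriv \<phi> z \<noteq> 0"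
proof
  assume d0: "deriv \<phi> z = 0"
  obtain \<eta> where \<eta>: "\<eta> \<in> Moeb" "\<And>z. z \<in> ball 0 1 \<Longrightarrow> \<eta> (\<phi> z) = z"
    using Moeb_inverse[OF assms(1)] by metis
  have "(\<phi> has_field_derivative deriv \<phi> z) (at z)"
    by (rule holomorphic_derivI[OF Moeb_holo[OF assms(1)] open_ball assms(2)])
  moreover have "(\<eta> has_field_derivative deriv \<eta> (\<phi> z)) (at (\<phi> z))"
    by (rule holomorphic_derivI[OF Moeb_holo[OF \<eta>(1)] open_ball Moeb_mem[OF assms]])
  ultimately have "(\<eta> \<circ> \<phi> has_field_derivative deriv \<eta> (\<phi> z) * deriv \<phi> z) (at z)"
    by (rule DERIV_chain[rotated])
  then have "((\<lambda>z. z) has_field_derivative deriv \<eta> (\<phi> z) * deriv \<phi> z) (at z)"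
    by (rule has_field_derivative_transform_within_open[OF _ open_ball assms(2)]) (simp add: \<eta>(2) del: mem_ball)
  then have "deriv \<eta> (\<phi> z) * deriv \<phi> z = 1" using DERIV_unique[OF _ DERIV_ident] by blast
  then show False using d0 by simp
qed

text \<open>After the zero of \<open>\<phi>\<close> has been moved to the origin, the Schwarz lemma for \<open>\<phi>\<close> and for its inverse
  leaves only rotations.\<close>

lemma Moeb_explicit:
  assumes "\<phi> \<in> Moeb"
  obtains c b where "cmod c = 1" "cmod b < 1" "\<And>z. z \<in> ball 0 1 \<Longrightarrow> \<phi> z = c * (z - b) / (1 - cnj b * z)"
proof -
  obtain \<eta> where \<eta>: "\<eta> \<in> Moeb" "\<And>z. z \<in> ball 0 1 \<Longrightarrow> \<eta> (\<phi> z) = z" "\<And>z. z \<in> ball 0 1 \<Longrightarrow> \<phi> (\<eta> z) = z"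
    using Moeb_inverse[OF assms] by metis
  define b where "b = \<eta> 0"
  have b: "cmod b < 1" using Moeb_mem[OF \<eta>(1), of 0] by (simp add: b_def)
  have \<phi>b: "\<phi> b = 0" using \<eta>(3)[of 0] by (simp add: b_def)
  define f where "f = (\<lambda>z. \<phi> (Moebius_function 0 (- b) z))"
  define g where "g = (\<lambda>z. Moebius_function 0 b (\<eta> z))"
  have f: "f \<in> Moeb" and g: "g \<in> Moeb"
    unfolding f_def g_def using b
    by (simp_all add: Moeb_compose[OF assms Moebius_function_Moeb] Moeb_compose[OF Moebius_function_Moeb \<eta>(1)])
  have f0: "f 0 = 0" "g 0 = 0"
    by (simp_all add: f_def g_def Moebius_function_of_zero Moebius_function_eq_zero \<phi>b b_def[symmetric])
  have gf: "g (f z) = z" if "z \<in> ball 0 1" for z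
  proof -
    have m: "Moebius_function 0 (- b) z \<in> ball 0 1" using Moebius_function_norm_lt_1[of "- b" z 0] b that by simp
    show ?thesis using \<eta>(2)[OF m] Moebius_function_compose[of b "- b" z] b that by (simp add: f_def g_def)
  qed
  have le: "cmod (h z) \<le> cmod z" if "h \<in> Moeb" "h 0 = 0" "z \<in> ball 0 1" for h z
    using Schwarz_Lemma(1)[OF Moeb_holo[OF that(1)] that(2), of z] Moeb_mem[OF that(1)] that(3) by simp
  have eq: "cmod (f z) = cmod z" if z: "z \<in> ball 0 1" for z
    using le[OF f f0(1) z] le[OF g f0(2) Moeb_mem[OF f z]] gf[OF z] by simp
  have "\<exists>\<alpha>. (\<forall>z. cmod z < 1 \<longrightarrow> f z = \<alpha> * z) \<and> cmod \<alpha> = 1"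
  proof (rule Schwarz_Lemma(3)[OF Moeb_holo[OF f] f0(1), of 0])
    show "(\<exists>z. cmod z < 1 \<and> z \<noteq> 0 \<and> cmod (f z) = cmod z) \<or> cmod (deriv f 0) = 1"
      by (intro disjI1 exI[of _ "1/2"]) (use eq[of "1/2"] in auto)
  qed (use Moeb_mem[OF f] in auto)
  then obtain c where c: "\<And>z. z \<in> ball 0 1 \<Longrightarrow> f z = c * z" "cmod c = 1" by auto
  have "\<phi> z = c * (z - b) / (1 - cnj b * z)" if z: "z \<in> ball 0 1" for z
  proof -
    have m: "Moebius_function 0 b z \<in> ball 0 1" using Moebius_function_norm_lt_1[of b z 0] b z by simp
    have "\<phi> z = f (Moebius_function 0 b z)"
      using Moebius_function_compose[of "- b" b z] b z by (simp add: f_def)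
    then show ?thesis using c(1)[OF m] by (simp add: Moebius_function_simple)
  qed
  then show ?thesis using that b c(2) by blast
qed

section \<open>Weak homogeneity\<close>

text \<open>Let \<open>\<theta> = disc_conj \<phi>\<close>. The adjoints of \<open>T\<close> and \<open>\<phi>(T)\<close> are multiplication by \<open>G\<close> and by
  \<open>B = \<theta>(G)\<close>. Composition with \<open>\<theta>\<close> is invertible by Moebius invariance and conjugates the former
  into multiplication by \<open>G \<circ> \<theta>\<close>. The matrices \<open>B\<close> and \<open>G \<circ> \<theta>\<close> both have the diagonal \<open>\<theta>\<close> and units below it, so
  \<open>lower_tri_intertwiner\<close> conjugates one into the other.\<close>

lemma (in rkhs_tower) weakly_homogeneous_if_unit_subdiagonal:
  assumes G: "lower_tri n G" and G_diag: "\<And>i z. i \<in> {1..n} \<Longrightarrow> G i i z = z"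
    and TG: "adjoint_pair DS DS T (mat_op n G)"
    and unit: "\<And>i. i \<in> {1..<n} \<Longrightarrow> G (Suc i) i \<in> Hinf_units"
  shows "weakly_homogeneous DS T"
  unfolding weakly_homogeneous_def
proof (intro conjI ballI)
  note ac = DS.complete_ips_axioms
  note sym = adjoint_pair_sym[OF ac ac]
  show T: "bounded_op DS DS T" by (rule adjoint_pair_bounded[OF ac ac TG])
  show "op_spectrum DS T \<subseteq> cball 0 1"
  proof
    fix w assume w: "w \<in> op_spectrum DS T"
    show "w \<in> cball 0 1"
    proof (rule ccontr)
      assume "w \<notin> cball 0 1"
      then have "poly [:- w, 1:] z \<noteq> 0" if "z \<in> cball 0 1" for z using that by auto
      then obtain R where R: "inverse_ops DS (poly_op [:- w, 1:] T) R"
        using poly_op_inverse[OF G G_diag TG] by blast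
      have "poly_op [:- w, 1:] T = (\<lambda>x. T x - w *\<^sub>C x)"
        by (auto simp: poly_op_def cv.scale_minus_left cv.scale_one fun_eq_iff)
      then show False using R w by (auto simp: op_spectrum_def)
    qed
  qed
  fix \<phi> assume \<phi>: "\<phi> \<in> Moeb"
  obtain c b where cb: "cmod c = 1" "cmod b < 1" "\<And>z. z \<in> ball 0 1 \<Longrightarrow> \<phi> z = c * (z - b) / (1 - cnj b * z)"
    using Moeb_explicit[OF \<phi>] by metis
  define p q where "p = [:- c * b, c:]" "q = [:1, - cnj b:]"
  have q: "poly q z \<noteq> 0" if "z \<in> cball 0 1" for z
  proof
    assume "poly q z = 0"
    then have "cnj b * z = 1" by (simp add: p_q_def mult.commute)
    then have "cmod b * cmod z = 1" by (metis complex_mod_cnj norm_mult norm_one)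
    moreover have "cmod b * cmod z \<le> cmod b * 1" using that by (intro mult_left_mono) auto
    ultimately show False using cb(2) by simp
  qed
  have \<phi>_pq: "\<phi> z = poly p z / poly q z" if "z \<in> ball 0 1" for z
    using cb(3)[OF that] by (simp add: p_q_def algebra_simps)
  define S where "S x = poly_op p T (inv_into DS.C (poly_op q T) x)" for x
  have S: "is_fun_of_op DS T \<phi> S" unfolding is_fun_of_op_def using q \<phi>_pq S_def by blast
  define \<theta> where "\<theta> = disc_conj \<phi>"
  have \<theta>: "\<theta> \<in> Moeb" unfolding \<theta>_def by (rule disc_conj_Moeb[OF \<phi>])
  have \<theta>': "\<theta> holomorphic_on ball 0 1" "\<theta> ` ball 0 1 \<subseteq> ball 0 1"
    using Moeb_holo[OF \<theta>] Moeb_mem[OF \<theta>] by auto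
  obtain B where B: "lower_tri n B" "adjoint_pair DS DS S (mat_op n B)"
    "\<And>i z. i \<in> {1..n} \<Longrightarrow> z \<in> ball 0 1 \<Longrightarrow> B i i z = \<theta> z"
    "\<And>i z. i \<in> {1..<n} \<Longrightarrow> z \<in> ball 0 1 \<Longrightarrow> B (Suc i) i z = deriv \<theta> z * G (Suc i) i z"
    using function_of_op_adjoint[OF G G_diag TG S] unfolding \<theta>_def by blast
  let ?N = "\<lambda>i j z. G i j (\<theta> z)"
  have LN: "lower_tri n ?N" by (rule lower_tri_compose[OF G \<theta>'])
  note Qb = disc_conj_poly_unit[OF q]
  have sub: "B (Suc i) i \<in> Hinf_units \<and> ?N (Suc i) i \<in> Hinf_units" if i: "i \<in> {1..<n}" for i
  proof
    \<comment> \<open>\<open>?k / (1 - b z)\<^sup>2\<close> is the derivative of \<open>\<theta>\<close>\<close>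
    let ?k = "cnj c * (1 - cnj b * b)"
    have "c \<noteq> 0" using cb(1) by auto
    moreover have "1 - cnj b * b \<noteq> 0" using q[of b] cb(2) by (simp add: p_q_def mult.commute)
    ultimately have k: "?k \<noteq> 0" by simp
    show "B (Suc i) i \<in> Hinf_units"
    proof (rule Hinf_units_cong[OF Hinf_units_mult[OF Hinf_units_divide[OF Hinf_units_const[OF k]
            Hinf_units_mult[OF Qb Qb]] unit[OF i]]])
      fix z :: complex assume z: "z \<in> ball 0 1"
      have Q: "disc_conj (poly q) v = 1 - b * v" for v by (simp add: p_q_def disc_conj_def mult.commute)
      have \<theta>_eq: "\<theta> v = cnj c * (v - cnj b) / (1 - b * v)" if "v \<in> ball 0 1" for v
        using cb(3)[of "cnj v"] that by (simp add: \<theta>_def disc_conj_def)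
      have "1 - b * z \<noteq> 0" using Hinf_units_nz[OF Qb z] by (simp add: Q)
      then have "((\<lambda>v. cnj c * (v - cnj b) / (1 - b * v)) has_field_derivative ?k / ((1 - b * z) * (1 - b * z))) (at z)"
        by (auto intro!: derivative_eq_intros simp: field_simps)
      then have "(\<theta> has_field_derivative ?k / ((1 - b * z) * (1 - b * z))) (at z)"
        by (rule has_field_derivative_transform_within_open[OF _ open_ball z]) (simp add: \<theta>_eq del: mem_ball)
      then show "B (Suc i) i z = ?k / (disc_conj (poly q) z * disc_conj (poly q) z) * G (Suc i) i z"
        using B(4)[OF i z] by (simp add: Q DERIV_imp_deriv)
    qed
    show "?N (Suc i) i \<in> Hinf_units" by (rule Hinf_units_compose[OF unit[OF i] \<theta>'])
  qed
  obtain X where X: "lower_tri n X" "\<And>i. i \<in> {1..n} \<Longrightarrow> X i i \<in> Hinf_units" "meq n (mmul n B X) (mmul n X ?N)"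
    using lower_tri_intertwiner[OF B(1) LN _ sub, of \<theta>] B(3) G_diag by blast
  obtain E where E: "inverse_ops DS (mat_op n X) (mat_op n E)" using mat_op_inverse[OF X(1,2)] by blast
  obtain \<eta> where \<eta>: "\<eta> \<in> Moeb" "\<And>z. z \<in> ball 0 1 \<Longrightarrow> \<eta> (\<theta> z) = z" "\<And>z. z \<in> ball 0 1 \<Longrightarrow> \<theta> (\<eta> z) = z"
    using Moeb_inverse[OF \<theta>] by metis
  have "inverse_ops DS (comp_op \<theta>) (comp_op \<eta>)"
    by (rule comp_op_inverse[OF \<theta> \<eta>(1)]) (use \<eta> in auto)
  note inv = inverse_ops_comp[OF this E]
  have "mat_op n X (comp_op \<theta> (mat_op n G x)) = mat_op n B (mat_op n X (comp_op \<theta> x))" if x: "x \<in> DS.C" for x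
  proof -
    have cx: "comp_op \<theta> x \<in> DS.C" by (rule bounded_opD(1)[OF comp_op_bounded[OF \<theta>] x])
    have "mat_op n X (comp_op \<theta> (mat_op n G x)) = mat_op n (mmul n X ?N) (comp_op \<theta> x)"
      by (simp add: comp_op_mat_op[OF \<theta>] mat_op_mmul)
    also have "\<dots> = mat_op n (mmul n B X) (comp_op \<theta> x)" by (rule mat_op_cong[OF X(3) cx, symmetric])
    finally show ?thesis by (simp add: mat_op_mmul)
  qed
  then have "similar_ops DS (mat_op n G) (mat_op n B)" using inv unfolding similar_ops_def by blast
  then have "similar_ops DS S T" by (rule similar_ops_adjoint[OF ac sym[OF TG] sym[OF B(2)]])
  with S show "\<exists>S. is_fun_of_op DS T \<phi> S \<and> similar_ops DS S T" by blast
qed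

text \<open>Similarity of \<open>T\<close> and \<open>\<phi>(T)\<close> for \<open>\<phi> = disc_conj \<theta>\<close> makes multiplication by \<open>G\<close> and by
  \<open>B = \<theta>(G)\<close> similar. Composition with \<open>\<theta>\<^sup>-\<^sup>1\<close> turns the diagonal \<open>\<theta>\<close> of \<open>B\<close> into \<open>z\<close>, so that
  \<open>similar_shift_tri\<close> compares the entries below the diagonals.\<close>

lemma (in rkhs_tower_rigid) weakly_homogeneous_relation:
  assumes G: "shift_tri G" and G_diag: "\<And>i z. i \<in> {1..n} \<Longrightarrow> G i i z = z"
    and TG: "adjoint_pair DS DS T (mat_op n G)"
    and wh: "weakly_homogeneous DS T" and \<theta>: "\<theta> \<in> Moeb" and i: "i \<in> {1..<n}"
  obtains x y where "x \<in> Hinf_units" "y \<in> Hinf_units"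
    "\<And>v. v \<in> ball 0 1 \<Longrightarrow> deriv \<theta> v * G (Suc i) i v * x v = y v * G (Suc i) i (\<theta> v)"
proof -
  note ac = DS.complete_ips_axioms
  have LG: "lower_tri n G" using G by (simp add: shift_tri_def)
  obtain S where S: "is_fun_of_op DS T (disc_conj \<theta>) S" and sim: "similar_ops DS S T"
    using wh disc_conj_Moeb[OF \<theta>] unfolding weakly_homogeneous_def by blast
  obtain B where B: "lower_tri n B" "adjoint_pair DS DS S (mat_op n B)"
    "\<And>i z. i \<in> {1..n} \<Longrightarrow> z \<in> ball 0 1 \<Longrightarrow> B i i z = \<theta> z"
    "\<And>i z. i \<in> {1..<n} \<Longrightarrow> z \<in> ball 0 1 \<Longrightarrow> B (Suc i) i z = deriv \<theta> z * G (Suc i) i z"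
    using function_of_op_adjoint[OF LG G_diag TG S] unfolding disc_conj_disc_conj by blast
  have "similar_ops DS (mat_op n G) (mat_op n B)" by (rule similar_ops_adjoint[OF ac B(2) TG sim])
  then obtain Z W where ZW: "inverse_ops DS Z W" "\<And>x. x \<in> DS.C \<Longrightarrow> Z (mat_op n G x) = mat_op n B (Z x)"
    unfolding similar_ops_def by blast
  obtain \<eta> where \<eta>: "\<eta> \<in> Moeb" "\<And>z. z \<in> ball 0 1 \<Longrightarrow> \<eta> (\<theta> z) = z" "\<And>z. z \<in> ball 0 1 \<Longrightarrow> \<theta> (\<eta> z) = z"
    using Moeb_inverse[OF \<theta>] by metis
  have "inverse_ops DS (comp_op \<eta>) (comp_op \<theta>)"
    by (rule comp_op_inverse[OF \<eta>(1) \<theta>]) (use \<eta> in auto)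
  note inv = inverse_ops_comp[OF ZW(1) this]
  let ?B = "\<lambda>i j z. B i j (\<eta> z)"
  have sB: "shift_tri ?B" unfolding shift_tri_def
  proof (intro conjI ballI)
    show "lower_tri n ?B"
      by (rule lower_tri_compose[OF B(1) Moeb_holo[OF \<eta>(1)]]) (use Moeb_mem[OF \<eta>(1)] in auto)
    show "B k k (\<eta> z) = z" if "k \<in> {1..n}" "z \<in> ball 0 1" for k z
      using B(3)[OF that(1) Moeb_mem[OF \<eta>(1) that(2)]] \<eta>(3)[OF that(2)] by simp
    fix k assume k: "k \<in> {1..<n}"
    then obtain v where v: "v \<in> ball 0 1" "G (Suc k) k v \<noteq> 0" using G unfolding shift_tri_def by blast
    then have "B (Suc k) k (\<eta> (\<theta> v)) \<noteq> 0"
      using B(4)[OF k v(1)] Moeb_deriv_nonzero[OF \<theta> v(1)] \<eta>(2)[OF v(1)] by simp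
    then show "\<exists>z\<in>ball 0 1. B (Suc k) k (\<eta> z) \<noteq> 0" using Moeb_mem[OF \<theta> v(1)] by blast
  qed
  have inter: "comp_op \<eta> (Z (mat_op n G x)) = mat_op n ?B (comp_op \<eta> (Z x))" if "x \<in> DS.C" for x
    by (simp add: ZW(2)[OF that] comp_op_mat_op[OF \<eta>(1)])
  obtain x where x: "\<And>i. i \<in> {1..n} \<Longrightarrow> x i \<in> Hinf_units"
    "\<And>i z. i \<in> {1..<n} \<Longrightarrow> z \<in> ball 0 1 \<Longrightarrow> ?B (Suc i) i z * x i z = x (Suc i) z * G (Suc i) i z"
    using similar_shift_tri[OF G sB inv inter] by blast
  have \<theta>': "\<theta> holomorphic_on ball 0 1" "\<theta> ` ball 0 1 \<subseteq> ball 0 1"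
    using Moeb_holo[OF \<theta>] Moeb_mem[OF \<theta>] by auto
  have i': "i \<in> {1..n}" "Suc i \<in> {1..n}" using i by auto
  show ?thesis
  proof (rule that)
    show "(\<lambda>z. x i (\<theta> z)) \<in> Hinf_units" "(\<lambda>z. x (Suc i) (\<theta> z)) \<in> Hinf_units"
      by (rule Hinf_units_compose[OF x(1)[OF i'(1)] \<theta>'], rule Hinf_units_compose[OF x(1)[OF i'(2)] \<theta>'])
    show "deriv \<theta> v * G (Suc i) i v * x i (\<theta> v) = x (Suc i) (\<theta> v) * G (Suc i) i (\<theta> v)" if "v \<in> ball 0 1" for v
      using x(2)[OF i Moeb_mem[OF \<theta> that]] B(4)[OF i that] \<eta>(2)[OF that] by simp
  qed
qed

lemma zero_on_cball_if_zero_on_ball: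
  fixes f :: "complex \<Rightarrow> complex"
  assumes "continuous_on (cball 0 1) f" "\<And>z. z \<in> ball 0 1 \<Longrightarrow> f z = 0" "z \<in> cball 0 1"
  shows "f z = 0"
proof (rule continuous_constant_on_closure[of "ball 0 1" f 0 z])
  show "continuous_on (closure (ball 0 1)) f" "z \<in> closure (ball 0 1)" using assms by (simp_all add: closure_ball)
qed (use assms in auto)

text \<open>The relation makes the zero set of \<open>f\<close> invariant under Moebius maps. By transitivity a zero in
  the disc makes \<open>f\<close> vanish on the disc. For a zero on the circle only rotations are used, whose
  derivative is constant: the estimate extends to the circle by continuity, \<open>f\<close> vanishes on the
  whole circle, and the maximum principle applies.\<close>

lemma zero_free_if_Moebius_quasi_invariant:
  assumes cont: "continuous_on (cball 0 1) f" and holo: "f holomorphic_on ball 0 1"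
    and nz: "\<exists>z\<in>cball 0 1. f z \<noteq> 0"
    and rel: "\<And>\<theta>. \<theta> \<in> Moeb \<Longrightarrow> \<exists>x\<in>Hinf_units. \<exists>y\<in>Hinf_units.
        \<forall>v\<in>ball 0 1. deriv \<theta> v * f v * x v = y v * f (\<theta> v)"
    and z: "z \<in> cball 0 1"
  shows "f z \<noteq> 0"
proof
  assume fz: "f z = 0"
  have "f v = 0" if v: "v \<in> cball 0 1" for v
  proof (cases "z \<in> ball 0 1")
    case True
    show ?thesis
    proof (rule zero_on_cball_if_zero_on_ball[OF cont _ v])
      fix v :: complex assume v: "v \<in> ball 0 1"
      obtain \<theta> where \<theta>: "\<theta> \<in> Moeb" "\<theta> v = z" using Moeb_transitive[OF v True] by metis
      obtain x y where xy: "x \<in> Hinf_units" "\<forall>v\<in>ball 0 1. deriv \<theta> v * f v * x v = y v * f (\<theta> v)"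
        using rel[OF \<theta>(1)] by blast
      have "deriv \<theta> v * f v * x v = 0" using xy(2) v \<theta>(2) fz by simp
      then show "f v = 0" using Moeb_deriv_nonzero[OF \<theta>(1) v] Hinf_units_nz[OF xy(1) v] by simp
    qed
  next
    case False
    then have z1: "cmod z = 1" using z by simp
    have circ: "f u = 0" if u: "cmod u = 1" for u
    proof -
      define c where "c = z / u"
      have u0: "u \<noteq> 0" using u by auto
      have c: "cmod c = 1" "c * u = z" using u0 u z1 by (simp_all add: c_def norm_divide)
      obtain x y where x: "x \<in> Hinf_units" and y: "y \<in> Hinf_units"
        and xy: "\<And>v. v \<in> ball 0 1 \<Longrightarrow> deriv (\<lambda>z. c * z) v * f v * x v = y v * f (c * v)"
        using rel[OF rotation_Moeb[OF c(1)]] by blast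
      obtain M where M: "M > 0" "\<And>z. z \<in> ball 0 1 \<Longrightarrow> cmod (y z) \<le> M"
        using H_infinityE[OF Hinf_units_mem[OF y]] by metis
      obtain d where d: "d > 0" "\<And>z. z \<in> ball 0 1 \<Longrightarrow> d \<le> cmod (x z)"
        using x by (auto simp: Hinf_units_def)
      have ineq: "d * cmod (f v) \<le> M * cmod (f (c * v))" if v: "v \<in> ball 0 1" for v
      proof -
        have "deriv (\<lambda>z. c * z) v = c" by (rule DERIV_imp_deriv) (auto intro!: derivative_eq_intros)
        then have "cmod (x v) * cmod (f v) = cmod (y v) * cmod (f (c * v))"
          using arg_cong[OF xy[OF v], of cmod] c(1) by (simp add: norm_mult mult.commute)
        moreover have "d * cmod (f v) \<le> cmod (x v) * cmod (f v)" by (rule mult_right_mono[OF d(2)[OF v]]) simp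
        moreover have "cmod (y v) * cmod (f (c * v)) \<le> M * cmod (f (c * v))" by (rule mult_right_mono[OF M(2)[OF v]]) simp
        ultimately show ?thesis by simp
      qed
      have "d * cmod (f u) - M * cmod (f (c * u)) \<le> 0"
      proof (rule continuous_le_on_closure[of "ball 0 1" "\<lambda>v. d * cmod (f v) - M * cmod (f (c * v))"])
        have "continuous_on (cball 0 1) (\<lambda>v. f (c * v))"
          by (rule continuous_on_compose2[OF cont]) (use c(1) in \<open>auto intro!: continuous_intros simp: norm_mult\<close>)
        then show "continuous_on (closure (ball 0 1)) (\<lambda>v. d * cmod (f v) - M * cmod (f (c * v)))"
          using cont by (auto intro!: continuous_intros simp: closure_ball)
        show "u \<in> closure (ball 0 1)" using u by (simp add: closure_ball)
      qed (use ineq in auto)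
      then have "d * cmod (f u) \<le> 0" using c(2) fz by simp
      then show ?thesis using d(1) by (simp add: mult_le_0_iff)
    qed
    have fr: "frontier (ball 0 1 :: complex set) = sphere 0 1" by (simp add: frontier_ball)
    have "cmod (f v) \<le> 0" if "v \<in> ball 0 1" for v
    proof (rule maximum_modulus_frontier[of f "ball 0 1"])
      show "f holomorphic_on interior (ball 0 1)" using holo by simp
      show "continuous_on (closure (ball 0 1)) f" using cont by (simp add: closure_ball)
      show "\<And>z. z \<in> frontier (ball 0 1) \<Longrightarrow> cmod (f z) \<le> 0" using circ by (simp add: fr)
    qed (use that in auto)
    then show ?thesis by (intro zero_on_cball_if_zero_on_ball[OF cont _ v]) simp
  qed
  then show False using nz by blast
qed

text \<open>The adjoint of \<open>\<Phi>\<close> commutes with the shift, so it is multiplication by a multiplier of \<open>H\<close>.\<close>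

lemma commutant_shift_adjoint:
  assumes H: "diag_rkhs H a" and M: "Mult H = H_infinity"
    and A: "adjoint_pair H H A (mult_op (\<lambda>z. z))" and \<Phi>: "\<Phi> \<in> commutant H A"
  obtains h where "h \<in> H_infinity" "adjoint_pair H H \<Phi> (mult_op h)"
proof -
  interpret diag_rkhs H a by fact
  have b: "bounded_op H H \<Phi>" and comm: "\<And>x. x \<in> C \<Longrightarrow> \<Phi> (A x) = A (\<Phi> x)"
    using \<Phi> by (auto simp: commutant_def)
  obtain \<Psi> where \<Psi>: "adjoint_pair H H \<Phi> \<Psi>"
    using bounded_op_adjoint[OF complete_ips_axioms complete_ips_axioms b] .
  note sym = adjoint_pair_sym[OF complete_ips_axioms complete_ips_axioms]
  have b': "bounded_op H H \<Psi>"
    by (rule adjoint_pair_bounded[OF complete_ips_axioms complete_ips_axioms sym[OF \<Psi>]])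
  have c': "\<Psi> (mult_op (\<lambda>z. z) f) = mult_op (\<lambda>z. z) (\<Psi> f)" if "f \<in> C" for f
    by (rule adjoint_pair_unique[OF complete_ips_axioms adjoint_pair_comp[OF \<Psi> A] adjoint_pair_comp[OF A \<Psi>]])
      (use comm that in auto)
  define h where "h = \<Psi> (on_disc (\<lambda>_. 1))"
  have h: "\<Psi> f = mult_op h f" if "f \<in> C" for f
    unfolding h_def by (rule shift_intertwiner_is_mult[OF H H b' c' that])
  have "h \<in> C" unfolding h_def using bounded_opD(1)[OF b'] pw_mem[of 0] by (simp add: pw_def)
  then have "h \<in> Mult H" using h bounded_opD(1)[OF b'] mem_holo by (auto simp: Mult_def)
  moreover have "adjoint_pair H H \<Phi> (mult_op h)" by (rule adjoint_pair_cong[OF \<Psi>]) (simp_all add: h)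
  ultimately show ?thesis using that M by blast
qed

theorem theorem5p1:
  fixes n :: nat
    and a :: "nat \<Rightarrow> nat \<Rightarrow> real"
    and H :: "nat \<Rightarrow> (complex \<Rightarrow> complex) hspace"
    and \<psi> :: "nat \<Rightarrow> complex \<Rightarrow> complex"
    and T :: "nat \<Rightarrow> nat \<Rightarrow> (complex \<Rightarrow> complex) \<Rightarrow> (complex \<Rightarrow> complex)"
  assumes "n \<ge> 1"
    and "\<And>i k. i \<in> {1..n} \<Longrightarrow> a i k > 0"
    and "\<And>i z w. i \<in> {1..n} \<Longrightarrow> z \<in> ball 0 1 \<Longrightarrow> w \<in> ball 0 1 \<Longrightarrow>
           summable (\<lambda>k. complex_of_real (a i k) * z ^ k * cnj w ^ k)"
    and "\<And>i. i \<in> {1..n} \<Longrightarrow> rkhs_disc (H i) (diag_kernel (a i))"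
    and "\<And>i. i \<in> {1..n} \<Longrightarrow> moebius_invariant (H i)"
    and "\<And>i. i \<in> {1..n} \<Longrightarrow> bounded_op (H i) (H i) (mult_op (\<lambda>z. z))"
    and "\<And>i. i \<in> {1..<n} \<Longrightarrow>
           filterlim (\<lambda>k. real k * sqrt (a i k / a (i + 1) k)) at_top sequentially"
    and "\<And>i. i \<in> {1..<n} \<Longrightarrow> hcarrier (H i) \<subseteq> hcarrier (H (i + 1))"
    and "\<And>i. i \<in> {1..n} \<Longrightarrow> Mult (H i) = H_infinity"
    and "\<And>i. i \<in> {1..<n} \<Longrightarrow> continuous_on (cball 0 1) (\<psi> i) \<and> \<psi> i holomorphic_on ball 0 1"
    and "\<And>i. i \<in> {1..<n} \<Longrightarrow> \<exists>z\<in>cball 0 1. \<psi> i z \<noteq> 0"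
    and "\<And>i f. i \<in> {1..n} \<Longrightarrow> f \<in> hcarrier (H i) \<Longrightarrow>
           T i i f = adjoint_op (H i) (H i) (mult_op (\<lambda>z. z)) f"
    and "\<And>i f. i \<in> {1..<n} \<Longrightarrow> f \<in> hcarrier (H (i + 1)) \<Longrightarrow>
           T i (i + 1) f = adjoint_op (H i) (H (i + 1)) (mult_op (\<psi> i)) f"
    and "condition_A n H T"
  shows "weakly_homogeneous (direct_sum n H) (op_matrix n T) \<longleftrightarrow>
         (\<forall>i\<in>{1..<n}. \<forall>z\<in>cball 0 1. \<psi> i z \<noteq> 0)"
proof -
  have FB: "FB_class n H T" using assms(14) by (simp add: condition_A_def)
  have diag: "diag_rkhs (H i) (a i)" if "i \<in> {1..n}" for i
    using that assms(2,3,4,6) by unfold_locales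
  interpret rkhs_tower n H a
    by (rule rkhs_tower.intro[OF diag]) (use assms(5,8,9) in auto)
  have T_diag: "adjoint_pair (H i) (H i) (T i i) (mult_op (\<lambda>z. z))" if i: "i \<in> {1..n}" for i
    by (rule adjoint_pair_cong[OF adjoint_pair_sym[OF Hi Hi adjoint_pair_adjoint_op[OF Hi Hi assms(6)]]])
      (use i assms(12) in auto)
  interpret rkhs_tower_rigid n H a
  proof unfold_locales
    fix i assume i: "i \<in> {1..n}"
    have "cowen_douglas_1 (H i) (T i i)" using FB i by (simp add: FB_class_def)
    then have "(\<lambda>x. T i i x - 0 *\<^sub>C x) ` hcarrier (H i) = hcarrier (H i)"
      unfolding cowen_douglas_1_def by (metis centre_in_ball zero_less_one)
    then have "T i i ` hcarrier (H i) = hcarrier (H i)" by simp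
    moreover have "T i i ` hcarrier (H i) = adjoint_op (H i) (H i) (mult_op (\<lambda>z. z)) ` hcarrier (H i)"
      by (rule image_cong[OF refl assms(12)[OF i]])
    ultimately show "adjoint_op (H i) (H i) (mult_op (\<lambda>z. z)) ` hcarrier (H i) = hcarrier (H i)" by simp
  qed (use assms(7) in auto)
  have \<psi>: "continuous_on (cball 0 1) (\<psi> i)" "\<psi> i holomorphic_on ball 0 1" "\<psi> i \<in> H_infinity" if "i \<in> {1..<n}" for i
    using assms(10)[OF that] H_infinity_cont by auto
  have T_super: "adjoint_pair (H (Suc i)) (H i) (T i (Suc i)) (mult_op (\<psi> i))" if i: "i \<in> {1..<n}" for i
  proof -
    have i': "i \<in> {1..n}" "Suc i \<in> {1..n}" using i by auto
    have "bounded_op (H i) (H (Suc i)) (mult_op (\<psi> i))"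
      by (rule mult_bounded[OF \<psi>(3)[OF i]]) (use i in auto)
    from adjoint_pair_sym[OF Hi[OF i'(1)] Hi[OF i'(2)] adjoint_pair_adjoint_op[OF Hi[OF i'(1)] Hi[OF i'(2)] this]]
    show ?thesis by (rule adjoint_pair_cong) (use assms(13)[OF i] in auto)
  qed
  have prod: "\<exists>g\<in>H_infinity. adjoint_pair (H (i + m)) (H i) (superdiag_prod T i m) (mult_op g)"
    if "i \<in> {1..n}" "i + m \<le> n" for i m
    using that(2)
  proof (induction m)
    case 0
    have "adjoint_pair (H i) (H i) (\<lambda>x. x) (mult_op (\<lambda>_. 1))" by (simp add: adjoint_pair_def mult_op_def)
    then show ?case by (intro bexI[of _ "\<lambda>_. 1"]) (simp_all add: id_def)
  next
    case (Suc m)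
    then obtain g where g: "g \<in> H_infinity" "adjoint_pair (H (i + m)) (H i) (superdiag_prod T i m) (mult_op g)" by auto
    have im: "i + m \<in> {1..<n}" using that(1) Suc.prems by auto
    have "adjoint_pair (H (Suc (i + m))) (H i) (\<lambda>x. superdiag_prod T i m (T (i + m) (Suc (i + m)) x))
        (\<lambda>y. mult_op (\<psi> (i + m)) (mult_op g y))"
      by (rule adjoint_pair_comp[OF T_super[OF im] g(2)])
    then have "adjoint_pair (H (i + Suc m)) (H i) (superdiag_prod T i (Suc m)) (mult_op (\<lambda>z. \<psi> (i + m) z * g z))"
      by (simp add: o_def mult_op_def[abs_def] mult.assoc)
    then show ?case using H_infinity_mult[OF \<psi>(3)[OF im] g(1)] by blast
  qed
  \<comment> \<open>Condition (A) makes all entries of \<open>T\<close> adjoints of multiplications by bounded functions.\<close>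
  have upper: "\<exists>g\<in>H_infinity. adjoint_pair (H j) (H i) (T i j) (mult_op g)" if ij: "1 \<le> i" "i < j" "j \<le> n" for i j
  proof -
    have i: "i \<in> {1..n}" using ij by auto
    obtain \<Phi> where \<Phi>: "\<Phi> \<in> commutant (H i) (T i i)"
      "\<And>x. x \<in> hcarrier (H j) \<Longrightarrow> T i j x = \<Phi> (superdiag_prod T i (j - i) x)"
      using assms(14) ij unfolding condition_A_def by blast
    obtain h where h: "h \<in> H_infinity" "adjoint_pair (H i) (H i) \<Phi> (mult_op h)"
      using commutant_shift_adjoint[OF diag[OF i] Mult_eq[OF i] T_diag[OF i] \<Phi>(1)] by metis
    obtain g where g: "g \<in> H_infinity" "adjoint_pair (H j) (H i) (superdiag_prod T i (j - i)) (mult_op g)"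
      using prod[OF i, of "j - i"] ij by auto
    have "adjoint_pair (H j) (H i) (T i j) (mult_op (\<lambda>z. g z * h z))"
      by (rule adjoint_pair_cong[OF adjoint_pair_comp[OF g(2) h(2)]]) (auto simp: \<Phi>(2) mult_op_def mult.assoc)
    then show ?thesis using H_infinity_mult[OF g(1) h(1)] by blast
  qed
  define E where "E i j = (SOME g. g \<in> H_infinity \<and> adjoint_pair (H j) (H i) (T i j) (mult_op g))" for i j
  have E: "E i j \<in> H_infinity" "adjoint_pair (H j) (H i) (T i j) (mult_op (E i j))"
    if "1 \<le> i" "i < j" "j \<le> n" for i j
    using someI_ex[of "\<lambda>g. g \<in> H_infinity \<and> adjoint_pair (H j) (H i) (T i j) (mult_op g)"] upper[OF that]
    unfolding E_def by blast+
  define G where "G j i = (if j < i then (\<lambda>_. 0) else if j = i then (\<lambda>z. z) else if j = Suc i then \<psi> i else E i j)" for j i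
  have LG: "lower_tri n G" unfolding lower_tri_def G_def using \<psi>(3) E(1) by auto
  have G_diag: "G i i z = z" for i z by (simp add: G_def)
  have G_sub: "G (Suc i) i = \<psi> i" for i by (simp add: G_def)
  have TG: "adjoint_pair DS DS (op_matrix n T) (mat_op n G)"
    unfolding mat_op_def
  proof (rule adjoint_pair_op_matrix[OF Hi])
    fix i j assume ij: "i \<in> {1..n}" "j \<in> {1..n}"
    show "adjoint_pair (H j) (H i) (T i j) (mult_op (G j i))"
    proof (cases i j rule: linorder_cases)
      case less
      then show ?thesis using T_super[of i] E(2)[of i j] ij by (cases "j = Suc i") (auto simp: G_def)
    next
      case equal
      then show ?thesis using T_diag[OF ij(1)] by (simp add: G_def)
    next
      case greater
      have "T i j x = 0" if "x \<in> hcarrier (H j)" for x using FB greater ij that by (auto simp: FB_class_def)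
      moreover have "mult_op (\<lambda>_. 0) f = 0" for f by (auto simp: mult_op_def)
      ultimately show ?thesis using greater complete_ips.zero_mem[OF Hi] complete_ips.ip_zero[OF Hi] ij
        by (simp add: adjoint_pair_def G_def)
    qed
  qed auto
  show ?thesis
  proof
    assume wh: "weakly_homogeneous DS (op_matrix n T)"
    have "\<exists>z\<in>ball 0 1. \<psi> i z \<noteq> 0" if "i \<in> {1..<n}" for i
      using zero_on_cball_if_zero_on_ball[OF \<psi>(1)[OF that]] assms(11)[OF that] by blast
    then have sG: "shift_tri G" using LG by (simp add: shift_tri_def G_diag G_sub)
    show "\<forall>i\<in>{1..<n}. \<forall>z\<in>cball 0 1. \<psi> i z \<noteq> 0"
    proof (intro ballI)
      fix i z assume i: "i \<in> {1..<n}" and z: "z \<in> cball (0::complex) 1"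
      show "\<psi> i z \<noteq> 0"
      proof (rule zero_free_if_Moebius_quasi_invariant[OF \<psi>(1,2)[OF i] assms(11)[OF i] _ z])
        show "\<exists>x\<in>Hinf_units. \<exists>y\<in>Hinf_units. \<forall>v\<in>ball 0 1. deriv \<theta> v * \<psi> i v * x v = y v * \<psi> i (\<theta> v)"
          if "\<theta> \<in> Moeb" for \<theta>
          using weakly_homogeneous_relation[OF sG G_diag TG wh that i] unfolding G_sub by metis
      qed
    qed
  next
    assume nz: "\<forall>i\<in>{1..<n}. \<forall>z\<in>cball 0 1. \<psi> i z \<noteq> 0"
    show "weakly_homogeneous DS (op_matrix n T)"
      by (rule weakly_homogeneous_if_unit_subdiagonal[OF LG G_diag TG])
        (use nz \<psi> Hinf_units_cont in \<open>simp add: G_sub\<close>)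
  qed
qed

end
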